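(* Let $d\ge3$ and let $D\subset\mathbb{R}^d$ be an unbounded domain in the class $\mathcal{D}$ such that $D\setminus\overline{B(0,r)}$ is a uniform domain for some $r>0$. Then $\mathbb{H}^*(D)$ consists of constant functions on $D$.
   Context: A domain is a nonempty connected open set; $B(x,r)$ is the ball in $\mathbb{R}^d$ centered at $x$ with radius $r$. For a domain $D\subset\mathbb{R}^d$, $L^p(D)$ is taken with respect to Lebesgue measure. Let $\mathrm{BL}(D)=\{u\in L^2_{loc}(D):\partial u/\partial x_i\in L^2(D),\ 1\le i\le d\}$ (distributional derivatives), $\mathbf{D}(u,v)=\int_D\nabla u\cdot\nabla v\,dx$, and $W^{1,2}(D)=\mathrm{BL}(D)\cap L^2(D)$ with norm $\|u\|_{1,2}^2=\|u\|_{L^2(D)}^2+\mathbf{D}(u,u)$. Then $(\tfrac12\mathbf{D},W^{1,2}(D))$ is a Dirichlet form on $L^2(D)$. $W^{1,2}_e(D)$ is the extended Dirichlet space of $(\tfrac12\mathbf{D},W^{1,2}(D))$: the a.e. finite functions $u$ on $D$ for which there is a $\mathbf{D}$-Cauchy sequence $\{u_n\}\subset W^{1,2}(D)$ with $u_n\to u$ a.e. It is contained in $\mathrm{BL}(D)$. $\mathbb{H}^*(D)$ is the set of $u\in\mathrm{BL}(D)$ with $\mathbf{D}(u,v)=0$ for all $v\in W^{1,2}_e(D)$ (functions identified when a.e. equal). Class $\mathcal{D}$: the domains $D\subset\mathbb{R}^d$ for which $(\tfrac12\mathbf{D},W^{1,2}(D))$ is regular on $L^2(\overline{D})$ (identified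 with $L^2(D)$, i.e. $\partial D$ carries no mass), i.e. $W^{1,2}(D)\cap C_c(\overline{D})$ is dense in $(W^{1,2}(D),\|\cdot\|_{1,2})$ and in $(C_\infty(\overline{D}),\|\cdot\|_\infty)$, where $C_c(\overline D)$ (resp. $C_\infty(\overline{D})$) is the space of continuous functions on $\overline{D}$ with compact support (resp. vanishing at infinity). Uniform domain: a domain $U\subset\mathbb{R}^d$ for which there is $C>0$ such that for all $x,y\in U$ there is a rectifiable curve $\gamma$ in $U$ connecting $x$ and $y$ with $\mathrm{length}(\gamma)\le C|x-y|$ and $\min\{|x-z|,|z-y|\}\le C\,\mathrm{dist}(z,U^c)$ for every $z\in\gamma$. *)

theory Defs
  imports "HOL-Analysis.Analysis"
begin

text \<open>
  An element of a function space on \<open>D\<close> is represented by a total function of which only the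
  values on \<open>D\<close> matter. Functions are not quotiented: all the spaces of measurable functions
  below are closed under changes on a Lebesgue null subset of \<open>D\<close>. Measurability is with
  respect to the completed measure \<^term>\<open>lebesgue_on D\<close>.
\<close>

definition is_domain :: "'a::euclidean_space set \<Rightarrow> bool" where
  "is_domain D \<longleftrightarrow> D \<noteq> {} \<and> open D \<and> connected D"


subsection \<open>Weak derivatives\<close>

primrec C_k :: "nat \<Rightarrow> ('a::euclidean_space \<Rightarrow> real) \<Rightarrow> bool" where
  "C_k 0 f \<longleftrightarrow> continuous_on UNIV f"
| "C_k (Suc k) f \<longleftrightarrow>
     (\<forall>x. f differentiable (at x)) \<and> (\<forall>i\<in>Basis. C_k k (\<lambda>x. frechet_derivative f (at x) i))"

definition test_functions :: "'a::euclidean_space set \<Rightarrow> ('a \<Rightarrow> real) set" where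
  "test_functions D =
     {\<phi>. (\<forall>k. C_k k \<phi>) \<and> compact (closure {x. \<phi> x \<noteq> 0}) \<and> closure {x. \<phi> x \<noteq> 0} \<subseteq> D}"

definition L1_loc :: "'a::euclidean_space set \<Rightarrow> ('a \<Rightarrow> real) set" where
  "L1_loc D = {u \<in> borel_measurable (lebesgue_on D).
     \<forall>K. compact K \<longrightarrow> K \<subseteq> D \<longrightarrow> integrable (lebesgue_on K) u}"

definition L2 :: "'a::euclidean_space set \<Rightarrow> ('a \<Rightarrow> real) set" where
  "L2 D = {u \<in> borel_measurable (lebesgue_on D). integrable (lebesgue_on D) (\<lambda>x. (u x)\<^sup>2)}"

definition L2_loc :: "'a::euclidean_space set \<Rightarrow> ('a \<Rightarrow> real) set" where
  "L2_loc D = {u \<in> borel_measurable (lebesgue_on D).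
     \<forall>K. compact K \<longrightarrow> K \<subseteq> D \<longrightarrow> integrable (lebesgue_on K) (\<lambda>x. (u x)\<^sup>2)}"

definition has_weak_partial ::
    "'a::euclidean_space set \<Rightarrow> 'a \<Rightarrow> ('a \<Rightarrow> real) \<Rightarrow> ('a \<Rightarrow> real) \<Rightarrow> bool" where
  "has_weak_partial D i u g \<longleftrightarrow> u \<in> L1_loc D \<and> g \<in> L1_loc D \<and>
     (\<forall>\<phi>\<in>test_functions D.
        (\<integral>x. u x * frechet_derivative \<phi> (at x) i \<partial>lebesgue_on D)
        = - (\<integral>x. g x * \<phi> x \<partial>lebesgue_on D))"

text \<open>Weak partial derivatives are unique up to null sets, so for open \<open>D\<close> the choice below
  only affects the weak gradient on a null set.\<close>

definition weak_partial :: "'a::euclidean_space set \<Rightarrow> 'a \<Rightarrow> ('a \<Rightarrow> real) \<Rightarrow> 'a \<Rightarrow> real" where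
  "weak_partial D i u = (SOME g. has_weak_partial D i u g)"

definition weak_grad :: "'a::euclidean_space set \<Rightarrow> ('a \<Rightarrow> real) \<Rightarrow> 'a \<Rightarrow> 'a" where
  "weak_grad D u x = (\<Sum>i\<in>Basis. weak_partial D i u x *\<^sub>R i)"


subsection \<open>The Dirichlet form and its function spaces\<close>

definition BL :: "'a::euclidean_space set \<Rightarrow> ('a \<Rightarrow> real) set" where
  "BL D = {u \<in> L2_loc D. \<forall>i\<in>Basis. \<exists>g\<in>L2 D. has_weak_partial D i u g}"

definition Dirichlet :: "'a::euclidean_space set \<Rightarrow> ('a \<Rightarrow> real) \<Rightarrow> ('a \<Rightarrow> real) \<Rightarrow> real" where
  "Dirichlet D u v = (\<integral>x. weak_grad D u x \<bullet> weak_grad D v x \<partial>lebesgue_on D)"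

definition W12 :: "'a::euclidean_space set \<Rightarrow> ('a \<Rightarrow> real) set" where
  "W12 D = BL D \<inter> L2 D"

definition W12_norm :: "'a::euclidean_space set \<Rightarrow> ('a \<Rightarrow> real) \<Rightarrow> real" where
  "W12_norm D u = sqrt ((\<integral>x. (u x)\<^sup>2 \<partial>lebesgue_on D) + Dirichlet D u u)"

text \<open>An a.e. finite function is represented by a real-valued one.\<close>

definition W12_ext :: "'a::euclidean_space set \<Rightarrow> ('a \<Rightarrow> real) set" where
  "W12_ext D = {u \<in> borel_measurable (lebesgue_on D).
     \<exists>f :: nat \<Rightarrow> 'a \<Rightarrow> real.
       (\<forall>n. f n \<in> W12 D) \<and>
       (\<forall>\<epsilon>>0. \<exists>N. \<forall>m\<ge>N. \<forall>n\<ge>N.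
          Dirichlet D (\<lambda>x. f m x - f n x) (\<lambda>x. f m x - f n x) < \<epsilon>) \<and>
       (AE x in lebesgue_on D. (\<lambda>n. f n x) \<longlonglongrightarrow> u x)}"

definition H_star :: "'a::euclidean_space set \<Rightarrow> ('a \<Rightarrow> real) set" where
  "H_star D = {u \<in> BL D. \<forall>v\<in>W12_ext D. Dirichlet D u v = 0}"


subsection \<open>Regularity on the closure\<close>

definition C_c_on :: "'a::euclidean_space set \<Rightarrow> ('a \<Rightarrow> real) set" where
  "C_c_on S = {f. continuous_on S f \<and> compact (S \<inter> closure {x\<in>S. f x \<noteq> 0})}"

definition C_inf_on :: "'a::euclidean_space set \<Rightarrow> ('a \<Rightarrow> real) set" where
  "C_inf_on S = {f. continuous_on S f \<and>
     (\<forall>\<epsilon>>0. \<exists>K. compact K \<and> K \<subseteq> S \<and> (\<forall>x\<in>S - K. \<bar>f x\<bar> < \<epsilon>))}"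

text \<open>The reference measure on \<^term>\<open>closure D\<close> is Lebesgue measure on \<open>D\<close> extended by zero to the
  boundary. Hence membership in \<^term>\<open>W12 D\<close> only concerns values on \<open>D\<close>, and the frontier of \<open>D\<close>
  is not required to be a Lebesgue null set.\<close>

definition class_D :: "'a::euclidean_space set \<Rightarrow> bool" where
  "class_D D \<longleftrightarrow> is_domain D \<and>
     (\<forall>u\<in>W12 D. \<forall>\<epsilon>>0. \<exists>f\<in>W12 D \<inter> C_c_on (closure D). W12_norm D (\<lambda>x. u x - f x) < \<epsilon>) \<and>
     (\<forall>g\<in>C_inf_on (closure D). \<forall>\<epsilon>>0. \<exists>f\<in>W12 D \<inter> C_c_on (closure D).
        \<forall>x\<in>closure D. \<bar>g x - f x\<bar> < \<epsilon>)"


subsection \<open>Uniform domains\<close>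

text \<open>Each partition of the unit interval is the initial segment of a monotone sequence.\<close>

definition curve_length :: "(real \<Rightarrow> 'a::euclidean_space) \<Rightarrow> ennreal" where
  "curve_length \<gamma> = (SUP (n, t) \<in> {(n::nat, t::nat \<Rightarrow> real). mono t \<and> range t \<subseteq> {0..1}}.
     \<Sum>k<n. ennreal (dist (\<gamma> (t k)) (\<gamma> (t (Suc k)))))"

definition rectifiable :: "(real \<Rightarrow> 'a::euclidean_space) \<Rightarrow> bool" where
  "rectifiable \<gamma> \<longleftrightarrow> path \<gamma> \<and> curve_length \<gamma> < \<infinity>"

text \<open>Since \<^term>\<open>infdist z {} = 0\<close>, the case of an empty complement, where the distance should be
  infinite, is treated separately.\<close>

definition uniform_domain :: "'a::euclidean_space set \<Rightarrow> bool" where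
  "uniform_domain U \<longleftrightarrow> is_domain U \<and>
     (\<exists>C>0. \<forall>x\<in>U. \<forall>y\<in>U. \<exists>\<gamma>.
        rectifiable \<gamma> \<and> path_image \<gamma> \<subseteq> U \<and> pathstart \<gamma> = x \<and> pathfinish \<gamma> = y \<and>
        curve_length \<gamma> \<le> ennreal (C * dist x y) \<and>
        (\<forall>z\<in>path_image \<gamma>. U = UNIV \<or> min (dist x z) (dist z y) \<le> C * infdist z (- U)))"

end

theory Submission
  imports Defs
begin

text \<open>
  A function \<open>u\<close> in \<open>H_star D\<close> is orthogonal, in the sense of Dirichlet integrals, to every function
  of \<open>W12 D\<close>. It would be constant at once if \<open>u\<close> itself could be used as a test function; two things
  stand in the way: \<open>u\<close> may fail to be square integrable near the boundary, and at infinity. The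
  first is cured by truncation, the second by a cutoff: for a constant \<open>c\<close> and a cutoff function \<open>\<phi>\<close>
  that passes from 1 to 0 in the shell \<open>R < |x| < 2R\<close>, the function
  \<open>v = (arctan u - arctan c) \<phi>\<close> is bounded with bounded support, and \<open>\<D>(u,v) = 0\<close> reads
    \<open>\<integral> \<phi> |\<nabla>u|^2 / (1 + u^2) = - \<integral> (arctan u - arctan c) \<nabla>u \<bullet> \<nabla>\<phi>\<close>.
  Since \<open>|\<nabla>\<phi>|\<close> is of order \<open>1/R\<close>, the right-hand side is at most a constant times
  \<open>(1/R) \<parallel>u - c\<parallel> \<parallel>\<nabla>u\<parallel>\<close> with both \<open>L2\<close> norms taken over the shell. The last factor tends to 0 as
  \<open>R\<close> grows. So \<open>u\<close> is constant as soon as the shell satisfies a Poincare inequality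
  \<open>\<parallel>u - c\<parallel> \<le> const R\<close> for a suitable \<open>c = c(R)\<close>, with a constant independent of \<open>R\<close>. Lemma
  \<open>cutoff_energy_le\<close> is the inequality that results from this choice of \<open>v\<close>, and
  \<open>H_star_imp_AE_const\<close> carries out the limit.

  The Poincare inequality (\<open>uniform_domain_Poincare\<close>) is where the uniform domain
  \<open>U = D - cball 0 r\<close> enters. Near each \<open>x \<in> U\<close> and at each scale \<open>s\<close> the uniform condition gives a deep
  point \<open>p\<close>, that is \<open>|x - p| = s\<close> and \<open>dist p (- U) \<ge> s / C\<close>, and two deep points of scale \<open>s\<close> at
  distance of order \<open>s\<close> are joined by a curve of length of order \<open>s\<close> along which the depth stays of
  order \<open>s\<close>. Integrating \<open>\<nabla>u\<close> along the curve bounds the difference of the values at the two deep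
  points by the energy of \<open>u\<close> in a ball of radius of order \<open>s\<close> around \<open>x\<close>. Telescoping over the deep
  points of \<open>x\<close> at the scales \<open>R, R/2, R/4, ...\<close> bounds \<open>|u x - c|^2\<close> by a weighted sum of such
  energies, and integration over \<open>x\<close> turns that sum into a geometric series.

  Pointwise values and pointwise gradients are available because \<open>u\<close> is harmonic. Test functions
  belong to \<open>W12 D\<close>, so \<open>u\<close> is weakly harmonic, and Weyl's lemma (\<open>harmonic_rep_AE_eq\<close>,
  \<open>harmonic_rep_has_derivative\<close>) makes it almost everywhere equal to a continuously differentiable
  function whose gradient at \<open>p\<close> is controlled by the mean energy over any ball around \<open>p\<close> whose
  threefold enlargement lies in \<open>D\<close> (\<open>harmonic_gradient_estimate\<close>). With such a representative the chain and product rules are the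
  classical ones.

  That almost everywhere constant functions belong to \<open>H_star D\<close> rests on the almost everywhere
  uniqueness of weak derivatives (\<open>has_weak_partial_AE_unique\<close>).
\<close>

section \<open>Smooth functions\<close>

text \<open>
  The family is closed under differentiation up to linear combinations, which is why the powers of
  \<open>s\<close> are divided out.
\<close>

definition flat :: "nat \<Rightarrow> real \<Rightarrow> real" where
  "flat m s = (if s > 0 then exp (- (1 / s)) / s ^ m else 0)"

lemma flat_nonneg: "0 \<le> flat m s"
  by (simp add: flat_def)

lemma flat_pos: "s > 0 \<Longrightarrow> 0 < flat m s"
  by (simp add: flat_def)

lemma flat_eq_0: "s \<le> 0 \<Longrightarrow> flat m s = 0"
  by (simp add: flat_def)

lemma power_div_fact_le_exp:
  fixes x :: real
  assumes "0 \<le> x"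
  shows "x ^ n / fact n \<le> exp x"
proof -
  obtain t where "exp x = (\<Sum>m<Suc n. x ^ m / fact m) + exp t / fact (Suc n) * x ^ Suc n"
    using Maclaurin_exp_le[of x "Suc n"] by blast
  moreover have "0 \<le> (\<Sum>m<n. x ^ m / fact m)"
    using assms by (intro sum_nonneg) auto
  moreover have "0 \<le> exp t / fact (Suc n) * x ^ Suc n"
    using assms by simp
  ultimately show ?thesis
    by simp
qed

text \<open>
  The exponential beats every power. The case \<open>n = 0\<close> shows that the functions are bounded, the case
  \<open>n = 2\<close> that they are differentiable at 0.
\<close>

lemma flat_le_power: "flat m s \<le> fact (m + n) * \<bar>s\<bar> ^ n"
proof (cases "s > 0")
  case True
  have "(1 / s) ^ (m + n) / fact (m + n) \<le> exp (1 / s)"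
    using True by (intro power_div_fact_le_exp) simp
  then have "exp (- (1 / s)) \<le> fact (m + n) * s ^ (m + n)"
    using True by (simp add: exp_minus field_simps)
  then show ?thesis
    using True by (simp add: flat_def field_simps power_add)
qed (auto simp: flat_def)

lemma flat_le_fact: "flat m s \<le> fact m"
  using flat_le_power[of m s 0] by simp

lemma has_real_derivative_flat:
  "(flat m has_real_derivative flat (m + 2) s - real m * flat (m + 1) s) (at s)"
proof -
  consider "s > 0" | "s < 0" | "s = 0"
    by linarith
  then show ?thesis
  proof cases
    case 1
    have "((\<lambda>s. exp (- (1 / s)) / s ^ m) has_real_derivative
        flat (m + 2) s - real m * flat (m + 1) s) (at s)"
    proof (cases m)
      case 0
      with 1 show ?thesis
        by (auto intro!: derivative_eq_intros simp: flat_def power2_eq_square)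
    next
      case (Suc k)
      have "((\<lambda>s. exp (- (1 / s)) / s ^ Suc k) has_real_derivative
          (exp (- (1 / s)) * (1 / s\<^sup>2) * s ^ Suc k - exp (- (1 / s)) * (real (Suc k) * s ^ k)) /
            (s ^ Suc k * s ^ Suc k)) (at s)"
      proof (rule DERIV_divide)
        show "((\<lambda>s. exp (- (1 / s))) has_real_derivative exp (- (1 / s)) * (1 / s\<^sup>2)) (at s)"
          using 1 by (auto intro!: derivative_eq_intros simp: power2_eq_square)
        show "((\<lambda>s. s ^ Suc k) has_real_derivative real (Suc k) * s ^ k) (at s)"
          using DERIV_pow[of "Suc k" s] by simp
      qed (use 1 in simp)
      moreover have "(exp (- (1 / s)) * (1 / s\<^sup>2) * s ^ Suc k - exp (- (1 / s)) * (real (Suc k) * s ^ k)) /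
            (s ^ Suc k * s ^ Suc k) = flat (m + 2) s - real m * flat (m + 1) s"
      proof -
        define E q n where "E = exp (- (1 / s))" "q = s ^ k" "n = real (Suc k)"
        have "(E * (1 / s\<^sup>2) * (s * q) - E * (n * q)) / (s * q * (s * q)) =
            E / (s * s * s * q) - n * (E / (s * s * q))"
          using 1 by (simp add: E_q_n_def(2) field_simps power2_eq_square)
        then show ?thesis
          using 1 by (simp add: flat_def Suc E_q_n_def mult.assoc)
      qed
      ultimately show ?thesis
        using Suc by simp
    qed
    then show ?thesis
      by (rule has_field_derivative_transform_within_open[of _ _ _ "{0<..}"])
        (use 1 in \<open>auto simp: flat_def\<close>)
  next
    case 2
    have "((\<lambda>s. 0) has_real_derivative flat (m + 2) s - real m * flat (m + 1) s) (at s)"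
      using 2 by (simp add: flat_def)
    then show ?thesis
      by (rule has_field_derivative_transform_within_open[of _ _ _ "{..<0}"])
        (use 2 in \<open>auto simp: flat_def\<close>)
  next
    case 3
    have "((\<lambda>h. flat m h / h) \<longlongrightarrow> 0) (at 0)"
    proof (rule Lim_null_comparison)
      have "norm (flat m h / h) \<le> fact (m + 2) * \<bar>h\<bar>" if "h \<noteq> 0" for h
      proof -
        have "flat m h \<le> fact (m + 2) * \<bar>h\<bar> * \<bar>h\<bar>"
          using flat_le_power[of m h 2] by (simp only: power2_eq_square mult.assoc)
        then show ?thesis
          using that flat_nonneg[of m h] by (simp del: fact_Suc add: divide_le_eq)
      qed
      then show "\<forall>\<^sub>F h in at 0. norm (flat m h / h) \<le> fact (m + 2) * \<bar>h\<bar>"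
        by (auto simp: eventually_at_filter simp del: fact_Suc intro!: always_eventually)
      show "((\<lambda>h. fact (m + 2) * \<bar>h\<bar>) \<longlongrightarrow> 0) (at (0::real))"
        by (auto intro!: tendsto_eq_intros)
    qed
    then show ?thesis
      using 3 by (simp add: DERIV_def flat_def)
  qed
qed

text \<open>
  An algebra of functions that contains its own partial derivatives consists of smooth functions.
  Closure under composition with \<open>flat\<close> provides compactly supported members.
\<close>

inductive_set smooth_alg :: "('a::euclidean_space \<Rightarrow> real) set" where
  const: "(\<lambda>x. c) \<in> smooth_alg"
| coord: "(\<lambda>x. x \<bullet> i) \<in> smooth_alg"
| add: "f \<in> smooth_alg \<Longrightarrow> g \<in> smooth_alg \<Longrightarrow> (\<lambda>x. f x + g x) \<in> smooth_alg"
| mult: "f \<in> smooth_alg \<Longrightarrow> g \<in> smooth_alg \<Longrightarrow> (\<lambda>x. f x * g x) \<in> smooth_alg"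
| flat: "f \<in> smooth_alg \<Longrightarrow> (\<lambda>x. flat m (f x)) \<in> smooth_alg"

lemma smooth_alg_diff: "f \<in> smooth_alg \<Longrightarrow> g \<in> smooth_alg \<Longrightarrow> (\<lambda>x. f x - g x) \<in> smooth_alg"
  using smooth_alg.add[OF _ smooth_alg.mult[OF smooth_alg.const[of "-1"]], of f g] by simp

lemma smooth_alg_sum:
  "finite I \<Longrightarrow> (\<And>i. i \<in> I \<Longrightarrow> f i \<in> smooth_alg) \<Longrightarrow> (\<lambda>x. \<Sum>i\<in>I. f i x) \<in> smooth_alg"
  by (induction I rule: finite_induct) (auto intro: smooth_alg.intros)

lemma smooth_alg_prod:
  "finite I \<Longrightarrow> (\<And>i. i \<in> I \<Longrightarrow> f i \<in> smooth_alg) \<Longrightarrow> (\<lambda>x. \<Prod>i\<in>I. f i x) \<in> smooth_alg"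
  by (induction I rule: finite_induct) (auto intro: smooth_alg.intros)

lemma smooth_alg_has_derivative:
  assumes "f \<in> smooth_alg"
  shows "\<exists>f'. (\<forall>x. (f has_derivative f' x) (at x)) \<and> (\<forall>i. (\<lambda>x. f' x i) \<in> smooth_alg)"
  using assms
proof induction
  case (const c)
  show ?case
    by (intro exI[of _ "\<lambda>x h. 0"]) (auto intro: smooth_alg.intros)
next
  case (coord i)
  show ?case
    by (intro exI[of _ "\<lambda>x h. h \<bullet> i"]) (auto intro!: smooth_alg.intros derivative_eq_intros)
next
  case (add f g)
  then obtain f' g' where
    "\<forall>x. (f has_derivative f' x) (at x)" "\<forall>i. (\<lambda>x. f' x i) \<in> smooth_alg"
    "\<forall>x. (g has_derivative g' x) (at x)" "\<forall>i. (\<lambda>x. g' x i) \<in> smooth_alg" by auto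
  then show ?case
    by (intro exI[of _ "\<lambda>x h. f' x h + g' x h"])
      (auto intro!: smooth_alg.intros has_derivative_add)
next
  case (mult f g)
  then obtain f' g' where
    "\<forall>x. (f has_derivative f' x) (at x)" "\<forall>i. (\<lambda>x. f' x i) \<in> smooth_alg"
    "\<forall>x. (g has_derivative g' x) (at x)" "\<forall>i. (\<lambda>x. g' x i) \<in> smooth_alg" by auto
  with mult.hyps show ?case
    by (intro exI[of _ "\<lambda>x h. f x * g' x h + f' x h * g x"])
      (auto intro!: smooth_alg.intros has_derivative_mult)
next
  case (flat f m)
  then obtain f' where
    f': "\<forall>x. (f has_derivative f' x) (at x)" "\<forall>i. (\<lambda>x. f' x i) \<in> smooth_alg" by auto
  show ?case
  proof (intro exI[of _ "\<lambda>x h. (flat (m + 2) (f x) - real m * flat (m + 1) (f x)) * f' x h"]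
        conjI allI)
    fix x
    have "(flat m has_derivative
        (*) (flat (m + 2) (f x) - real m * flat (m + 1) (f x))) (at (f x))"
      using has_real_derivative_flat unfolding has_field_derivative_def .
    with f'(1) show "((\<lambda>x. flat m (f x)) has_derivative
        (\<lambda>h. (flat (m + 2) (f x) - real m * flat (m + 1) (f x)) * f' x h)) (at x)"
      using has_derivative_compose[of f "f' x" x UNIV] by fast
  next
    fix i
    show "(\<lambda>x. (flat (m + 2) (f x) - real m * flat (m + 1) (f x)) * f' x i) \<in> smooth_alg"
      using f' flat.hyps by (auto intro!: smooth_alg.intros smooth_alg_diff)
  qed
qed

lemma smooth_alg_differentiable: "f \<in> smooth_alg \<Longrightarrow> f differentiable (at x)"
  using smooth_alg_has_derivative unfolding differentiable_def by blast

lemma smooth_alg_partial: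
  assumes "f \<in> smooth_alg"
  shows "(\<lambda>x. frechet_derivative f (at x) i) \<in> smooth_alg"
proof -
  obtain f' where f': "\<And>x. (f has_derivative f' x) (at x)" "\<And>i. (\<lambda>x. f' x i) \<in> smooth_alg"
    using smooth_alg_has_derivative[OF assms] by blast
  then have "frechet_derivative f (at x) = f' x" for x
    by (simp add: frechet_derivative_at[symmetric])
  with f' show ?thesis by simp
qed

text \<open>
  Every member is differentiable with partial derivatives in the algebra, so the induction on the
  order of differentiability goes through.
\<close>

lemma C_k_smooth_alg: "f \<in> smooth_alg \<Longrightarrow> C_k k f"
proof (induction k arbitrary: f)
  case 0
  then show ?case
    by (auto intro!: continuous_at_imp_continuous_on differentiable_imp_continuous_within
        smooth_alg_differentiable)
qed (auto intro: smooth_alg_differentiable smooth_alg_partial)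

section \<open>Test functions and integration by parts\<close>

lemma test_functionsI:
  assumes "\<phi> \<in> smooth_alg" "compact K" "K \<subseteq> D" "\<And>x. x \<notin> K \<Longrightarrow> \<phi> x = 0"
  shows "\<phi> \<in> test_functions D"
proof -
  have *: "closure {x. \<phi> x \<noteq> 0} \<subseteq> K"
    using assms by (intro closure_minimal) (auto intro: compact_imp_closed)
  then have "compact (closure {x. \<phi> x \<noteq> 0})"
    using assms(2) by (metis closed_closure compact_Int_closed inf.absorb_iff2)
  with * show ?thesis
    using assms C_k_smooth_alg by (auto simp: test_functions_def)
qed

lemma test_function_has_derivative:
  assumes "\<phi> \<in> test_functions D"
  shows "(\<phi> has_derivative frechet_derivative \<phi> (at x)) (at x)"
proof -
  have "C_k (Suc 0) \<phi>"
    using assms by (auto simp: test_functions_def)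
  then show ?thesis
    by (simp add: frechet_derivative_works[symmetric])
qed

lemma test_function_continuous: "\<phi> \<in> test_functions D \<Longrightarrow> continuous_on UNIV \<phi>"
  using test_function_has_derivative
  by (metis continuous_at_imp_continuous_on has_derivative_continuous)

lemma test_function_support:
  assumes "\<phi> \<in> test_functions D"
  obtains K where "compact K" "K \<subseteq> D" "\<And>x. x \<notin> K \<Longrightarrow> \<phi> x = 0"
    "\<And>x i. x \<notin> K \<Longrightarrow> frechet_derivative \<phi> (at x) i = 0"
proof (rule that[of "closure {x. \<phi> x \<noteq> 0}"])
  fix x assume *: "x \<notin> closure {x. \<phi> x \<noteq> 0}"
  then show "\<phi> x = 0"
    using closure_subset[of "{x. \<phi> x \<noteq> 0}"] by auto
  have "((\<lambda>x. 0::real) has_derivative (\<lambda>h. 0)) (at x)"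
    by simp
  then have "(\<phi> has_derivative (\<lambda>h. 0)) (at x)"
    by (rule has_derivative_transform_within_open[of _ _ _ _ "- closure {x. \<phi> x \<noteq> 0}"])
      (use * closure_subset[of "{x. \<phi> x \<noteq> 0}"] in auto)
  then show "frechet_derivative \<phi> (at x) i = 0" for i
    by (simp add: frechet_derivative_at[symmetric])
qed (use assms in \<open>auto simp: test_functions_def\<close>)

lemma test_function_partial:
  assumes "\<phi> \<in> test_functions D" "i \<in> Basis"
  shows "(\<lambda>x. frechet_derivative \<phi> (at x) i) \<in> test_functions D"
proof -
  let ?g = "\<lambda>x. frechet_derivative \<phi> (at x) i"
  obtain K where K: "compact K" "K \<subseteq> D" "\<And>x. x \<notin> K \<Longrightarrow> ?g x = 0"
    using test_function_support[OF assms(1)] by metis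
  have "C_k (Suc k) \<phi>" for k
    using assms by (simp add: test_functions_def)
  then have Ck: "C_k k ?g" for k
    using assms(2) by simp
  have *: "closure {x. ?g x \<noteq> 0} \<subseteq> K"
    using K by (intro closure_minimal) (auto intro: compact_imp_closed)
  then have "compact (closure {x. ?g x \<noteq> 0})"
    using K(1) by (metis closed_closure compact_Int_closed inf.absorb_iff2)
  with * K Ck show ?thesis
    by (auto simp: test_functions_def)
qed

lemma continuous_compact_support_bounded:
  fixes f :: "'a::topological_space \<Rightarrow> real"
  assumes "continuous_on UNIV f" "compact K" "\<And>x. x \<notin> K \<Longrightarrow> f x = 0"
  obtains B where "0 \<le> B" "\<And>x. \<bar>f x\<bar> \<le> B"
proof -
  have "compact (f ` K)"
    using assms by (intro compact_continuous_image) (auto intro: continuous_on_subset)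
  then obtain B where "\<forall>x\<in>K. \<bar>f x\<bar> \<le> B"
    using compact_imp_bounded bounded_iff by (metis imageI real_norm_def)
  then have "\<bar>f x\<bar> \<le> max B 0" for x
    using assms(3)[of x] by (cases "x \<in> K") force+
  then show ?thesis
    using that[of "max B 0"] by auto
qed

lemma continuous_compact_support_integrable:
  fixes f :: "'a::euclidean_space \<Rightarrow> real"
  assumes "continuous_on UNIV f" "compact K" "\<And>x. x \<notin> K \<Longrightarrow> f x = 0"
  shows "integrable lborel f"
proof -
  have "integrable lborel (\<lambda>x. indicator K x *\<^sub>R f x)"
    using assms by (intro borel_integrable_compact) (auto intro: continuous_on_subset)
  also have "(\<lambda>x. indicator K x *\<^sub>R f x) = f"
    using assms(3) by (intro ext) (simp add: indicator_def, blast)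
  finally show ?thesis .
qed

lemma lebesgue_on_integral_eq_lborel:
  fixes f :: "'a::euclidean_space \<Rightarrow> real"
  assumes "f \<in> borel_measurable borel" "D \<in> sets lebesgue" "\<And>x. x \<notin> D \<Longrightarrow> f x = 0"
  shows "(\<integral>x. f x \<partial>lebesgue_on D) = (\<integral>x. f x \<partial>lborel)"
    and "integrable (lebesgue_on D) f \<longleftrightarrow> integrable lborel f"
proof -
  have eq: "(\<lambda>x. indicator D x * f x) = f"
    using assms(3) by (intro ext) (simp add: indicator_def, blast)
  show "(\<integral>x. f x \<partial>lebesgue_on D) = (\<integral>x. f x \<partial>lborel)"
    using assms by (simp add: integral_restrict_space eq integral_completion)
  show "integrable (lebesgue_on D) f \<longleftrightarrow> integrable lborel f"
    using assms by (simp add: integrable_restrict_space eq integrable_completion)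
qed

lemma measurable_lebesgue_on_if_continuous_on:
  fixes f :: "'a::euclidean_space \<Rightarrow> real"
  shows "open D \<Longrightarrow> continuous_on D f \<Longrightarrow> f \<in> borel_measurable (lebesgue_on D)"
  by (intro continuous_imp_measurable_on_sets_lebesgue) auto

lemma measurable_lebesgue_on_if_borel:
  fixes f :: "'a::euclidean_space \<Rightarrow> 'b::real_normed_vector"
  shows "f \<in> borel_measurable borel \<Longrightarrow> f \<in> borel_measurable (lebesgue_on D)"
  by (intro measurable_restrict_space1 measurable_completion) simp

lemma continuous_on_if_has_derivative:
  "(\<And>x. x \<in> S \<Longrightarrow> (f has_derivative f' x) (at x)) \<Longrightarrow> continuous_on S f"
  by (meson continuous_at_imp_continuous_on has_derivative_continuous)

lemma lborel_integral_translate: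
  fixes f :: "'a::euclidean_space \<Rightarrow> real"
  assumes "f \<in> borel_measurable borel"
  shows "(\<integral>x. f (c + x) \<partial>lborel) = (\<integral>x. f x \<partial>lborel)"
proof -
  have "(\<integral>x. f x \<partial>lborel) = (\<integral>x. f x \<partial>distr lborel borel ((+) c))"
    by (simp add: lborel_distr_plus)
  also have "\<dots> = (\<integral>x. f (c + x) \<partial>lborel)"
    using assms by (subst integral_distr) auto
  finally show ?thesis ..
qed

text \<open>
  The difference quotients are dominated by \<open>2 G\<close>, so dominated convergence applies along every
  sequence that tends to \<open>p0\<close>.
\<close>

lemma has_derivative_integral_dominated:
  fixes f :: "'p::real_normed_vector \<Rightarrow> 'x \<Rightarrow> real"
  assumes "open P" "p0 \<in> P"
    and int: "\<And>p. p \<in> P \<Longrightarrow> integrable M (f p)"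
    and int': "\<And>h. integrable M (\<lambda>x. f' x h)"
    and deriv: "\<And>x. x \<in> space M \<Longrightarrow> ((\<lambda>p. f p x) has_derivative f' x) (at p0)"
    and lip: "\<And>x p. x \<in> space M \<Longrightarrow> p \<in> P \<Longrightarrow> \<bar>f p x - f p0 x\<bar> \<le> norm (p - p0) * G x"
    and lip': "\<And>x h. x \<in> space M \<Longrightarrow> \<bar>f' x h\<bar> \<le> norm h * G x"
    and G: "integrable M G"
  shows "((\<lambda>p. \<integral>x. f p x \<partial>M) has_derivative (\<lambda>h. \<integral>x. f' x h \<partial>M)) (at p0)"
proof (rule has_derivativeI)
  have lin: "linear (f' x)" if "x \<in> space M" for x
    using deriv[OF that] has_derivative_linear by blast
  show "bounded_linear (\<lambda>h. \<integral>x. f' x h \<partial>M)"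
  proof (rule bounded_linear_intro)
    fix h k and r :: real
    have "(\<integral>x. f' x (h + k) \<partial>M) = (\<integral>x. f' x h + f' x k \<partial>M)"
      by (intro Bochner_Integration.integral_cong) (auto simp: linear_add[OF lin])
    then show "(\<integral>x. f' x (h + k) \<partial>M) = (\<integral>x. f' x h \<partial>M) + (\<integral>x. f' x k \<partial>M)"
      using int' by simp
    have "(\<integral>x. f' x (r *\<^sub>R h) \<partial>M) = (\<integral>x. r * f' x h \<partial>M)"
      by (intro Bochner_Integration.integral_cong) (auto simp: linear_cmul[OF lin])
    then show "(\<integral>x. f' x (r *\<^sub>R h) \<partial>M) = r *\<^sub>R (\<integral>x. f' x h \<partial>M)"
      by simp
    have "norm (\<integral>x. f' x h \<partial>M) \<le> (\<integral>x. norm (f' x h) \<partial>M)"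
      by (rule integral_norm_bound)
    also have "\<dots> \<le> (\<integral>x. norm h * G x \<partial>M)"
      using int' G lip' by (intro integral_mono) auto
    finally show "norm (\<integral>x. f' x h \<partial>M) \<le> norm h * (\<integral>x. G x \<partial>M)"
      by simp
  qed
  let ?q = "\<lambda>p x. (f p x - f p0 x - f' x (p - p0)) /\<^sub>R norm (p - p0)"
  have *: "((\<lambda>p. \<integral>x. ?q p x \<partial>M) \<longlongrightarrow> 0) (at p0)"
    unfolding tendsto_at_iff_sequentially comp_def
  proof (intro allI impI)
    fix X assume X: "\<forall>i. X i \<in> UNIV - {p0}" "X \<longlonglongrightarrow> p0"
    from X(2) \<open>open P\<close> \<open>p0 \<in> P\<close> obtain N where N: "\<And>i. i \<ge> N \<Longrightarrow> X i \<in> P"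
      by (metis lim_explicit)
    have "(\<lambda>i. \<integral>x. ?q (X (i + N)) x \<partial>M) \<longlonglongrightarrow> (\<integral>x. 0 \<partial>M)"
    proof (rule integral_dominated_convergence[where w="\<lambda>x. 2 * G x"])
      show "AE x in M. (\<lambda>i. ?q (X (i + N)) x) \<longlonglongrightarrow> 0"
      proof (rule AE_I2)
        fix x assume "x \<in> space M"
        then have "((\<lambda>p. ?q p x) \<longlongrightarrow> 0) (at p0)"
          using deriv[of x] by (simp add: has_derivative_at_within)
        then have "(\<lambda>i. ?q (X i) x) \<longlonglongrightarrow> 0"
          using X unfolding tendsto_at_iff_sequentially comp_def by blast
        then show "(\<lambda>i. ?q (X (i + N)) x) \<longlonglongrightarrow> 0"
          by (rule LIMSEQ_ignore_initial_segment)
      qed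
      show "AE x in M. norm (?q (X (i + N)) x) \<le> 2 * G x" for i
      proof (rule AE_I2)
        fix x assume x: "x \<in> space M"
        let ?p = "X (i + N)"
        have "norm (?p - p0) > 0" "?p \<in> P"
          using X N by auto
        moreover have "\<bar>f ?p x - f p0 x - f' x (?p - p0)\<bar> \<le> norm (?p - p0) * (2 * G x)"
          using lip[OF x, of ?p] lip'[OF x, of "?p - p0"] \<open>?p \<in> P\<close> by (simp add: algebra_simps)
        ultimately show "norm (?q ?p x) \<le> 2 * G x"
          by (simp add: field_simps)
      qed
    qed (use int int' G N \<open>p0 \<in> P\<close> in \<open>auto intro!: borel_measurable_integrable\<close>)
    then show "(\<lambda>i. \<integral>x. ?q (X i) x \<partial>M) \<longlonglongrightarrow> 0"
      using LIMSEQ_offset[where k=N] by simp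
  qed
  have ev: "\<forall>\<^sub>F p in at p0. p \<in> P"
    using assms(1,2) by (rule eventually_at_in_open')
  show "((\<lambda>p. ((\<integral>x. f p x \<partial>M) - (\<integral>x. f p0 x \<partial>M) - (\<integral>x. f' x (p - p0) \<partial>M)) /\<^sub>R norm (p - p0))
      \<longlongrightarrow> 0) (at p0)"
  proof (rule Lim_transform_eventually[OF *])
    show "\<forall>\<^sub>F p in at p0. (\<integral>x. ?q p x \<partial>M) =
        ((\<integral>x. f p x \<partial>M) - (\<integral>x. f p0 x \<partial>M) - (\<integral>x. f' x (p - p0) \<partial>M)) /\<^sub>R norm (p - p0)"
      using ev by eventually_elim (use int int' \<open>p0 \<in> P\<close> in simp)
  qed
qed

text \<open>
  By translation invariance the integral of \<open>F (t *\<^sub>R i + x)\<close> over \<open>x\<close> is independent of \<open>t\<close>, and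
  the integral of the partial derivative is its derivative at \<open>t = 0\<close>.
\<close>

lemma integral_partial_eq_0:
  fixes F :: "'a::euclidean_space \<Rightarrow> real"
  assumes F: "\<And>x. (F has_derivative F' x) (at x)"
    and cont: "continuous_on UNIV (\<lambda>x. F' x i)"
    and K: "compact K" "\<And>x. x \<notin> K \<Longrightarrow> F x = 0"
  shows "(\<integral>x. F' x i \<partial>lborel) = 0"
proof -
  have contF: "continuous_on UNIV F"
    using F by (rule continuous_on_if_has_derivative)
  then have [measurable]: "F \<in> borel_measurable borel"
    by (rule borel_measurable_continuous_onI)
  have zero: "F' x i = 0" if "x \<notin> K" for x
  proof -
    have "(F has_derivative (\<lambda>h. 0)) (at x)"
      by (rule has_derivative_transform_within_open[of "\<lambda>x. 0" _ _ _ "- K"])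
        (use that K in \<open>auto intro: compact_imp_closed\<close>)
    then show ?thesis
      using F has_derivative_unique by metis
  qed
  obtain B where B: "0 \<le> B" "\<And>x. \<bar>F' x i\<bar> \<le> B"
    using continuous_compact_support_bounded[OF cont K(1) zero] by blast
  have line: "((\<lambda>t. F (t *\<^sub>R i + x)) has_real_derivative F' (t *\<^sub>R i + x) i) (at t)" for t x
  proof -
    have "((\<lambda>t. F (t *\<^sub>R i + x)) has_derivative (\<lambda>s. F' (t *\<^sub>R i + x) (s *\<^sub>R i))) (at t)"
      by (rule has_derivative_compose[OF _ F, where f="\<lambda>t. t *\<^sub>R i + x"])
        (auto intro!: derivative_eq_intros)
    moreover have "(\<lambda>s. F' (t *\<^sub>R i + x) (s *\<^sub>R i)) = (*) (F' (t *\<^sub>R i + x) i)"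
      using linear_cmul[OF has_derivative_linear[OF F]] by (auto simp: mult.commute)
    ultimately show ?thesis
      by (simp add: has_field_derivative_def)
  qed
  \<comment> \<open>All translates by at most one unit are supported in the compact set that follows.\<close>
  define K' where "K' = (\<lambda>(t, x). x - t *\<^sub>R i) ` (cbox (-1) (1::real) \<times> K)"
  have K': "compact K'"
    unfolding K'_def case_prod_unfold using K(1)
    by (intro compact_continuous_image compact_Times) (auto intro!: continuous_intros)
  have out: "t *\<^sub>R i + x \<notin> K" if "x \<notin> K'" "\<bar>t\<bar> \<le> 1" for t x
  proof
    assume "t *\<^sub>R i + x \<in> K"
    then have "x \<in> K'"
      using that(2) unfolding K'_def by (intro image_eqI[of _ _ "(t, t *\<^sub>R i + x)"]) auto
    with that show False by simp
  qed
  have lip: "\<bar>F (t *\<^sub>R i + x) - F x\<bar> \<le> \<bar>t\<bar> * (B * indicator K' x)" if "\<bar>t\<bar> < 1" for t x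
  proof (cases "x \<in> K'")
    case True
    have "norm (F (t *\<^sub>R i + x) - F (0 *\<^sub>R i + x)) \<le> B * norm (t - 0)"
      by (rule field_differentiable_bound[of UNIV "\<lambda>t. F (t *\<^sub>R i + x)"])
        (auto intro: B line DERIV_subset)
    with True show ?thesis by (simp add: mult.commute)
  next
    case False
    then show ?thesis
      using out[of x t] out[of x 0] that K(2) by simp
  qed
  have "((\<lambda>t. \<integral>x. F (t *\<^sub>R i + x) \<partial>lborel) has_derivative (\<lambda>h. \<integral>x. h * F' x i \<partial>lborel)) (at 0)"
  proof (rule has_derivative_integral_dominated[where P="{-1<..<1::real}" and G="\<lambda>x. B * indicator K' x"])
    fix t :: real assume "t \<in> {-1<..<1}"
    show "integrable lborel (\<lambda>x. F (t *\<^sub>R i + x))"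
      using out[of _ t] \<open>t \<in> _\<close> K(2)
      by (intro continuous_compact_support_integrable[OF _ K'] continuous_on_compose2[OF contF])
        (auto intro!: continuous_intros)
  next
    show "integrable lborel (\<lambda>x. h * F' x i)" for h
      using continuous_compact_support_integrable[OF cont K(1) zero] by simp
    show "integrable lborel (\<lambda>x. B * indicator K' x)"
      using K' emeasure_compact_finite[OF K']
      by (intro integrable_mult_right integrable_real_indicator)
        (auto simp: compact_imp_closed borel_closed)
  next
    fix x :: 'a
    have "(*) (F' x i) = (\<lambda>h. h * F' x i)"
      by (auto simp: mult.commute)
    then show "((\<lambda>t. F (t *\<^sub>R i + x)) has_derivative (\<lambda>h. h * F' x i)) (at 0)"
      using line[of x 0] by (simp add: has_field_derivative_def)
    fix h :: real
    show "\<bar>h * F' x i\<bar> \<le> norm h * (B * indicator K' x)"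
    proof (cases "x \<in> K'")
      case False
      then show ?thesis using out[of x 0] zero by simp
    qed (auto simp: abs_mult intro!: mult_left_mono B)
  qed (use lip in auto)
  moreover have "(\<lambda>t. \<integral>x. F (t *\<^sub>R i + x) \<partial>lborel) = (\<lambda>t. \<integral>x. F x \<partial>lborel)"
    by (simp add: lborel_integral_translate)
  ultimately have "((\<lambda>t::real. \<integral>x. F x \<partial>lborel) has_derivative (\<lambda>h. \<integral>x. h * F' x i \<partial>lborel)) (at 0)"
    by simp
  then have "(\<lambda>h. \<integral>x. h * F' x i \<partial>lborel) = (\<lambda>h::real. 0)"
    using has_derivative_unique has_derivative_const by blast
  from fun_cong[OF this, of 1] show ?thesis by simp
qed

section \<open>The fundamental lemma of the calculus of variations\<close>

lemma L1_loc_mult_integrable: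
  fixes u :: "'a::euclidean_space \<Rightarrow> real"
  assumes "open D" and u: "u \<in> L1_loc D"
    and \<phi>: "\<phi> \<in> borel_measurable borel" "\<And>x. \<bar>\<phi> x\<bar> \<le> B"
    and K: "compact K" "K \<subseteq> D" "\<And>x. x \<notin> K \<Longrightarrow> \<phi> x = 0"
  shows "integrable (lebesgue_on D) (\<lambda>x. u x * \<phi> x)"
proof -
  have D: "D \<in> sets lebesgue"
    using \<open>open D\<close> by auto
  have Ks: "K \<in> sets lebesgue"
    using K(1) by (intro lmeasurable_compact[THEN fmeasurableD])
  have "integrable (lebesgue_on K) u"
    using u K by (auto simp: L1_loc_def)
  then have int: "integrable lebesgue (\<lambda>x. indicator K x * u x)"
    using Ks by (simp add: integrable_restrict_space)
  have "integrable lebesgue (\<lambda>x. (indicator K x * u x) * \<phi> x)"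
  proof (rule Bochner_Integration.integrable_bound[OF integrable_mult_right[OF int, of B]])
    show "(\<lambda>x. (indicator K x * u x) * \<phi> x) \<in> borel_measurable lebesgue"
      using \<phi>(1)
      by (intro borel_measurable_times[OF borel_measurable_integrable[OF int]])
        (auto simp: measurable_completion)
    show "AE x in lebesgue. norm ((indicator K x * u x) * \<phi> x) \<le> norm (B * (indicator K x * u x))"
    proof (rule AE_I2)
      fix x
      have "\<bar>\<phi> x\<bar> \<le> \<bar>B\<bar>"
        using \<phi>(2)[of x] by linarith
      then show "norm ((indicator K x * u x) * \<phi> x) \<le> norm (B * (indicator K x * u x))"
        by (auto simp: abs_mult indicator_def mult.commute intro!: mult_right_mono)
    qed
  qed
  also have "(\<lambda>x. (indicator K x * u x) * \<phi> x) = (\<lambda>x. indicator D x * (u x * \<phi> x))"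
    using K(2,3) by (intro ext) (auto simp: indicator_def)
  finally show ?thesis
    using D by (simp add: integrable_restrict_space)
qed

lemma L1_loc_mult_continuous_integrable:
  fixes u :: "'a::euclidean_space \<Rightarrow> real"
  assumes "open D" "u \<in> L1_loc D" "continuous_on UNIV \<phi>"
    and K: "compact K" "K \<subseteq> D" "\<And>x. x \<notin> K \<Longrightarrow> \<phi> x = 0"
  shows "integrable (lebesgue_on D) (\<lambda>x. u x * \<phi> x)"
proof -
  obtain B where "\<And>x. \<bar>\<phi> x\<bar> \<le> B"
    using continuous_compact_support_bounded[OF assms(3) K(1,3)] by metis
  then show ?thesis
    using K assms by (intro L1_loc_mult_integrable) (auto intro: borel_measurable_continuous_onI)
qed

lemma L1_loc_mult_test_integrable:
  fixes u :: "'a::euclidean_space \<Rightarrow> real"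
  assumes "open D" "u \<in> L1_loc D" "\<phi> \<in> test_functions D"
  shows "integrable (lebesgue_on D) (\<lambda>x. u x * \<phi> x)"
proof -
  obtain K where "compact K" "K \<subseteq> D" "\<And>x. x \<notin> K \<Longrightarrow> \<phi> x = 0"
    using test_function_support[OF assms(3)] by metis
  then show ?thesis
    using assms test_function_continuous by (intro L1_loc_mult_continuous_integrable)
qed

lemma L1_loc_diff:
  assumes "open D" "u \<in> L1_loc D" "v \<in> L1_loc D"
  shows "(\<lambda>x. u x - v x) \<in> L1_loc D"
  using assms by (auto simp: L1_loc_def intro!: borel_measurable_diff)

text \<open>
  The indicator of the box is the bounded pointwise limit, as \<open>m\<close> tends to infinity, of the test
  functions that equal \<open>\<Prod>i. exp (- 1 / (m (x\<^sub>i - a\<^sub>i) (b\<^sub>i - x\<^sub>i)))\<close> on the box and 0 elsewhere.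
\<close>

lemma integral_box_eq_0_if_orthogonal_test_functions:
  fixes g :: "'a::euclidean_space \<Rightarrow> real"
  assumes "open D" and g: "g \<in> L1_loc D"
    and orth: "\<And>\<phi>. \<phi> \<in> test_functions D \<Longrightarrow> (\<integral>x. g x * \<phi> x \<partial>lebesgue_on D) = 0"
    and sub: "cbox a b \<subseteq> D"
  shows "(\<integral>x. g x * indicator (box a b) x \<partial>lebesgue_on D) = 0"
proof (cases "box a b = {}")
  case False
  then have less: "a \<bullet> i < b \<bullet> i" if "i \<in> Basis" for i
    using that by (auto simp: box_ne_empty)
  define \<phi> where "\<phi> m x = (\<Prod>i\<in>Basis. flat 0 (real m * ((x \<bullet> i - a \<bullet> i) * (b \<bullet> i - x \<bullet> i))))" for m x
  have zero: "\<phi> m x = 0" if out: "x \<notin> box a b" for m x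
  proof -
    obtain i where i: "i \<in> Basis" "x \<bullet> i \<le> a \<bullet> i \<or> b \<bullet> i \<le> x \<bullet> i"
      using out unfolding mem_box by (meson not_less)
    then have "(x \<bullet> i - a \<bullet> i) * (b \<bullet> i - x \<bullet> i) \<le> 0"
      using less[OF i(1)] by (auto simp: mult_le_0_iff)
    then have "flat 0 (real m * ((x \<bullet> i - a \<bullet> i) * (b \<bullet> i - x \<bullet> i))) = 0"
      by (intro flat_eq_0) (simp add: mult_nonneg_nonpos)
    with i show ?thesis
      by (auto simp: \<phi>_def)
  qed
  have alg: "\<phi> m \<in> smooth_alg" for m
    unfolding \<phi>_def by (intro smooth_alg_prod smooth_alg.flat smooth_alg.mult smooth_alg_diff
        smooth_alg.const smooth_alg.coord) simp
  have test: "\<phi> m \<in> test_functions D" for m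
    using alg zero box_subset_cbox[of a b] by (intro test_functionsI[OF _ compact_cbox sub]) auto
  have le1: "\<bar>\<phi> m x\<bar> \<le> indicator (cbox a b) x" for m x
  proof (cases "x \<in> box a b")
    case True
    have "\<bar>\<phi> m x\<bar> = \<phi> m x"
      unfolding \<phi>_def by (intro abs_of_nonneg prod_nonneg ballI flat_nonneg)
    also have "\<dots> \<le> 1"
      unfolding \<phi>_def using flat_le_fact[of 0] flat_nonneg by (intro prod_le_1) auto
    finally show ?thesis
      using True box_subset_cbox[of a b] by (auto simp: indicator_def)
  qed (simp add: zero)
  have lim: "(\<lambda>m. \<phi> m x) \<longlonglongrightarrow> indicator (box a b) x" for x
  proof (cases "x \<in> box a b")
    case True
    have "(\<lambda>m. flat 0 (real m * c)) \<longlonglongrightarrow> 1" if "c > 0" for c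
    proof (rule Lim_transform_eventually)
      have "(\<lambda>m. inverse c * (1 / real m)) \<longlonglongrightarrow> inverse c * 0"
        by (intro tendsto_mult tendsto_const lim_1_over_n)
      then have "(\<lambda>m. exp (- (inverse c * (1 / real m)))) \<longlonglongrightarrow> exp (- (inverse c * 0))"
        by (intro tendsto_intros)
      then show "(\<lambda>m. exp (- (inverse c * (1 / real m)))) \<longlonglongrightarrow> 1"
        by simp
      show "\<forall>\<^sub>F m in sequentially. exp (- (inverse c * (1 / real m))) = flat 0 (real m * c)"
        using eventually_gt_at_top[of 0]
        by eventually_elim (use that in \<open>auto simp: flat_def field_simps\<close>)
    qed
    then have "(\<lambda>m. \<phi> m x) \<longlonglongrightarrow> (\<Prod>i\<in>(Basis::'a set). 1)"
      unfolding \<phi>_def using True by (intro tendsto_prod) (auto simp: mem_box)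
    then show ?thesis using True by simp
  qed (simp add: zero)
  have m: "g \<in> borel_measurable (lebesgue_on D)"
    using g by (simp add: L1_loc_def)
  have int: "integrable (lebesgue_on D) (\<lambda>x. g x * indicator (cbox a b) x)"
    using assms(1) g sub by (intro L1_loc_mult_integrable[where B=1 and K="cbox a b"]) auto
  have "(\<lambda>m. \<integral>x. g x * \<phi> m x \<partial>lebesgue_on D) \<longlonglongrightarrow>
      (\<integral>x. g x * indicator (box a b) x \<partial>lebesgue_on D)"
  proof (rule integral_dominated_convergence[OF _ _ integrable_abs[OF int]])
    show "(\<lambda>x. g x * indicator (box a b) x) \<in> borel_measurable (lebesgue_on D)"
      by (intro borel_measurable_times[OF m measurable_lebesgue_on_if_borel]) simp
    show "(\<lambda>x. g x * \<phi> m x) \<in> borel_measurable (lebesgue_on D)" for m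
      using L1_loc_mult_test_integrable[OF assms(1) g test] by (rule borel_measurable_integrable)
    show "AE x in lebesgue_on D. (\<lambda>m. g x * \<phi> m x) \<longlonglongrightarrow> g x * indicator (box a b) x"
      by (intro AE_I2 tendsto_mult tendsto_const lim)
    show "AE x in lebesgue_on D. norm (g x * \<phi> m x) \<le> \<bar>g x * indicator (cbox a b) x\<bar>" for m
      using le1[of m] by (intro AE_I2) (auto simp: abs_mult intro!: mult_left_mono)
  qed
  then show ?thesis
    using orth[OF test] by (simp add: LIMSEQ_const_iff)
qed simp

text \<open>
  The integral of \<open>g\<close> vanishes over every box whose closure lies in \<open>D\<close>. The boxes generate the Borel
  sets, so inside each such box it vanishes over all Borel sets, and countably many boxes cover \<open>D\<close>.
\<close>

lemma AE_0_if_orthogonal_test_functions: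
  fixes g :: "'a::euclidean_space \<Rightarrow> real"
  assumes "open D" and g: "g \<in> L1_loc D"
    and orth: "\<And>\<phi>. \<phi> \<in> test_functions D \<Longrightarrow> (\<integral>x. g x * \<phi> x \<partial>lebesgue_on D) = 0"
  shows "AE x in lebesgue_on D. g x = 0"
proof -
  have D: "D \<in> sets lebesgue"
    using \<open>open D\<close> by auto
  have "(\<lambda>x. indicator D x * g x) \<in> borel_measurable lebesgue"
    using g D by (simp add: L1_loc_def borel_measurable_restrict_space_iff)
  then obtain g' where g': "g' \<in> borel_measurable lborel" "AE x in lborel. indicator D x * g x = g' x"
    using completion_ex_borel_measurable_real by blast
  have g'm[measurable]: "g' \<in> borel_measurable borel"
    using g' by simp
  have sets_box: "sets (borel :: 'a measure) = sigma_sets UNIV (range (\<lambda>(a, b). box a b))"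
    by (subst borel_eq_box) (rule sets_measure_of, simp)
  have local: "AE x in lborel. x \<in> box a b \<longrightarrow> g' x = 0" if ab: "cbox a b \<subseteq> D" for a b
  proof -
    have eq: "(\<integral>x. g x * indicator A x \<partial>lebesgue_on D) = (\<integral>x. indicator A x * g' x \<partial>lborel)"
      if [measurable]: "A \<in> sets borel" for A
    proof -
      have "(\<integral>x. g x * indicator A x \<partial>lebesgue_on D) = (\<integral>x. indicator D x * (g x * indicator A x) \<partial>lebesgue)"
        using D by (simp add: integral_restrict_space)
      also have "\<dots> = (\<integral>x. indicator A x * g' x \<partial>lebesgue)"
      proof (rule integral_cong_AE)
        have "(\<lambda>x. (indicator D x * g x) * indicator A x) \<in> borel_measurable lebesgue"
          by (intro borel_measurable_times[OF \<open>(\<lambda>x. indicator D x * g x) \<in> _\<close>])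
            (auto simp: measurable_completion)
        then show "(\<lambda>x. indicator D x * (g x * indicator A x)) \<in> borel_measurable lebesgue"
          by (simp add: mult.assoc)
        show "AE x in lebesgue. indicator D x * (g x * indicator A x) = indicator A x * g' x"
          using AE_completion[OF g'(2)] by eventually_elim (auto simp: indicator_def)
      qed (auto intro!: measurable_completion)
      also have "\<dots> = (\<integral>x. indicator A x * g' x \<partial>lborel)"
        by (intro integral_completion) auto
      finally show ?thesis .
    qed
    have box0: "(\<integral>x. indicator (box c d) x * g' x \<partial>lborel) = 0" if "box c d \<subseteq> box a b" for c d
    proof (cases "box c d = {}")
      case False
      then have "closure (box c d) \<subseteq> closure (box a b)"
        using that by (intro closure_mono)
      then have "cbox c d \<subseteq> D"
        using False that ab closure_box[of c d] closure_box[of a b] by (cases "box a b = {}") auto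
      then show ?thesis
        using integral_box_eq_0_if_orthogonal_test_functions[OF assms] eq[of "box c d"] by simp
    qed simp
    let ?f = "\<lambda>x. indicator (box a b) x * g' x"
    have "integrable (lebesgue_on D) (\<lambda>x. g x * indicator (box a b) x)"
      using assms(1) g ab box_subset_cbox[of a b]
      by (intro L1_loc_mult_integrable[where B=1 and K="cbox a b"]) (auto simp: indicator_def)
    then have "integrable lebesgue (\<lambda>x. indicator D x * (g x * indicator (box a b) x))"
      using D by (simp add: integrable_restrict_space)
    then have "integrable lebesgue ?f"
      by (rule integrable_cong_AE_imp)
        (use AE_completion[OF g'(2)] in \<open>auto simp: indicator_def elim!: eventually_mono intro!: measurable_completion\<close>)
    then have int: "integrable lborel ?f"
      by (subst (asm) integrable_completion) auto
    have int': "set_integrable lborel A ?f" if "A \<in> sets borel" for A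
      unfolding set_integrable_def using int that by (intro integrable_mult_indicator) auto
    have "AE x in lborel. ?f x = 0"
    proof (rule sigma_finite_measure.density_zero[OF sigma_finite_lborel int])
      fix A :: "'a set" assume "A \<in> sets lborel"
      then have A: "A \<in> sigma_sets UNIV (range (\<lambda>(a, b). box a b))"
        using sets_box by simp
      have "Int_stable (range (\<lambda>(a, b). box a b :: 'a set))"
      proof (rule Int_stableI)
        fix X Y :: "'a set" assume "X \<in> range (\<lambda>(a, b). box a b)" "Y \<in> range (\<lambda>(a, b). box a b)"
        then obtain p q r s where "X = box p q" "Y = box r s"
          by auto
        then show "X \<inter> Y \<in> range (\<lambda>(a, b). box a b)"
          by (auto simp: box_Int_box)
      qed
      moreover have "range (\<lambda>(a, b). box a b) \<subseteq> Pow (UNIV :: 'a set)"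
        by simp
      ultimately show "(LINT x:A|lborel. ?f x) = 0"
      using A
      proof (induction rule: sigma_sets_induct_disjoint)
        case (basic A)
        then obtain c d where "A = box c d" by auto
        moreover obtain e k where ek: "box c d \<inter> box a b = box e k"
          unfolding box_Int_box by blast
        ultimately have "(\<lambda>x. indicator A x *\<^sub>R ?f x) = (\<lambda>x. indicator (box e k) x * g' x)"
          by (auto simp: indicator_def fun_eq_iff)
        then show ?case
          using box0[of e k] ek unfolding set_lebesgue_integral_def by auto
      next
        case empty
        then show ?case by (simp add: set_lebesgue_integral_def)
      next
        case (compl A)
        have A: "A \<in> sets borel"
          using compl(1) sets_box by simp
        have "(LINT x:UNIV - A|lborel. ?f x) = (\<integral>x. ?f x - indicator A x *\<^sub>R ?f x \<partial>lborel)"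
          unfolding set_lebesgue_integral_def
          by (intro Bochner_Integration.integral_cong) (auto simp: indicator_def)
        also have "\<dots> = (\<integral>x. ?f x \<partial>lborel) - (LINT x:A|lborel. ?f x)"
          using int int'[OF A] unfolding set_lebesgue_integral_def set_integrable_def
          by (rule Bochner_Integration.integral_diff)
        also have "\<dots> = 0"
          using compl(2) box0[of a b] by simp
        finally show ?case .
      next
        case (union A)
        have A: "A i \<in> sets borel" for i
          using union(2) sets_box by auto
        then have "(LINT x:(\<Union>i. A i)|lborel. ?f x) = (\<Sum>i. LINT x:A i|lborel. ?f x)"
          using union(1)
          by (intro lebesgue_integral_countable_add int') (auto simp: disjoint_family_on_def)
        then show ?case using union(3) by simp
      qed
    qed
    then show ?thesis
      by (auto simp: indicator_def)
  qed
  let ?F = "{box a b |a b. cbox a b \<subseteq> D}"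
  obtain F' where F': "F' \<subseteq> ?F" "countable F'" "\<Union>F' = \<Union>?F"
    using Lindelof[of ?F] by (auto simp: open_box)
  have cover: "D \<subseteq> \<Union>?F"
  proof
    fix x assume "x \<in> D"
    then obtain a b where "cbox a b \<subseteq> D" "x \<in> box a b"
      using open_contains_cbox[OF \<open>open D\<close>] by metis
    then show "x \<in> \<Union>?F"
      by auto
  qed
  have "AE x in lborel. \<forall>X\<in>F'. x \<in> X \<longrightarrow> g' x = 0"
    using F' local by (subst AE_ball_countable) auto
  with g'(2) have "AE x in lborel. x \<in> D \<longrightarrow> g x = 0"
    by eventually_elim (use cover F'(3) in \<open>auto simp: indicator_def\<close>)
  then show ?thesis
    using D by (simp add: AE_restrict_space_iff AE_completion)
qed

section \<open>Weak gradients and Dirichlet integrals\<close>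

lemma has_weak_partial_AE_unique:
  fixes u :: "'a::euclidean_space \<Rightarrow> real"
  assumes "open D" "has_weak_partial D i u g" "has_weak_partial D i u h"
  shows "AE x in lebesgue_on D. g x = h x"
proof -
  have gh: "g \<in> L1_loc D" "h \<in> L1_loc D"
    using assms by (auto simp: has_weak_partial_def)
  have "AE x in lebesgue_on D. g x - h x = 0"
  proof (rule AE_0_if_orthogonal_test_functions[OF \<open>open D\<close>])
    show "(\<lambda>x. g x - h x) \<in> L1_loc D"
      using assms(1) gh by (rule L1_loc_diff)
    fix \<phi> :: "'a \<Rightarrow> real" assume \<phi>: "\<phi> \<in> test_functions D"
    have "(\<integral>x. (g x - h x) * \<phi> x \<partial>lebesgue_on D) =
        (\<integral>x. g x * \<phi> x \<partial>lebesgue_on D) - (\<integral>x. h x * \<phi> x \<partial>lebesgue_on D)"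
      using L1_loc_mult_test_integrable[OF assms(1) gh(1) \<phi>]
        L1_loc_mult_test_integrable[OF assms(1) gh(2) \<phi>]
      by (simp add: left_diff_distrib)
    also have "\<dots> = 0"
      using assms(2,3) \<phi> by (simp add: has_weak_partial_def)
    finally show "(\<integral>x. (g x - h x) * \<phi> x \<partial>lebesgue_on D) = 0" .
  qed
  then show ?thesis by simp
qed

lemma weak_partial_AE_eq:
  fixes u :: "'a::euclidean_space \<Rightarrow> real"
  assumes "open D" "has_weak_partial D i u g"
  shows "AE x in lebesgue_on D. weak_partial D i u x = g x"
    and "weak_partial D i u \<in> borel_measurable (lebesgue_on D)"
proof -
  have *: "has_weak_partial D i u (weak_partial D i u)"
    unfolding weak_partial_def using assms(2) by (rule someI[of "has_weak_partial D i u"])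
  then show "AE x in lebesgue_on D. weak_partial D i u x = g x"
    using has_weak_partial_AE_unique assms by blast
  from * show "weak_partial D i u \<in> borel_measurable (lebesgue_on D)"
    by (simp add: has_weak_partial_def L1_loc_def)
qed

text \<open>
  Makes the Dirichlet integral computable: any choice of weak partial derivatives may replace the
  one selected in its definition.
\<close>

lemma Dirichlet_eq:
  fixes u v :: "'a::euclidean_space \<Rightarrow> real"
  assumes "open D"
    and g: "\<And>i. i \<in> Basis \<Longrightarrow> has_weak_partial D i u (g i)"
    and h: "\<And>i. i \<in> Basis \<Longrightarrow> has_weak_partial D i v (h i)"
  shows "Dirichlet D u v = (\<integral>x. (\<Sum>i\<in>Basis. g i x * h i x) \<partial>lebesgue_on D)"
proof -
  have inner: "weak_grad D u x \<bullet> weak_grad D v x = (\<Sum>i\<in>Basis. weak_partial D i u x * weak_partial D i v x)" for x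
    unfolding weak_grad_def by (subst euclidean_inner) (simp add: inner_sum_left_Basis)
  have gm: "g i \<in> borel_measurable (lebesgue_on D)" "h i \<in> borel_measurable (lebesgue_on D)"
    if "i \<in> Basis" for i
    using g[OF that] h[OF that] by (auto simp: has_weak_partial_def L1_loc_def)
  have "AE x in lebesgue_on D. \<forall>i\<in>Basis. weak_partial D i u x = g i x \<and> weak_partial D i v x = h i x"
    using weak_partial_AE_eq(1)[OF assms(1) g] weak_partial_AE_eq(1)[OF assms(1) h]
    by (intro AE_finite_allI AE_conjI) auto
  then show ?thesis
    unfolding Dirichlet_def inner
    by (intro integral_cong_AE borel_measurable_sum borel_measurable_times
        weak_partial_AE_eq(2)[OF assms(1) g] weak_partial_AE_eq(2)[OF assms(1) h] gm)
      (auto elim!: eventually_mono)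
qed

lemma continuous_on_imp_L1_loc:
  fixes v :: "'a::euclidean_space \<Rightarrow> real"
  assumes "open D" "continuous_on D v"
  shows "v \<in> L1_loc D"
  unfolding L1_loc_def
proof (intro CollectI conjI allI impI)
  show "v \<in> borel_measurable (lebesgue_on D)"
    using assms by (rule measurable_lebesgue_on_if_continuous_on)
  fix K assume K: "compact K" "K \<subseteq> D"
  have "integrable lborel (\<lambda>x. indicator K x *\<^sub>R v x)"
    using K assms by (intro borel_integrable_compact) (auto intro: continuous_on_subset)
  then have "integrable lebesgue (\<lambda>x. indicator K x *\<^sub>R v x)"
    by (simp add: integrable_completion borel_measurable_integrable)
  then show "integrable (lebesgue_on K) v"
    using K by (simp add: integrable_restrict_space lmeasurable_compact[THEN fmeasurableD])
qed

text \<open>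
  The product of \<open>v\<close> and a test function, extended by 0, is continuously differentiable with compact
  support on the whole space, so the integrals of its partial derivatives vanish.
\<close>

lemma has_weak_partial_classical:
  fixes v :: "'a::euclidean_space \<Rightarrow> real"
  assumes "open D" and deriv: "\<And>x. x \<in> D \<Longrightarrow> (v has_derivative v' x) (at x)"
    and cont: "continuous_on D (\<lambda>x. v' x i)" and "i \<in> Basis"
  shows "has_weak_partial D i v (\<lambda>x. v' x i)"
proof -
  have contv: "continuous_on D v"
    using deriv by (rule continuous_on_if_has_derivative)
  have L1: "v \<in> L1_loc D" "(\<lambda>x. v' x i) \<in> L1_loc D"
    using assms contv by (auto intro: continuous_on_imp_L1_loc)
  have "(\<integral>x. v x * frechet_derivative \<phi> (at x) i \<partial>lebesgue_on D) =
      - (\<integral>x. v' x i * \<phi> x \<partial>lebesgue_on D)"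
    if \<phi>: "\<phi> \<in> test_functions D" for \<phi>
  proof -
    let ?\<phi>' = "\<lambda>x. frechet_derivative \<phi> (at x)"
    obtain K where K: "compact K" "K \<subseteq> D" "\<And>x. x \<notin> K \<Longrightarrow> \<phi> x = 0" "\<And>x i. x \<notin> K \<Longrightarrow> ?\<phi>' x i = 0"
      using test_function_support[OF \<phi>] by metis
    define F where "F x = (if x \<in> D then v x * \<phi> x else 0)" for x
    define F' where "F' x h = (if x \<in> D then v x * ?\<phi>' x h + v' x h * \<phi> x else 0)" for x h
    have "open (- K)"
      using K(1) by (auto intro: compact_imp_closed)
    have F: "(F has_derivative F' x) (at x)" for x
    proof (cases "x \<in> D")
      case True
      have "F' x = (\<lambda>h. v x * ?\<phi>' x h + v' x h * \<phi> x)"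
        using True by (simp add: F'_def fun_eq_iff)
      then have "((\<lambda>x. v x * \<phi> x) has_derivative F' x) (at x)"
        using has_derivative_mult[OF deriv[OF True] test_function_has_derivative[OF \<phi>]] by simp
      then show ?thesis
        by (rule has_derivative_transform_within_open[OF _ \<open>open D\<close> True]) (simp add: F_def)
    next
      case False
      then have "x \<in> - K" "F' x = (\<lambda>h. 0)"
        using K(2) by (auto simp: F'_def)
      have "((\<lambda>x. 0) has_derivative F' x) (at x)"
        unfolding \<open>F' x = _\<close> by simp
      then show ?thesis
        by (rule has_derivative_transform_within_open[OF _ \<open>open (- K)\<close> \<open>x \<in> - K\<close>])
          (simp add: F_def K(3))
    qed
    have c1: "continuous_on UNIV (\<lambda>x. ?\<phi>' x i)"
      using test_function_partial[OF \<phi> \<open>i \<in> Basis\<close>] by (rule test_function_continuous)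
    note c2 = test_function_continuous[OF \<phi>]
    have "continuous_on (D \<union> - K) (\<lambda>x. F' x i)"
    proof (rule continuous_on_open_Un[OF \<open>open D\<close> \<open>open (- K)\<close>])
      have "continuous_on D (\<lambda>x. v x * ?\<phi>' x i + v' x i * \<phi> x)"
        using c1 c2 contv cont by (intro continuous_intros) (auto intro: continuous_on_subset)
      then show "continuous_on D (\<lambda>x. F' x i)"
        by (simp add: F'_def cong: continuous_on_cong)
      have "continuous_on (- K) (\<lambda>x. 0::real)"
        by simp
      then show "continuous_on (- K) (\<lambda>x. F' x i)"
        by (rule continuous_on_eq) (simp add: F'_def K(3,4))
    qed
    moreover have "D \<union> - K = UNIV"
      using K(2) by auto
    ultimately have contF': "continuous_on UNIV (\<lambda>x. F' x i)"
      by simp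
    have D: "D \<in> sets lebesgue"
      using \<open>open D\<close> by auto
    have "0 = (\<integral>x. F' x i \<partial>lborel)"
      using integral_partial_eq_0[OF F contF' K(1)] K(3) by (simp add: F_def)
    also have "\<dots> = (\<integral>x. F' x i \<partial>lebesgue_on D)"
      using D contF' by (intro lebesgue_on_integral_eq_lborel(1)[symmetric] borel_measurable_continuous_onI)
        (simp_all add: F'_def)
    also have "\<dots> = (\<integral>x. v x * ?\<phi>' x i + v' x i * \<phi> x \<partial>lebesgue_on D)"
      by (intro Bochner_Integration.integral_cong) (simp_all add: F'_def)
    also have "\<dots> = (\<integral>x. v x * ?\<phi>' x i \<partial>lebesgue_on D) + (\<integral>x. v' x i * \<phi> x \<partial>lebesgue_on D)"
      by (intro Bochner_Integration.integral_add L1_loc_mult_test_integrable[OF \<open>open D\<close>] L1 \<phi>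
          test_function_partial \<open>i \<in> Basis\<close>)
    finally show ?thesis by simp
  qed
  with L1 show ?thesis
    by (simp add: has_weak_partial_def)
qed

text \<open>
  The gradient \<open>v'\<close> is carried along explicitly, since the orthogonality relation for \<open>H_star\<close> is
  used with formulas for it.
\<close>

definition C1_W12 :: "'a::euclidean_space set \<Rightarrow> ('a \<Rightarrow> real) \<Rightarrow> ('a \<Rightarrow> 'a \<Rightarrow> real) \<Rightarrow> bool" where
  "C1_W12 D v v' \<longleftrightarrow> (\<forall>x\<in>D. (v has_derivative v' x) (at x)) \<and>
     (\<forall>i\<in>Basis. continuous_on D (\<lambda>x. v' x i)) \<and>
     integrable (lebesgue_on D) (\<lambda>x. (v x)\<^sup>2) \<and>
     (\<forall>i\<in>Basis. integrable (lebesgue_on D) (\<lambda>x. (v' x i)\<^sup>2))"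

lemma C1_W12_imp_W12:
  assumes "open D" "C1_W12 D v v'"
  shows "v \<in> W12 D"
proof -
  have deriv: "(v has_derivative v' x) (at x)" if "x \<in> D" for x
    using assms(2) that by (simp add: C1_W12_def)
  have cont: "continuous_on D (\<lambda>x. v' x i)" if "i \<in> Basis" for i
    using assms(2) that by (simp add: C1_W12_def)
  have contv: "continuous_on D v"
    using deriv by (rule continuous_on_if_has_derivative)
  have L1: "v \<in> L1_loc D" "(\<lambda>x. (v x)\<^sup>2) \<in> L1_loc D"
      "\<And>i. i \<in> Basis \<Longrightarrow> (\<lambda>x. v' x i) \<in> L1_loc D"
    using assms(1) cont contv by (auto intro!: continuous_on_imp_L1_loc continuous_intros)
  then have "v \<in> L2_loc D" "v \<in> L2 D"
    using assms(2) by (auto simp: C1_W12_def L1_loc_def L2_loc_def L2_def)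
  moreover have "\<exists>g\<in>L2 D. has_weak_partial D i v g" if "i \<in> Basis" for i
    using has_weak_partial_classical[OF assms(1) deriv cont[OF that] that] assms(2) L1(3)[OF that] that
    by (intro bexI[of _ "\<lambda>x. v' x i"]) (auto simp: C1_W12_def L2_def L1_loc_def)
  ultimately show ?thesis
    by (simp add: W12_def BL_def)
qed

lemma Dirichlet_zero:
  fixes D :: "'a::euclidean_space set"
  assumes "open D"
  shows "Dirichlet D (\<lambda>x. 0) (\<lambda>x. 0) = 0"
proof -
  have "has_weak_partial D i (\<lambda>x. 0) (\<lambda>x. 0)" if "i \<in> Basis" for i :: 'a
    using has_weak_partial_classical[OF assms, of "\<lambda>x. 0" "\<lambda>x h. 0" i] that by simp
  then show ?thesis
    using Dirichlet_eq[OF assms, of "\<lambda>x. 0" "\<lambda>i x. 0" "\<lambda>x. 0" "\<lambda>i x. 0"] by simp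
qed

lemma W12_subset_W12_ext:
  fixes D :: "'a::euclidean_space set"
  assumes "open D"
  shows "W12 D \<subseteq> W12_ext D"
proof
  fix v :: "'a \<Rightarrow> real" assume "v \<in> W12 D"
  moreover from this have "v \<in> borel_measurable (lebesgue_on D)"
    by (simp add: W12_def L2_def)
  ultimately show "v \<in> W12_ext D"
    unfolding W12_ext_def using Dirichlet_zero[OF assms]
    by (intro CollectI conjI exI[of _ "\<lambda>n. v"]) auto
qed

lemma H_star_orthogonal:
  fixes v :: "'a::euclidean_space \<Rightarrow> real"
  assumes "open D" "u \<in> H_star D"
    and g: "\<And>i. i \<in> Basis \<Longrightarrow> has_weak_partial D i u (g i)"
    and v: "C1_W12 D v v'"
  shows "(\<integral>x. (\<Sum>i\<in>Basis. g i x * v' x i) \<partial>lebesgue_on D) = 0"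
proof -
  have "has_weak_partial D i v (\<lambda>x. v' x i)" if "i \<in> Basis" for i
    using v that by (intro has_weak_partial_classical assms(1)) (auto simp: C1_W12_def)
  then have "Dirichlet D u v = (\<integral>x. (\<Sum>i\<in>Basis. g i x * v' x i) \<partial>lebesgue_on D)"
    using Dirichlet_eq[OF assms(1) g, where v=v and h="\<lambda>i x. v' x i"] by simp
  moreover have "v \<in> W12_ext D"
    using C1_W12_imp_W12[OF assms(1) v] W12_subset_W12_ext[OF assms(1)] by blast
  ultimately show ?thesis
    using assms(2) by (simp add: H_star_def)
qed

text \<open>
  A weak derivative of a constant is 0, hence the selected one vanishes almost everywhere, and so
  does the integrand of every Dirichlet integral with \<open>u\<close>.
\<close>

lemma AE_const_in_H_star:
  fixes D :: "'a::euclidean_space set"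
  assumes "open D" and u: "AE x in lebesgue_on D. u x = c"
  shows "u \<in> H_star D"
proof -
  have D: "D \<in> sets lebesgue"
    using assms by auto
  have um: "u \<in> borel_measurable (lebesgue_on D)"
  proof -
    have "AE x in lebesgue. indicator D x * c = indicator D x * u x"
      using u D by (auto simp: AE_restrict_space_iff indicator_def elim!: eventually_mono)
    moreover have "(\<lambda>x. indicator D x * c) \<in> borel_measurable lebesgue"
      using D by (intro borel_measurable_times borel_measurable_indicator) auto
    ultimately have "(\<lambda>x. indicator D x * u x) \<in> borel_measurable lebesgue"
      by (rule borel_measurable_AE[rotated])
    then show ?thesis
      using D by (simp add: borel_measurable_restrict_space_iff)
  qed
  have K: "AE x in lebesgue_on K. u x = c" if "compact K" "K \<subseteq> D" for K
    using u D that lmeasurable_compact[OF that(1), THEN fmeasurableD]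
    by (auto simp: AE_restrict_space_iff elim!: eventually_mono)
  have Kc: "integrable (lebesgue_on K) f"
    if "compact K" "K \<subseteq> D" "AE x in lebesgue_on K. f x = k" "f \<in> borel_measurable (lebesgue_on D)"
    for K f and k :: real
  proof (rule integrable_cong_AE_imp)
    have Km: "K \<in> lmeasurable" using that(1) by (rule lmeasurable_compact)
    then show "integrable (lebesgue_on K) (\<lambda>x. k)"
      by (intro finite_measure.integrable_const finite_measure_lebesgue_on)
    show "f \<in> borel_measurable (lebesgue_on K)"
      using that Km D by (meson measurable_restrict_mono)
  qed (use that in \<open>auto elim!: eventually_mono\<close>)
  have L1: "u \<in> L1_loc D"
    unfolding L1_loc_def using um Kc K by blast
  have L2: "u \<in> L2_loc D"
    unfolding L2_loc_def
  proof (intro CollectI conjI allI impI um)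
    fix K assume *: "compact K" "K \<subseteq> D"
    have "AE x in lebesgue_on K. (u x)\<^sup>2 = c\<^sup>2"
      using K[OF *] by eventually_elim simp
    with * show "integrable (lebesgue_on K) (\<lambda>x. (u x)\<^sup>2)"
      using um by (intro Kc) auto
  qed
  have wp: "has_weak_partial D i u (\<lambda>x. 0)" if "i \<in> Basis" for i :: 'a
  proof -
    have c: "has_weak_partial D i (\<lambda>x. c) (\<lambda>x. 0)"
      using has_weak_partial_classical[OF assms(1), of "\<lambda>x. c" "\<lambda>x h. 0" i] that by simp
    have "(\<integral>x. u x * frechet_derivative \<phi> (at x) i \<partial>lebesgue_on D) =
        (\<integral>x. c * frechet_derivative \<phi> (at x) i \<partial>lebesgue_on D)" if \<phi>: "\<phi> \<in> test_functions D" for \<phi>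
    proof (rule integral_cong_AE)
      note \<phi>' = test_function_partial[OF \<phi> \<open>i \<in> Basis\<close>]
      show "(\<lambda>x. u x * frechet_derivative \<phi> (at x) i) \<in> borel_measurable (lebesgue_on D)"
        using L1_loc_mult_test_integrable[OF assms(1) L1 \<phi>'] by (rule borel_measurable_integrable)
      show "(\<lambda>x. c * frechet_derivative \<phi> (at x) i) \<in> borel_measurable (lebesgue_on D)"
        using L1_loc_mult_test_integrable[OF assms(1) _ \<phi>'] c
        by (auto simp: has_weak_partial_def intro!: borel_measurable_integrable)
    qed (use u in \<open>auto elim!: eventually_mono\<close>)
    with c L1 show ?thesis
      by (simp add: has_weak_partial_def)
  qed
  have "Dirichlet D u v = 0" for v
  proof -
    have "AE x in lebesgue_on D. \<forall>i\<in>Basis. weak_partial D i u x = 0"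
      using weak_partial_AE_eq(1)[OF assms(1) wp] by (intro AE_finite_allI) auto
    then show ?thesis
      unfolding Dirichlet_def weak_grad_def
      by (intro integral_eq_zero_AE) (auto elim!: eventually_mono)
  qed
  moreover have "u \<in> BL D"
    unfolding BL_def using L2 wp by (intro CollectI conjI ballI bexI[of _ "\<lambda>x. 0"]) (auto simp: L2_def)
  ultimately show ?thesis
    by (simp add: H_star_def)
qed

section \<open>Weyl's lemma\<close>

text \<open>
  The factor \<open>1 / \<rho> ^ DIM('a)\<close> makes the integral independent of \<open>\<rho>\<close>. The profile \<open>flat 2\<close> is the
  derivative of \<open>flat 0\<close>, so that the derivative in \<open>\<rho>\<close> becomes the Laplacian of a compactly supported
  smooth function (\<open>bump_radial_eq_Laplacian\<close>).
\<close>

definition bump :: "real \<Rightarrow> 'a::euclidean_space \<Rightarrow> real" where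
  "bump \<rho> z = flat 2 (1 - (norm z)\<^sup>2 / \<rho>\<^sup>2) / \<rho> ^ DIM('a)"

text \<open>
  The derivative of \<open>bump \<rho>\<close> at \<open>z\<close> in direction \<open>h\<close>.
\<close>

definition bump_grad :: "real \<Rightarrow> 'a::euclidean_space \<Rightarrow> 'a \<Rightarrow> real" where
  "bump_grad \<rho> z h = (flat 4 (1 - (norm z)\<^sup>2 / \<rho>\<^sup>2) - 2 * flat 3 (1 - (norm z)\<^sup>2 / \<rho>\<^sup>2)) *
     (- 2 * (z \<bullet> h) / \<rho>\<^sup>2) / \<rho> ^ DIM('a)"

text \<open>
  The derivative of \<open>bump \<rho> z\<close> in \<open>\<rho>\<close>.
\<close>

definition bump_radial :: "real \<Rightarrow> 'a::euclidean_space \<Rightarrow> real" where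
  "bump_radial \<rho> z = (flat 4 (1 - (norm z)\<^sup>2 / \<rho>\<^sup>2) - 2 * flat 3 (1 - (norm z)\<^sup>2 / \<rho>\<^sup>2)) *
     (2 * (norm z)\<^sup>2 / \<rho> ^ 3) / \<rho> ^ DIM('a)
     - real DIM('a) * flat 2 (1 - (norm z)\<^sup>2 / \<rho>\<^sup>2) / (\<rho> * \<rho> ^ DIM('a))"

lemma continuous_on_flat [continuous_intros]:
  "continuous_on S f \<Longrightarrow> continuous_on S (\<lambda>x. flat m (f x))"
  using has_real_derivative_flat[of m, THEN DERIV_isCont]
  by (intro continuous_on_compose2[of UNIV "flat m" S f] continuous_at_imp_continuous_on) auto

lemma bump_nonneg: "0 \<le> \<rho> \<Longrightarrow> 0 \<le> bump \<rho> z"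
  by (simp add: bump_def flat_nonneg)

lemma bump_le: "0 < \<rho> \<Longrightarrow> bump \<rho> (z::'a::euclidean_space) \<le> 2 / \<rho> ^ DIM('a)"
  using flat_le_fact[of 2] by (simp add: bump_def divide_right_mono)

lemma bump_minus: "bump \<rho> (- z) = bump \<rho> z"
  by (simp add: bump_def)

lemma ratio_le_0: "\<lbrakk>0 < \<rho>; \<rho> \<le> norm z\<rbrakk> \<Longrightarrow> 1 - (norm z)\<^sup>2 / \<rho>\<^sup>2 \<le> 0"
  by (simp add: divide_simps power2_eq_square mult_mono)

lemma bump_eq_0:
  assumes "0 < \<rho>" "\<rho> \<le> norm z"
  shows "bump \<rho> z = 0" "bump_grad \<rho> z h = 0" "bump_radial \<rho> z = 0"
  using ratio_le_0[OF assms] by (simp_all add: bump_def bump_grad_def bump_radial_def flat_eq_0)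

lemma bump_pos:
  assumes "norm z < \<rho>"
  shows "0 < bump \<rho> z"
proof -
  have "0 < \<rho>"
    using assms norm_ge_zero[of z] by linarith
  moreover have "(norm z)\<^sup>2 < \<rho>\<^sup>2"
    using assms by (intro power_strict_mono) auto
  ultimately show ?thesis
    by (simp add: bump_def flat_pos)
qed

lemma continuous_on_bump: "0 < \<rho> \<Longrightarrow> continuous_on UNIV (\<lambda>y. bump \<rho> (y - p))"
  unfolding bump_def by (intro continuous_intros) auto

lemma smooth_alg_ratio: "(\<lambda>y. 1 - (norm (y - p))\<^sup>2 / c) \<in> smooth_alg"
proof -
  have "(\<lambda>y. 1 - (\<Sum>i\<in>Basis. (y \<bullet> i - p \<bullet> i) * (y \<bullet> i - p \<bullet> i)) * inverse c) \<in> smooth_alg"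
    by (intro smooth_alg_diff smooth_alg.intros smooth_alg_sum) auto
  moreover have "(norm (y - p))\<^sup>2 = (\<Sum>i\<in>Basis. (y \<bullet> i - p \<bullet> i) * (y \<bullet> i - p \<bullet> i))" for y
    unfolding power2_norm_eq_inner by (subst euclidean_inner) (simp add: inner_diff_left)
  ultimately show ?thesis
    by (simp add: divide_inverse)
qed

lemma has_derivative_flat_ratio:
  "((\<lambda>y. flat m (1 - (norm (y - p))\<^sup>2 / c)) has_derivative
     (\<lambda>h. (flat (m + 2) (1 - (norm (x - p))\<^sup>2 / c) - real m * flat (m + 1) (1 - (norm (x - p))\<^sup>2 / c)) *
        (- 2 * ((x - p) \<bullet> h) / c))) (at x)"
proof -
  have "((\<lambda>y. 1 - (norm (y - p))\<^sup>2 / c) has_derivative (\<lambda>h. - 2 * ((x - p) \<bullet> h) / c)) (at x)"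
  proof -
    have "((\<lambda>y. (norm (y - p))\<^sup>2) has_derivative (\<lambda>h. 2 * ((x - p) \<bullet> h))) (at x)"
      unfolding power2_norm_eq_inner
      by (auto intro!: derivative_eq_intros simp: inner_commute algebra_simps)
    from has_derivative_diff[OF has_derivative_const[of 1] has_derivative_mult_left[OF this, of "inverse c"]]
    show ?thesis
      by (simp add: divide_inverse)
  qed
  moreover have "(flat m has_derivative
      (*) (flat (m + 2) s - real m * flat (m + 1) s)) (at s)" for s
    using has_real_derivative_flat unfolding has_field_derivative_def .
  ultimately show ?thesis
    using has_derivative_compose[of "\<lambda>y. 1 - (norm (y - p))\<^sup>2 / c" _ x UNIV "flat m"] by fast
qed

lemma has_derivative_bump: "((\<lambda>y. bump \<rho> (y - p)) has_derivative bump_grad \<rho> (x - p)) (at x)"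
proof -
  have "((\<lambda>y. flat 2 (1 - (norm (y - p))\<^sup>2 / \<rho>\<^sup>2) / \<rho> ^ DIM('a)) has_derivative
     (\<lambda>h. ((flat (2 + 2) (1 - (norm (x - p))\<^sup>2 / \<rho>\<^sup>2) - real 2 * flat (2 + 1) (1 - (norm (x - p))\<^sup>2 / \<rho>\<^sup>2)) *
        (- 2 * ((x - p) \<bullet> h) / \<rho>\<^sup>2)) / \<rho> ^ DIM('a))) (at x)"
    using has_derivative_flat_ratio[of 2 p "\<rho>\<^sup>2" x] unfolding divide_inverse[of _ "\<rho> ^ DIM('a)"]
    by (rule has_derivative_mult_left)
  then show ?thesis
    by (simp add: bump_def[abs_def] bump_grad_def[abs_def])
qed

lemma has_derivative_bump_radial:
  fixes z :: "'a::euclidean_space"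
  assumes "0 < \<rho>"
  shows "((\<lambda>\<rho>. bump \<rho> z) has_real_derivative bump_radial \<rho> z) (at \<rho>)"
proof -
  have "((\<lambda>\<rho>. 1 - (norm z)\<^sup>2 / \<rho>\<^sup>2) has_real_derivative 2 * (norm z)\<^sup>2 / \<rho> ^ 3) (at \<rho>)"
    using assms by (auto intro!: derivative_eq_intros simp: power2_eq_square power3_eq_cube field_simps)
  from DERIV_chain2[OF has_real_derivative_flat this, of 2]
  have 1: "((\<lambda>\<rho>. flat 2 (1 - (norm z)\<^sup>2 / \<rho>\<^sup>2)) has_real_derivative
     (flat 4 (1 - (norm z)\<^sup>2 / \<rho>\<^sup>2) - 2 * flat 3 (1 - (norm z)\<^sup>2 / \<rho>\<^sup>2)) * (2 * (norm z)\<^sup>2 / \<rho> ^ 3)) (at \<rho>)"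
    by simp
  have 2: "((\<lambda>\<rho>. \<rho> ^ DIM('a)) has_real_derivative real DIM('a) * \<rho> ^ DIM('a) / \<rho>) (at \<rho>)"
    using DERIV_pow[of "DIM('a)" \<rho>] assms DIM_positive[where 'a='a] by (simp add: power_diff)
  from DERIV_divide[OF 1 2] assms show ?thesis
    by (simp add: bump_def[abs_def] bump_radial_def field_simps)
qed

lemma weakly_harmonic:
  fixes u :: "'a::euclidean_space \<Rightarrow> real"
  assumes "open D" "u \<in> H_star D" and \<psi>: "\<psi> \<in> test_functions D"
  shows "(\<integral>x. u x * (\<Sum>i\<in>Basis. frechet_derivative (\<lambda>y. frechet_derivative \<psi> (at y) i) (at x) i)
    \<partial>lebesgue_on D) = 0"
proof -
  let ?d = "\<lambda>i x. frechet_derivative \<psi> (at x) i"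
  have "\<forall>i\<in>Basis. \<exists>g. has_weak_partial D i u g"
    using assms(2) by (auto simp: H_star_def BL_def)
  then obtain g where g: "\<And>i. i \<in> Basis \<Longrightarrow> has_weak_partial D i u (g i)"
    by metis
  have L1: "u \<in> L1_loc D" "\<And>i. i \<in> Basis \<Longrightarrow> g i \<in> L1_loc D"
    using g[OF SOME_Basis] g by (auto simp: has_weak_partial_def)
  note d = test_function_partial[OF \<psi>]
  have square: "integrable (lebesgue_on D) (\<lambda>x. (\<phi> x)\<^sup>2)" if \<phi>: "\<phi> \<in> test_functions D" for \<phi>
  proof -
    have "\<phi> \<in> L1_loc D"
      using test_function_continuous[OF \<phi>] assms(1)
      by (intro continuous_on_imp_L1_loc) (auto intro: continuous_on_subset)
    from L1_loc_mult_test_integrable[OF assms(1) this \<phi>] show ?thesis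
      by (simp add: power2_eq_square)
  qed
  have "C1_W12 D \<psi> (\<lambda>x. frechet_derivative \<psi> (at x))"
    unfolding C1_W12_def using test_function_has_derivative[OF \<psi>] square[OF \<psi>] square[OF d]
    by (auto intro: continuous_on_subset[OF test_function_continuous[OF d]])
  have "(\<integral>x. u x * (\<Sum>i\<in>Basis. frechet_derivative (?d i) (at x) i) \<partial>lebesgue_on D) =
      (\<Sum>i\<in>Basis. \<integral>x. u x * frechet_derivative (?d i) (at x) i \<partial>lebesgue_on D)"
    unfolding sum_distrib_left
    by (intro Bochner_Integration.integral_sum L1_loc_mult_test_integrable[OF assms(1) L1(1)]
        test_function_partial d)
  also have "\<dots> = (\<Sum>i\<in>Basis. - (\<integral>x. g i x * ?d i x \<partial>lebesgue_on D))"
    using g d by (intro sum.cong) (auto simp: has_weak_partial_def)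
  also have "\<dots> = - (\<integral>x. (\<Sum>i\<in>Basis. g i x * ?d i x) \<partial>lebesgue_on D)"
    by (subst Bochner_Integration.integral_sum)
      (auto intro!: L1_loc_mult_test_integrable[OF assms(1) L1(2)] d simp: sum_negf)
  also have "\<dots> = 0"
    using H_star_orthogonal[OF assms(1,2) g \<open>C1_W12 D \<psi> _\<close>] by simp
  finally show ?thesis .
qed

text \<open>
  The heart of Weyl's lemma. Changing the radius changes the mollifier by a Laplacian, against which
  a weakly harmonic function integrates to 0. The prefactor \<open>\<rho> / (2 \<rho> ^ DIM('a))\<close> is found by matching
  the terms with \<open>flat 2\<close> on both sides.
\<close>

lemma bump_radial_eq_Laplacian:
  fixes p x :: "'a::euclidean_space"
  assumes "0 < \<rho>"
  defines "\<psi> \<equiv> \<lambda>y. flat 0 (1 - (norm (y - p))\<^sup>2 / \<rho>\<^sup>2) * (\<rho> / (2 * \<rho> ^ DIM('a)))"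
  shows "(\<Sum>i\<in>Basis. frechet_derivative (\<lambda>y. frechet_derivative \<psi> (at y) i) (at x) i) = bump_radial \<rho> (x - p)"
proof -
  define c where "c = \<rho> / (2 * \<rho> ^ DIM('a))"
  let ?s = "\<lambda>y. 1 - (norm (y - p))\<^sup>2 / \<rho>\<^sup>2"
  have "(\<psi> has_derivative (\<lambda>h. (flat (0 + 2) (?s y) - real 0 * flat (0 + 1) (?s y)) * (- 2 * ((y - p) \<bullet> h) / \<rho>\<^sup>2) * c)) (at y)" for y
    unfolding \<psi>_def c_def by (intro has_derivative_mult_left has_derivative_flat_ratio)
  then have d1: "frechet_derivative \<psi> (at y) = (\<lambda>h. flat 2 (?s y) * (- 2 * ((y - p) \<bullet> h) / \<rho>\<^sup>2) * c)" for y
    by (simp only: frechet_derivative_at[symmetric] add_0 of_nat_0 mult_zero_left diff_zero)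
  have d2: "frechet_derivative (\<lambda>y. frechet_derivative \<psi> (at y) i) (at x) i =
      ((flat 4 (?s x) - 2 * flat 3 (?s x)) * (- 2 * ((x - p) \<bullet> i) / \<rho>\<^sup>2) * (- 2 * ((x - p) \<bullet> i) / \<rho>\<^sup>2)
        + flat 2 (?s x) * (- 2 / \<rho>\<^sup>2)) * c" if "i \<in> Basis" for i
  proof -
    have "((\<lambda>y. - 2 * ((y - p) \<bullet> i) / \<rho>\<^sup>2) has_derivative (\<lambda>h. - 2 * (h \<bullet> i) / \<rho>\<^sup>2)) (at x)"
      using assms(1) by (auto intro!: derivative_eq_intros simp: fun_eq_iff field_simps power4_eq_xxxx power2_eq_square)
    from has_derivative_mult_left[OF has_derivative_mult[OF has_derivative_flat_ratio[of 2 p "\<rho>\<^sup>2" x] this], of c]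
    have "((\<lambda>y. flat 2 (?s y) * (- 2 * ((y - p) \<bullet> i) / \<rho>\<^sup>2) * c) has_derivative
      (\<lambda>h. (flat 2 (?s x) * (- 2 * (h \<bullet> i) / \<rho>\<^sup>2) + (flat 4 (?s x) - 2 * flat 3 (?s x)) * (- 2 * ((x - p) \<bullet> h) / \<rho>\<^sup>2)
         * (- 2 * ((x - p) \<bullet> i) / \<rho>\<^sup>2)) * c)) (at x)"
      by simp
    from frechet_derivative_at[OF this] show ?thesis
      using that by (simp add: d1 fun_eq_iff algebra_simps)
  qed
  have n: "(\<Sum>i\<in>Basis. ((x - p) \<bullet> i) * ((x - p) \<bullet> i)) = (norm (x - p))\<^sup>2"
    unfolding power2_norm_eq_inner by (rule euclidean_inner[symmetric])
  have "(\<Sum>i\<in>Basis. frechet_derivative (\<lambda>y. frechet_derivative \<psi> (at y) i) (at x) i) =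
    (\<Sum>i\<in>(Basis::'a set). (flat 4 (?s x) - 2 * flat 3 (?s x)) * (4 * c / \<rho>^4) * (((x - p) \<bullet> i) * ((x - p) \<bullet> i))
        - flat 2 (?s x) * (2 * c / \<rho>\<^sup>2))"
    by (intro sum.cong refl) (simp add: d2 field_simps power2_eq_square power4_eq_xxxx)
  also have "\<dots> = (flat 4 (?s x) - 2 * flat 3 (?s x)) * (4 * c / \<rho>^4) * (norm (x - p))\<^sup>2
      - real DIM('a) * (flat 2 (?s x) * (2 * c / \<rho>\<^sup>2))"
    unfolding sum_subtractf sum_distrib_left[symmetric] n by simp
  also have "\<dots> = bump_radial \<rho> (x - p)"
    using assms(1) by (simp add: bump_radial_def c_def field_simps power2_eq_square power3_eq_cube power4_eq_xxxx)
  finally show ?thesis .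
qed

lemma H_star_L1_loc: "u \<in> H_star D \<Longrightarrow> u \<in> L1_loc D"
  using SOME_Basis unfolding H_star_def BL_def has_weak_partial_def by blast

lemma L1_loc_abs: "u \<in> L1_loc D \<Longrightarrow> (\<lambda>x. \<bar>u x\<bar>) \<in> L1_loc D"
  by (auto simp: L1_loc_def)

lemma bump_radial_bounded:
  assumes "0 < a"
  obtains M where "0 \<le> M" "\<And>\<tau> z::'a::euclidean_space. \<lbrakk>a \<le> \<tau>; \<tau> \<le> b\<rbrakk> \<Longrightarrow> \<bar>bump_radial \<tau> z\<bar> \<le> M"
proof -
  let ?S = "{a..b} \<times> cball (0::'a) b"
  have "continuous_on ?S (\<lambda>(\<tau>, z). bump_radial \<tau> z)"
    unfolding bump_radial_def case_prod_unfold using assms by (intro continuous_intros) auto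
  then have "compact ((\<lambda>(\<tau>, z). bump_radial \<tau> z) ` ?S)"
    by (rule compact_continuous_image) (intro compact_Times compact_Icc compact_cball)
  then obtain M where M: "\<And>x. x \<in> (\<lambda>(\<tau>, z). bump_radial \<tau> z) ` ?S \<Longrightarrow> \<bar>x\<bar> \<le> M"
    using compact_imp_bounded bounded_iff by (metis real_norm_def)
  have "\<bar>bump_radial \<tau> z\<bar> \<le> max M 0" if "a \<le> \<tau>" "\<tau> \<le> b" for \<tau> and z :: 'a
  proof (cases "norm z \<le> b")
    case True
    then have "\<bar>bump_radial \<tau> z\<bar> \<le> M"
      using that by (intro M image_eqI[of _ _ "(\<tau>, z)"]) auto
    then show ?thesis by simp
  next
    case False
    then show ?thesis
      using that assms by (simp add: bump_eq_0)
  qed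
  then show ?thesis
    using that[of "max M 0"] by simp
qed

lemma bump_grad_bounded:
  assumes "0 < \<rho>"
  obtains M where "0 \<le> M" "\<And>z h::'a::euclidean_space. \<bar>bump_grad \<rho> z h\<bar> \<le> M * norm h"
proof -
  have "\<bar>bump_grad \<rho> z h\<bar> \<le> 36 * 2 / \<rho> / \<rho> ^ DIM('a) * norm h" for z h :: 'a
  proof (cases "norm z \<le> \<rho>")
    case True
    let ?s = "1 - (norm z)\<^sup>2 / \<rho>\<^sup>2"
    have "flat 4 ?s \<le> 24" "flat 3 ?s \<le> 6" "0 \<le> flat 4 ?s" "0 \<le> flat 3 ?s"
      using flat_le_fact[of 4 ?s] flat_le_fact[of 3 ?s] by (simp_all add: fact_numeral flat_nonneg)
    then have 1: "\<bar>flat 4 ?s - 2 * flat 3 ?s\<bar> \<le> 36"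
      by linarith
    have "\<bar>z \<bullet> h\<bar> \<le> \<rho> * norm h"
      using Cauchy_Schwarz_ineq2[of z h] True mult_right_mono[OF True norm_ge_zero[of h]] by linarith
    then have "\<bar>- 2 * (z \<bullet> h) / \<rho>\<^sup>2\<bar> \<le> 2 * (\<rho> * norm h) / \<rho>\<^sup>2"
      unfolding abs_divide by (intro divide_mono) (use assms in auto)
    then have 2: "\<bar>- 2 * (z \<bullet> h) / \<rho>\<^sup>2\<bar> \<le> 2 / \<rho> * norm h"
      using assms by (simp add: power2_eq_square)
    have "\<bar>bump_grad \<rho> z h\<bar> = \<bar>flat 4 ?s - 2 * flat 3 ?s\<bar> * \<bar>- 2 * (z \<bullet> h) / \<rho>\<^sup>2\<bar> / \<rho> ^ DIM('a)"
      unfolding bump_grad_def abs_mult abs_divide using assms by simp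
    also have "\<dots> \<le> 36 * (2 / \<rho> * norm h) / \<rho> ^ DIM('a)"
      using assms by (intro divide_right_mono mult_mono 1 2) auto
    finally show ?thesis by (simp add: mult_ac)
  next
    case False
    then show ?thesis
      using assms by (simp add: bump_eq_0)
  qed
  then show ?thesis
    using that[of "36 * 2 / \<rho> / \<rho> ^ DIM('a)"] assms by simp
qed

lemma L1_loc_mult_bump_integrable:
  fixes u :: "'a::euclidean_space \<Rightarrow> real"
  assumes "open D" "u \<in> L1_loc D" "cball p \<rho> \<subseteq> D" "0 < \<rho>"
  shows "integrable (lebesgue_on D) (\<lambda>y. u y * bump \<rho> (y - p))"
proof (rule L1_loc_mult_continuous_integrable[OF assms(1,2) continuous_on_bump[OF assms(4)] _ assms(3)])
  fix x assume "x \<notin> cball p \<rho>"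
  then have "\<rho> \<le> norm (x - p)"
    by (simp add: dist_norm norm_minus_commute)
  then show "bump \<rho> (x - p) = 0"
    using assms(4) by (simp add: bump_eq_0)
qed simp

text \<open>
  A common form for varying the radius and for varying the centre of a mollification: the kernels
  have a common compact support and a common Lipschitz constant.
\<close>

lemma has_derivative_integral_kernel:
  fixes k :: "'p::real_normed_vector \<Rightarrow> 'a::euclidean_space \<Rightarrow> real"
  assumes "open D" "v \<in> L1_loc D" "open P" "p0 \<in> P" "compact K" "K \<subseteq> D"
    and k: "\<And>p. p \<in> P \<Longrightarrow> continuous_on UNIV (k p)" "\<And>p y. p \<in> P \<Longrightarrow> y \<notin> K \<Longrightarrow> k p y = 0"
    and k': "\<And>h. continuous_on UNIV (\<lambda>y. k' y h)" "\<And>y h. y \<notin> K \<Longrightarrow> k' y h = 0"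
    and deriv: "\<And>y. ((\<lambda>p. k p y) has_derivative k' y) (at p0)"
    and lip: "\<And>p y. p \<in> P \<Longrightarrow> \<bar>k p y - k p0 y\<bar> \<le> M * norm (p - p0)"
    and lip': "\<And>y h. \<bar>k' y h\<bar> \<le> M * norm h"
    and "0 \<le> M"
  shows "((\<lambda>p. \<integral>y. v y * k p y \<partial>lebesgue_on D) has_derivative
    (\<lambda>h. \<integral>y. v y * k' y h \<partial>lebesgue_on D)) (at p0)"
proof (rule has_derivative_integral_dominated[OF assms(3,4), where G="\<lambda>y. \<bar>v y\<bar> * (M * indicator K y)"])
  show "integrable (lebesgue_on D) (\<lambda>y. v y * k p y)" if "p \<in> P" for p
    using k that by (intro L1_loc_mult_continuous_integrable[OF assms(1,2) _ assms(5,6)])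
  show "integrable (lebesgue_on D) (\<lambda>y. v y * k' y h)" for h
    using k' by (intro L1_loc_mult_continuous_integrable[OF assms(1,2) _ assms(5,6)])
  show "integrable (lebesgue_on D) (\<lambda>y. \<bar>v y\<bar> * (M * indicator K y))"
    using assms(5,6) \<open>0 \<le> M\<close>
    by (intro L1_loc_mult_integrable[where K=K and B=M] assms(1) L1_loc_abs[OF assms(2)]
        borel_measurable_times borel_measurable_const borel_measurable_indicator)
      (auto simp: indicator_def borel_compact)
  fix y
  show "((\<lambda>p. v y * k p y) has_derivative (\<lambda>h. v y * k' y h)) (at p0)"
    by (intro has_derivative_mult_right deriv)
  show "\<bar>v y * k p y - v y * k p0 y\<bar> \<le> norm (p - p0) * (\<bar>v y\<bar> * (M * indicator K y))" if "p \<in> P" for p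
  proof (cases "y \<in> K")
    case True
    have "\<bar>v y * k p y - v y * k p0 y\<bar> = \<bar>v y\<bar> * \<bar>k p y - k p0 y\<bar>"
      by (simp add: abs_mult[symmetric] right_diff_distrib)
    also have "\<dots> \<le> \<bar>v y\<bar> * (M * norm (p - p0))"
      by (intro mult_left_mono lip that) simp
    finally show ?thesis
      using True by (simp add: mult_ac)
  qed (use k(2) that assms(4) in simp)
  show "\<bar>v y * k' y h\<bar> \<le> norm h * (\<bar>v y\<bar> * (M * indicator K y))" for h
  proof (cases "y \<in> K")
    case True
    have "\<bar>v y\<bar> * \<bar>k' y h\<bar> \<le> \<bar>v y\<bar> * (M * norm h)"
      by (intro mult_left_mono lip') simp
    with True show ?thesis
      by (simp add: abs_mult mult_ac)
  qed (simp add: k'(2))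
qed

text \<open>
  A mean value property with smooth weights.
\<close>

lemma integral_bump_radius_independent:
  fixes u :: "'a::euclidean_space \<Rightarrow> real"
  assumes "open D" "u \<in> H_star D" "ball p R \<subseteq> D" "0 < \<rho>" "\<rho> < R" "0 < \<sigma>" "\<sigma> < R"
  shows "(\<integral>y. u y * bump \<rho> (y - p) \<partial>lebesgue_on D) = (\<integral>y. u y * bump \<sigma> (y - p) \<partial>lebesgue_on D)"
proof -
  let ?F = "\<lambda>\<rho>. \<integral>y. u y * bump \<rho> (y - p) \<partial>lebesgue_on D"
  note u = H_star_L1_loc[OF assms(2)]
  have "(?F has_derivative (\<lambda>h. 0)) (at \<rho>)" if \<rho>: "0 < \<rho>" "\<rho> < R" for \<rho>
  proof -
    define a b where "a = \<rho> / 2" "b = (\<rho> + R) / 2"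
    have ab: "0 < a" "a < \<rho>" "\<rho> < b" "b < R"
      using \<rho> by (auto simp: a_b_def)
    have sub: "cball p b \<subseteq> D" "cball p \<rho> \<subseteq> D"
      using assms(3) ab by (auto simp: subset_eq)
    obtain M where M: "0 \<le> M" "\<And>\<tau> z::'a. \<lbrakk>a \<le> \<tau>; \<tau> \<le> b\<rbrakk> \<Longrightarrow> \<bar>bump_radial \<tau> z\<bar> \<le> M"
      using bump_radial_bounded[OF ab(1), where b=b and 'a='a] by blast
    have out: "bump \<tau> (y - p) = 0" "bump_radial \<tau> (y - p) = 0"
      if "0 < \<tau>" "\<tau> \<le> b" "y \<notin> cball p b" for \<tau> y
      using that by (auto simp: bump_eq_0 dist_norm norm_minus_commute)
    have lip: "\<bar>bump \<tau> z - bump \<rho> z\<bar> \<le> M * \<bar>\<tau> - \<rho>\<bar>" if "\<tau> \<in> {a<..<b}" for \<tau> and z :: 'a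
    proof -
      have "norm (bump \<tau> z - bump \<rho> z) \<le> M * norm (\<tau> - \<rho>)"
      proof (rule field_differentiable_bound[of "{a..b}"])
        fix t assume "t \<in> {a..b}"
        then show "((\<lambda>\<rho>. bump \<rho> z) has_field_derivative bump_radial t z) (at t within {a..b})"
          using ab(1) by (intro DERIV_subset[OF has_derivative_bump_radial]) auto
        show "norm (bump_radial t z) \<le> M"
          using M \<open>t \<in> _\<close> by auto
      qed (use that ab in auto)
      then show ?thesis by simp
    qed
    have "(?F has_derivative (\<lambda>h. \<integral>y. u y * (h * bump_radial \<rho> (y - p)) \<partial>lebesgue_on D)) (at \<rho>)"
    proof (rule has_derivative_integral_kernel[OF assms(1) u, where P="{a<..<b}" and K="cball p b" and M=M])
      show "continuous_on UNIV (\<lambda>y. h * bump_radial \<rho> (y - p))" for h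
        unfolding bump_radial_def using \<rho> by (intro continuous_intros) auto
      show "((\<lambda>\<rho>. bump \<rho> (y - p)) has_derivative (\<lambda>h. h * bump_radial \<rho> (y - p))) (at \<rho>)" for y
      proof -
        have "(*) (bump_radial \<rho> (y - p)) = (\<lambda>h. h * bump_radial \<rho> (y - p))"
          by (auto simp: mult.commute)
        then show ?thesis
          using has_derivative_bump_radial[OF \<rho>(1), of "y - p"] by (simp add: has_field_derivative_def)
      qed
      show "\<bar>h * bump_radial \<rho> (y - p)\<bar> \<le> M * norm h" for y h
        using mult_left_mono[OF M(2)[of \<rho> "y - p"], of "\<bar>h\<bar>"] ab by (simp add: abs_mult mult.commute)
      show "continuous_on UNIV (\<lambda>y. bump \<tau> (y - p))" if "\<tau> \<in> {a<..<b}" for \<tau>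
        using that ab by (intro continuous_on_bump) auto
    qed (use ab \<rho> sub(1) M(1) lip out in auto)
    then have "(?F has_derivative (\<lambda>h. h * (\<integral>y. u y * bump_radial \<rho> (y - p) \<partial>lebesgue_on D))) (at \<rho>)"
      by (simp add: mult.left_commute)
    moreover have "(\<integral>y. u y * bump_radial \<rho> (y - p) \<partial>lebesgue_on D) = 0"
    proof -
      define \<psi> where "\<psi> = (\<lambda>y. flat 0 (1 - (norm (y - p))\<^sup>2 / \<rho>\<^sup>2) * (\<rho> / (2 * \<rho> ^ DIM('a))))"
      have "\<psi> \<in> smooth_alg"
        unfolding \<psi>_def by (intro smooth_alg.mult smooth_alg.flat smooth_alg.const smooth_alg_ratio)
      then have "\<psi> \<in> test_functions D"
      proof (rule test_functionsI[OF _ compact_cball sub(2)])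
        fix x assume "x \<notin> cball p \<rho>"
        then have "\<rho> \<le> norm (x - p)"
          by (simp add: dist_norm norm_minus_commute)
        then have "flat 0 (1 - (norm (x - p))\<^sup>2 / \<rho>\<^sup>2) = 0"
          by (intro flat_eq_0 ratio_le_0 \<rho>)
        then show "\<psi> x = 0"
          by (simp add: \<psi>_def)
      qed
      from weakly_harmonic[OF assms(1,2) this] show ?thesis
        unfolding \<psi>_def bump_radial_eq_Laplacian[OF \<rho>(1)] .
    qed
    ultimately show ?thesis by simp
  qed
  then have "\<forall>\<rho>\<in>{0<..<R}. (?F has_derivative (\<lambda>h. 0)) (at \<rho> within {0<..<R})"
    using has_derivative_at_withinI by force
  then obtain c where "\<And>\<rho>. \<rho> \<in> {0<..<R} \<Longrightarrow> ?F \<rho> = c"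
    using has_derivative_zero_constant[of "{0<..<R}" ?F] by auto
  with assms show ?thesis by simp
qed

definition bump_mass :: "'a::euclidean_space itself \<Rightarrow> real" where
  "bump_mass _ = (\<integral>z. bump 1 (z::'a) \<partial>lborel)"

lemma integrable_bump: "0 < \<rho> \<Longrightarrow> integrable lborel (\<lambda>y. bump \<rho> (y - p :: 'a::euclidean_space))"
  by (rule continuous_compact_support_integrable[where K="cball p \<rho>"])
    (auto intro: continuous_on_bump bump_eq_0 simp: dist_norm norm_minus_commute)

text \<open>
  The constant function 1 belongs to \<open>H_star UNIV\<close>, so the radius independence of mollifications
  yields that of the integral of the kernel.
\<close>

lemma integral_bump:
  fixes p :: "'a::euclidean_space"
  assumes "0 < \<rho>"
  shows "(\<integral>y. bump \<rho> (y - p) \<partial>lborel) = bump_mass TYPE('a)"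
proof -
  have one: "(\<lambda>x. 1) \<in> H_star (UNIV :: 'a set)"
    by (rule AE_const_in_H_star[where c=1]) auto
  have eq: "(\<integral>y. 1 * bump \<sigma> (y - 0::'a) \<partial>lebesgue_on UNIV) = (\<integral>y. bump \<sigma> (y - 0::'a) \<partial>lborel)" if "0 < \<sigma>" for \<sigma>
    using continuous_on_bump[OF that, of 0]
    by (subst lebesgue_on_integral_eq_lborel) (auto intro: borel_measurable_continuous_onI)
  have "(\<integral>y. bump \<rho> (y - p) \<partial>lborel) = (\<integral>y. bump \<rho> ((p + y) - p) \<partial>lborel)"
    using continuous_on_bump[OF assms, of p]
    by (intro lborel_integral_translate[symmetric] borel_measurable_continuous_onI)
  also have "\<dots> = (\<integral>y. bump \<rho> (y - 0::'a) \<partial>lborel)"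
    by simp
  also have "\<dots> = (\<integral>y. 1 * bump \<rho> (y - 0::'a) \<partial>lebesgue_on UNIV)"
    by (rule eq[OF assms, symmetric])
  also have "\<dots> = (\<integral>y. 1 * bump 1 (y - 0::'a) \<partial>lebesgue_on UNIV)"
    using assms by (intro integral_bump_radius_independent[OF _ one, of 0 "\<rho> + 2"]) auto
  also have "\<dots> = (\<integral>y. bump 1 (y - 0::'a) \<partial>lborel)"
    by (rule eq) simp
  finally show ?thesis
    by (simp add: bump_mass_def)
qed

lemma bump_mass_pos: "0 < bump_mass TYPE('a::euclidean_space)"
proof -
  have "\<not> (AE z in lborel. bump 1 (z::'a) = 0)"
  proof
    assume "AE z in lborel. bump 1 (z::'a) = 0"
    then have "AE z in lborel. z \<notin> ball (0::'a) 1"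
      by eventually_elim (use bump_pos[of _ 1] in force)
    then have "emeasure lborel (ball (0::'a) 1) = 0"
      by (subst (asm) AE_iff_measurable[OF _ refl]) (auto simp: ball_def)
    then show False
      using content_ball_pos[of 1 "0::'a"] by (simp add: measure_def)
  qed
  then have "bump_mass TYPE('a) \<noteq> 0"
    unfolding bump_mass_def using integrable_bump[of 1 "0::'a"]
    by (subst integral_nonneg_eq_0_iff_AE) (auto simp: bump_nonneg)
  moreover have "0 \<le> bump_mass TYPE('a)"
    unfolding bump_mass_def by (intro Bochner_Integration.integral_nonneg) (simp add: bump_nonneg)
  ultimately show ?thesis by linarith
qed

lemma mollification_has_derivative:
  fixes v :: "'a::euclidean_space \<Rightarrow> real"
  assumes "open D" "v \<in> L1_loc D" "0 < \<rho>" "cball p0 (2 * \<rho>) \<subseteq> D"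
  shows "((\<lambda>p. \<integral>y. v y * bump \<rho> (y - p) \<partial>lebesgue_on D) has_derivative
    (\<lambda>h. \<integral>y. v y * - bump_grad \<rho> (y - p0) h \<partial>lebesgue_on D)) (at p0)"
proof -
  obtain M where M: "0 \<le> M" "\<And>z h::'a. \<bar>bump_grad \<rho> z h\<bar> \<le> M * norm h"
    using bump_grad_bounded[OF assms(3), where 'a='a] by blast
  have deriv: "((\<lambda>p. bump \<rho> (y - p)) has_derivative (\<lambda>h. - bump_grad \<rho> (y - p) h)) (at p)" for p y :: 'a
  proof -
    have "bump \<rho> (y - p) = bump \<rho> (p - y)" for p
      using bump_minus[of \<rho> "p - y"] by simp
    moreover have "bump_grad \<rho> (p - y) = (\<lambda>h. - bump_grad \<rho> (y - p) h)"
      by (auto simp: bump_grad_def norm_minus_commute inner_diff_left diff_divide_distrib algebra_simps)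
    ultimately show ?thesis
      using has_derivative_bump[of \<rho> y p] by simp
  qed
  have lip: "\<bar>bump \<rho> (y - p) - bump \<rho> (y - p0)\<bar> \<le> M * norm (p - p0)" for p y
  proof -
    have "norm (bump \<rho> (y - p) - bump \<rho> (y - p0)) \<le> M * norm (p - p0)"
    proof (rule differentiable_bound[of UNIV])
      show "onorm (\<lambda>h. - bump_grad \<rho> (y - x) h) \<le> M" for x
        using M by (intro onorm_bound) auto
    qed (auto intro: deriv)
    then show ?thesis by simp
  qed
  have out: "bump \<rho> (y - p) = 0" "bump_grad \<rho> (y - p) h = 0"
    if "y \<notin> cball p0 (2 * \<rho>)" "p \<in> ball p0 \<rho>" for y p h
  proof -
    have "dist p0 y \<le> dist p0 p + dist p y"
      by (rule dist_triangle)
    then have "\<rho> \<le> norm (y - p)"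
      using that by (simp add: dist_norm norm_minus_commute)
    then show "bump \<rho> (y - p) = 0" "bump_grad \<rho> (y - p) h = 0"
      using assms(3) by (simp_all add: bump_eq_0)
  qed
  show ?thesis
  proof (rule has_derivative_integral_kernel[OF assms(1,2), where P="ball p0 \<rho>" and K="cball p0 (2 * \<rho>)" and M=M])
    show "continuous_on UNIV (\<lambda>y. - bump_grad \<rho> (y - p0) h)" for h
      unfolding bump_grad_def using assms(3) by (intro continuous_intros) auto
  qed (use assms(3,4) M lip out deriv continuous_on_bump in auto)
qed

text \<open>
  Any admissible radius gives the same value (\<open>harmonic_rep_eq\<close>); the strict inclusion in a larger
  ball leaves room to compare two of them.
\<close>

definition harmonic_rep :: "'a::euclidean_space set \<Rightarrow> ('a \<Rightarrow> real) \<Rightarrow> 'a \<Rightarrow> real" where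
  "harmonic_rep D u p = (let \<rho> = SOME \<rho>. 0 < \<rho> \<and> (\<exists>R>\<rho>. ball p R \<subseteq> D)
     in (\<integral>y. u y * bump \<rho> (y - p) \<partial>lebesgue_on D) / bump_mass TYPE('a))"

lemma harmonic_rep_eq:
  fixes u :: "'a::euclidean_space \<Rightarrow> real"
  assumes "open D" "u \<in> H_star D" "0 < \<rho>" "\<rho> < R" "ball p R \<subseteq> D"
  shows "harmonic_rep D u p = (\<integral>y. u y * bump \<rho> (y - p) \<partial>lebesgue_on D) / bump_mass TYPE('a)"
proof -
  define \<sigma> where "\<sigma> = (SOME \<rho>. 0 < \<rho> \<and> (\<exists>R>\<rho>. ball p R \<subseteq> D))"
  have "0 < \<sigma> \<and> (\<exists>R>\<sigma>. ball p R \<subseteq> D)"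
    unfolding \<sigma>_def by (rule someI[of _ \<rho>]) (use assms in auto)
  then obtain R' where R': "0 < \<sigma>" "\<sigma> < R'" "ball p R' \<subseteq> D"
    by auto
  have "ball p (max R R') \<subseteq> D"
    using assms(5) R'(3) by (auto simp: max_def)
  then have "(\<integral>y. u y * bump \<rho> (y - p) \<partial>lebesgue_on D) = (\<integral>y. u y * bump \<sigma> (y - p) \<partial>lebesgue_on D)"
    by (rule integral_bump_radius_independent[OF assms(1,2)]) (use assms R' in auto)
  then show ?thesis
    by (simp add: harmonic_rep_def \<sigma>_def)
qed

lemma harmonic_rep_has_derivative:
  fixes u :: "'a::euclidean_space \<Rightarrow> real"
  assumes "open D" "u \<in> H_star D" "0 < \<rho>" "cball p0 (3 * \<rho>) \<subseteq> D"
  shows "(harmonic_rep D u has_derivative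
    (\<lambda>h. (\<integral>y. u y * - bump_grad \<rho> (y - p0) h \<partial>lebesgue_on D) / bump_mass TYPE('a))) (at p0)"
proof -
  have sub: "cball p0 (2 * \<rho>) \<subseteq> D"
    using assms(3,4) by (auto simp: subset_eq)
  have "((\<lambda>p. (\<integral>y. u y * bump \<rho> (y - p) \<partial>lebesgue_on D) / bump_mass TYPE('a)) has_derivative
    (\<lambda>h. (\<integral>y. u y * - bump_grad \<rho> (y - p0) h \<partial>lebesgue_on D) / bump_mass TYPE('a))) (at p0)"
    unfolding divide_inverse
    by (intro has_derivative_mult_left mollification_has_derivative assms(1,3) sub H_star_L1_loc[OF assms(2)])
  then show ?thesis
  proof (rule has_derivative_transform_within_open)
    fix p assume p: "p \<in> ball p0 \<rho>"
    have "ball p (2 * \<rho>) \<subseteq> D"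
    proof
      fix y assume "y \<in> ball p (2 * \<rho>)"
      then have "dist p0 y \<le> 3 * \<rho>"
        using p dist_triangle[of p0 y p] by simp
      with assms(4) show "y \<in> D" by auto
    qed
    then show "(\<integral>y. u y * bump \<rho> (y - p) \<partial>lebesgue_on D) / bump_mass TYPE('a) = harmonic_rep D u p"
      using assms(3) by (subst harmonic_rep_eq[OF assms(1,2), of \<rho> "2 * \<rho>"]) auto
  qed (use assms(3) in auto)
qed

lemma bump_test_function:
  assumes "0 < \<rho>" "cball p \<rho> \<subseteq> D"
  shows "(\<lambda>y. bump \<rho> (y - p)) \<in> test_functions D"
proof (rule test_functionsI[OF _ compact_cball assms(2)])
  have "(\<lambda>y. flat 2 (1 - (norm (y - p))\<^sup>2 / \<rho>\<^sup>2) * inverse (\<rho> ^ DIM('a))) \<in> smooth_alg"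
    by (intro smooth_alg.mult smooth_alg.flat smooth_alg.const smooth_alg_ratio)
  then show "(\<lambda>y. bump \<rho> (y - p)) \<in> smooth_alg"
    by (simp add: bump_def divide_inverse)
  fix x assume "x \<notin> cball p \<rho>"
  then show "bump \<rho> (x - p) = 0"
    using assms(1) by (intro bump_eq_0) (auto simp: dist_norm norm_minus_commute)
qed

text \<open>
  Near \<open>p\<close> the representative is a mollification with a fixed radius. Its partial derivatives move
  onto the kernel and from there, by the definition of weak derivatives, back onto the function.
\<close>

lemma harmonic_rep_partial:
  fixes u :: "'a::euclidean_space \<Rightarrow> real"
  assumes "open D" "u \<in> H_star D" "has_weak_partial D i u g" "0 < \<rho>" "cball p (3 * \<rho>) \<subseteq> D"
  shows "frechet_derivative (harmonic_rep D u) (at p) i =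
    (\<integral>y. g y * bump \<rho> (y - p) \<partial>lebesgue_on D) / bump_mass TYPE('a)"
proof -
  have sub: "cball p \<rho> \<subseteq> D"
    using assms(4,5) by (auto simp: subset_eq)
  have fd: "frechet_derivative (\<lambda>y. bump \<rho> (y - p)) (at x) = bump_grad \<rho> (x - p)" for x
    using has_derivative_bump by (rule frechet_derivative_at[symmetric])
  have "frechet_derivative (harmonic_rep D u) (at p) i =
      (\<integral>y. u y * - bump_grad \<rho> (y - p) i \<partial>lebesgue_on D) / bump_mass TYPE('a)"
    using frechet_derivative_at[OF harmonic_rep_has_derivative[OF assms(1,2,4,5)]] by (metis (no_types))
  also have "(\<integral>y. u y * - bump_grad \<rho> (y - p) i \<partial>lebesgue_on D) =
      - (\<integral>y. u y * frechet_derivative (\<lambda>y. bump \<rho> (y - p)) (at y) i \<partial>lebesgue_on D)"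
    by (simp add: fd)
  also have "\<dots> = (\<integral>y. g y * bump \<rho> (y - p) \<partial>lebesgue_on D)"
    using assms(3) bump_test_function[OF assms(4) sub] by (simp add: has_weak_partial_def)
  finally show ?thesis .
qed

lemma open_contains_cball_mult:
  assumes "open D" "p \<in> D" "0 < (c::real)"
  obtains \<rho> where "0 < \<rho>" "cball p (c * \<rho>) \<subseteq> D"
proof -
  obtain e where "0 < e" "cball p e \<subseteq> D"
    using assms open_contains_cball by blast
  with assms(3) that[of "e / c"] show ?thesis by simp
qed

lemma harmonic_rep_differentiable:
  assumes "open D" "u \<in> H_star D" "p \<in> D"
  shows "(harmonic_rep D u has_derivative frechet_derivative (harmonic_rep D u) (at p)) (at p)"
proof -
  obtain \<rho> where "0 < \<rho>" "cball p (3 * \<rho>) \<subseteq> D"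
    using open_contains_cball_mult[OF assms(1,3), of 3] by auto
  from harmonic_rep_has_derivative[OF assms(1,2) this] show ?thesis
    by (metis frechet_derivative_works differentiableI)
qed

lemma harmonic_rep_partial_continuous:
  fixes u :: "'a::euclidean_space \<Rightarrow> real"
  assumes "open D" "u \<in> H_star D" "i \<in> Basis"
  shows "continuous_on D (\<lambda>p. frechet_derivative (harmonic_rep D u) (at p) i)"
proof (rule continuous_at_imp_continuous_on, rule ballI)
  fix p0 assume "p0 \<in> D"
  obtain g where g: "has_weak_partial D i u g"
    using assms(2,3) by (auto simp: H_star_def BL_def)
  then have L1: "g \<in> L1_loc D"
    by (simp add: has_weak_partial_def)
  obtain \<rho> where \<rho>: "0 < \<rho>" "cball p0 (4 * \<rho>) \<subseteq> D"
    using open_contains_cball_mult[OF assms(1) \<open>p0 \<in> D\<close>, of 4] by auto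
  have "cball p0 (2 * \<rho>) \<subseteq> D"
    using \<rho> by (auto simp: subset_eq)
  from has_derivative_continuous[OF mollification_has_derivative[OF assms(1) L1 \<rho>(1) this]]
  have "isCont (\<lambda>p. (\<integral>y. g y * bump \<rho> (y - p) \<partial>lebesgue_on D) / bump_mass TYPE('a)) p0"
    using bump_mass_pos[where 'a='a] by (intro continuous_intros) auto
  moreover have "\<forall>\<^sub>F p in nhds p0. frechet_derivative (harmonic_rep D u) (at p) i =
      (\<integral>y. g y * bump \<rho> (y - p) \<partial>lebesgue_on D) / bump_mass TYPE('a)"
  proof -
    have "frechet_derivative (harmonic_rep D u) (at p) i =
      (\<integral>y. g y * bump \<rho> (y - p) \<partial>lebesgue_on D) / bump_mass TYPE('a)" if p: "p \<in> ball p0 \<rho>" for p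
    proof (rule harmonic_rep_partial[OF assms(1,2) g \<rho>(1)])
      show "cball p (3 * \<rho>) \<subseteq> D"
      proof
        fix y assume "y \<in> cball p (3 * \<rho>)"
        then have "dist p0 y \<le> 4 * \<rho>"
          using p dist_triangle[of p0 y p] by simp
        with \<rho>(2) show "y \<in> D" by auto
      qed
    qed
    then show ?thesis
      using \<rho>(1) by (intro eventually_mono[OF eventually_nhds_in_open[of "ball p0 \<rho>"]]) auto
  qed
  ultimately show "isCont (\<lambda>p. frechet_derivative (harmonic_rep D u) (at p) i) p0"
    by (subst isCont_cong)
qed

lemma integral_bump_lebesgue_on:
  fixes p :: "'a::euclidean_space"
  assumes "open D" "0 < \<rho>" "cball p \<rho> \<subseteq> D"
  shows "(\<integral>y. bump \<rho> (y - p) \<partial>lebesgue_on D) = bump_mass TYPE('a)"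
proof -
  have "bump \<rho> (x - p) = 0" if "x \<notin> D" for x
    using that assms by (intro bump_eq_0) (auto simp: dist_norm norm_minus_commute subset_eq)
  then show ?thesis
    using assms continuous_on_bump[of \<rho> p] integral_bump[of \<rho> p]
    by (subst lebesgue_on_integral_eq_lborel) (auto intro: borel_measurable_continuous_onI)
qed

lemma sigma_finite_lebesgue_on:
  fixes D :: "'a::euclidean_space set"
  assumes "D \<in> sets lebesgue"
  shows "sigma_finite_measure (lebesgue_on D)"
proof
  show "\<exists>A. countable A \<and> A \<subseteq> sets (lebesgue_on D) \<and> \<Union>A = space (lebesgue_on D) \<and>
      (\<forall>a\<in>A. emeasure (lebesgue_on D) a \<noteq> \<infinity>)"
  proof (intro exI[of _ "range (\<lambda>n. D \<inter> cball 0 (real n))"] conjI ballI)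
    have "\<exists>n. norm x \<le> real n" for x :: 'a
      by (rule real_arch_simple)
    then show "\<Union>(range (\<lambda>n. D \<inter> cball 0 (real n))) = space (lebesgue_on D)"
      by auto
    show "range (\<lambda>n. D \<inter> cball 0 (real n)) \<subseteq> sets (lebesgue_on D)"
      using sets.Int[OF assms fmeasurableD[OF lmeasurable_cball]] assms
      by (auto simp: sets_restrict_space_iff)
    fix a assume "a \<in> range (\<lambda>n. D \<inter> cball 0 (real n))"
    then obtain n where a: "a = D \<inter> cball 0 (real n)" by auto
    then have "emeasure (lebesgue_on D) a = emeasure lebesgue a"
      using assms by (intro emeasure_restrict_space) auto
    also have "\<dots> \<le> emeasure lebesgue (cball 0 (real n) :: 'a set)"
      unfolding a by (intro emeasure_mono) auto
    also have "\<dots> < \<infinity>"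
      using lmeasurable_cball fmeasurableD2 by (metis infinity_ennreal_def less_top)
    finally show "emeasure (lebesgue_on D) a \<noteq> \<infinity>"
      by simp
  qed auto
qed

text \<open>
  For a test function \<open>\<phi>\<close>, Fubini moves the mollification from \<open>u\<close> to \<open>\<phi>\<close>. As the radius tends to 0
  the mollified test functions tend to \<open>\<phi>\<close>, while the integral against the representative does not
  change. So \<open>u\<close> and its representative have the same integrals against all test functions.
\<close>

lemma harmonic_rep_AE_eq:
  fixes u :: "'a::euclidean_space \<Rightarrow> real"
  assumes "open D" "u \<in> H_star D"
  shows "AE x in lebesgue_on D. u x = harmonic_rep D u x"
proof -
  let ?w = "harmonic_rep D u" and ?M = "lebesgue_on D" and ?N = "bump_mass TYPE('a)"
  have D: "D \<in> sets lebesgue"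
    using assms(1) by auto
  interpret M: sigma_finite_measure ?M
    using D by (rule sigma_finite_lebesgue_on)
  interpret MM: pair_sigma_finite ?M ?M ..
  have "continuous_on D ?w"
    using harmonic_rep_differentiable[OF assms]
    by (rule continuous_on_if_has_derivative)
  then have wL: "?w \<in> L1_loc D"
    by (rule continuous_on_imp_L1_loc[OF assms(1)])
  note uL = H_star_L1_loc[OF assms(2)]
  have "(\<integral>x. u x * \<phi> x \<partial>?M) = (\<integral>x. ?w x * \<phi> x \<partial>?M)" if \<phi>: "\<phi> \<in> test_functions D" for \<phi>
  proof -
    note c\<phi> = test_function_continuous[OF \<phi>]
    obtain K where K: "compact K" "K \<subseteq> D" "\<And>x. x \<notin> K \<Longrightarrow> \<phi> x = 0"
      using test_function_support[OF \<phi>] by metis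
    obtain B where B: "0 \<le> B" "\<And>x. \<bar>\<phi> x\<bar> \<le> B"
      using continuous_compact_support_bounded[OF c\<phi> K(1,3)] by metis
    obtain e where e: "0 < e" "(\<Union>x\<in>K. cball x e) \<subseteq> D"
      using compact_subset_open_imp_cball_epsilon_subset[OF K(1) assms(1) K(2)] by blast
    define \<epsilon> where "\<epsilon> = e / 2"
    \<comment> \<open>With half of the margin \<open>e\<close>, mollified test functions live in \<open>K'\<close> and balls around points of \<open>K'\<close> remain in \<open>D\<close>.\<close>
    define K' where "K' = (\<lambda>(x, z). x + z) ` (K \<times> cball 0 \<epsilon>)"
    have K': "compact K'"
      unfolding K'_def case_prod_unfold using K(1)
      by (intro compact_continuous_image compact_Times continuous_intros) auto
    have near: "y \<in> K'" if "x \<in> K" "norm (y - x) \<le> \<epsilon>" for x y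
      unfolding K'_def using that by (intro image_eqI[of _ _ "(x, y - x)"]) auto
    have K'D: "cball y \<epsilon> \<subseteq> D" if y: "y \<in> K'" for y
    proof
      fix z assume z: "z \<in> cball y \<epsilon>"
      obtain x where x: "x \<in> K" "dist x y \<le> \<epsilon>"
        using y unfolding K'_def by (auto simp: dist_norm)
      then have "z \<in> cball x e"
        using z dist_triangle[of x z y] by (simp add: \<epsilon>_def)
      with x e show "z \<in> D" by blast
    qed
    have "K' \<subseteq> D"
      using K'D e(1) by (force simp: \<epsilon>_def)
    define \<rho> where "\<rho> n = \<epsilon> / real (n + 2)" for n :: nat
    have \<rho>: "0 < \<rho> n" "\<rho> n < \<epsilon>" for n
      using e(1) by (auto simp: \<rho>_def \<epsilon>_def field_simps intro!: add_pos_nonneg)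
    have \<rho>0: "\<rho> \<longlonglongrightarrow> 0"
      unfolding \<rho>_def by (rule LIMSEQ_ignore_initial_segment[OF lim_const_over_n, of _ 2])
    define A where "A n y = (\<integral>p. \<phi> p * bump (\<rho> n) (y - p) \<partial>?M)" for n y
    have A0: "A n y = 0" if "y \<notin> K'" for n y
    proof -
      have "\<phi> p * bump (\<rho> n) (y - p) = 0" for p
      proof (cases "p \<in> K")
        case True
        then have "\<rho> n \<le> norm (y - p)"
          using near[of p y] that \<rho>[of n] by linarith
        then show ?thesis
          using \<rho>(1)[of n] by (simp add: bump_eq_0)
      qed (simp add: K(3))
      then show ?thesis
        unfolding A_def by (simp only: Bochner_Integration.integral_zero)
    qed
    have sym: "bump (\<rho> n) (y - p) = bump (\<rho> n) (p - y)" for n and y p :: 'a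
      using bump_minus[of "\<rho> n" "p - y"] by simp
    have bint: "integrable ?M (\<lambda>p. bump (\<rho> n) (p - y))" "(\<integral>p. bump (\<rho> n) (p - y) \<partial>?M) = ?N"
      and \<phi>int: "integrable ?M (\<lambda>p. \<phi> p * bump (\<rho> n) (p - y))"
      if "y \<in> K'" for n y
    proof -
      have sub: "cball y (\<rho> n) \<subseteq> D"
        using K'D[OF that] \<rho>[of n] by (auto simp: subset_eq)
      show "(\<integral>p. bump (\<rho> n) (p - y) \<partial>?M) = ?N"
        by (rule integral_bump_lebesgue_on[OF assms(1) \<rho>(1) sub])
      show "integrable ?M (\<lambda>p. bump (\<rho> n) (p - y))"
        using L1_loc_mult_bump_integrable[OF assms(1) _ sub \<rho>(1), of "\<lambda>x. 1"]
        by (simp add: continuous_on_imp_L1_loc[OF assms(1)])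
      show "integrable ?M (\<lambda>p. \<phi> p * bump (\<rho> n) (p - y))"
        using c\<phi> by (intro L1_loc_mult_bump_integrable[OF assms(1) _ sub \<rho>(1)]
            continuous_on_imp_L1_loc[OF assms(1)]) (auto intro: continuous_on_subset)
    qed
    have dev: "\<bar>A n y - c * ?N\<bar> \<le> \<eta> * ?N"
      if y: "y \<in> K'" and c: "\<And>p. norm (p - y) < \<rho> n \<Longrightarrow> \<bar>\<phi> p - c\<bar> \<le> \<eta>" for n y c \<eta>
    proof -
      have "A n y - c * ?N = (\<integral>p. \<phi> p * bump (\<rho> n) (p - y) - c * bump (\<rho> n) (p - y) \<partial>?M)"
        using bint[OF y] \<phi>int[OF y] by (simp add: A_def sym)
      also have "\<bar>\<dots>\<bar> \<le> (\<integral>p. \<eta> * bump (\<rho> n) (p - y) \<partial>?M)"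
      proof (rule order_trans[OF integral_abs_bound], rule integral_mono)
        fix p
        show "\<bar>\<phi> p * bump (\<rho> n) (p - y) - c * bump (\<rho> n) (p - y)\<bar> \<le> \<eta> * bump (\<rho> n) (p - y)"
        proof (cases "norm (p - y) < \<rho> n")
          case True
          have "\<bar>\<phi> p * bump (\<rho> n) (p - y) - c * bump (\<rho> n) (p - y)\<bar> = \<bar>\<phi> p - c\<bar> * bump (\<rho> n) (p - y)"
            using bump_nonneg[of "\<rho> n" "p - y"] \<rho>(1)[of n]
            by (simp add: left_diff_distrib[symmetric] abs_mult)
          also have "\<dots> \<le> \<eta> * bump (\<rho> n) (p - y)"
            using c[OF True] bump_nonneg[of "\<rho> n" "p - y"] \<rho>(1)[of n] by (intro mult_right_mono) auto
          finally show ?thesis .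
        next
          case False
          then show ?thesis
            using \<rho>(1)[of n] by (simp add: bump_eq_0)
        qed
      qed (use bint[OF y] \<phi>int[OF y] in auto)
      also have "\<dots> = \<eta> * ?N"
        using bint[OF y] by simp
      finally show ?thesis .
    qed
    have Abound: "\<bar>A n y\<bar> \<le> B * ?N * indicator K' y" for n y
    proof (cases "y \<in> K'")
      case True
      then show ?thesis
        using dev[OF True, of n 0 B] B by simp
    qed (simp add: A0)
    have Alim: "(\<lambda>n. A n y) \<longlonglongrightarrow> \<phi> y * ?N" for y
    proof (cases "y \<in> K'")
      case True
      show ?thesis
      proof (rule LIMSEQ_I)
        fix r :: real assume "0 < r"
        define \<eta> where "\<eta> = r / (2 * ?N)"
        have \<eta>: "0 < \<eta>" "\<eta> * ?N < r"
          using \<open>0 < r\<close> bump_mass_pos[where 'a='a] by (auto simp: \<eta>_def)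
        obtain \<delta> where \<delta>: "0 < \<delta>" "\<And>p. dist p y < \<delta> \<Longrightarrow> dist (\<phi> p) (\<phi> y) < \<eta>"
          using c\<phi> \<eta>(1) unfolding continuous_on_iff by (metis UNIV_I)
        obtain n0 where n0: "\<And>n. n \<ge> n0 \<Longrightarrow> \<bar>\<rho> n\<bar> < \<delta>"
          using LIMSEQ_D[OF \<rho>0 \<delta>(1)] by auto
        have "norm (A n y - \<phi> y * ?N) < r" if "n \<ge> n0" for n
        proof -
          have "\<bar>\<phi> p - \<phi> y\<bar> \<le> \<eta>" if "norm (p - y) < \<rho> n" for p
          proof -
            have "dist p y < \<delta>"
              using n0[OF \<open>n \<ge> n0\<close>] that by (simp add: dist_norm)
            from \<delta>(2)[OF this] show ?thesis
              by (simp add: dist_norm)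
          qed
          then have "\<bar>A n y - \<phi> y * ?N\<bar> \<le> \<eta> * ?N"
            by (rule dev[OF True])
          with \<eta>(2) show ?thesis by simp
        qed
        then show "\<exists>n0. \<forall>n\<ge>n0. norm (A n y - \<phi> y * ?N) < r" by blast
      qed
    next
      case False
      then have "y \<notin> K"
        using near[of y y] e(1) by (auto simp: \<epsilon>_def)
      then show ?thesis
        using A0[OF False] K(3) by simp
    qed
    have id: "(\<lambda>x. x) \<in> ?M \<rightarrow>\<^sub>M borel"
      by (intro measurable_restrict_space1 measurable_completion) simp
    have um: "u \<in> borel_measurable ?M"
      using uL by (simp add: L1_loc_def)
    have dom: "integrable ?M (\<lambda>y. \<bar>u y\<bar> * (C * indicator K' y))" if "0 \<le> C" for C
    proof (rule L1_loc_mult_integrable[where K=K' and B=C, OF assms(1) L1_loc_abs[OF uL]])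
      show "(\<lambda>y. C * indicator K' y) \<in> borel_measurable borel"
        using K' by (intro borel_measurable_times borel_measurable_const borel_measurable_indicator)
          (simp add: borel_compact)
    qed (use K' \<open>K' \<subseteq> D\<close> that in \<open>auto simp: indicator_def\<close>)
    have fub: "integrable (?M \<Otimes>\<^sub>M ?M) (\<lambda>(p, y). \<phi> p * (u y * bump (\<rho> n) (y - p)))" for n
    proof -
      define C where "C = 2 / \<rho> n ^ DIM('a)"
      have C: "0 \<le> C" "\<And>z::'a. bump (\<rho> n) z \<le> C"
        using \<rho>(1)[of n] bump_le[OF \<rho>(1)] by (auto simp: C_def)
      have \<phi>M: "\<phi> \<in> borel_measurable ?M"
        using c\<phi> by (intro measurable_lebesgue_on_if_borel borel_measurable_continuous_onI)
      have "integrable ?M (\<lambda>x. 1 * \<phi> x)"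
        by (rule L1_loc_mult_test_integrable[OF assms(1) _ \<phi>]) (simp add: continuous_on_imp_L1_loc[OF assms(1)])
      then have \<phi>I: "integrable ?M \<phi>" by simp
      note d = dom[OF C(1)]
      have "integrable (?M \<Otimes>\<^sub>M ?M) (\<lambda>(p, y). \<phi> p * (\<bar>u y\<bar> * (C * indicator K' y)))"
      proof (rule MM.Fubini_integrable)
        show "(\<lambda>(p, y). \<phi> p * (\<bar>u y\<bar> * (C * indicator K' y))) \<in> borel_measurable (?M \<Otimes>\<^sub>M ?M)"
          unfolding case_prod_unfold
          by (rule borel_measurable_times[OF measurable_compose[OF measurable_fst \<phi>M]
                measurable_compose[OF measurable_snd borel_measurable_integrable[OF d]]])
        show "integrable ?M (\<lambda>x. \<integral>y. norm (case (x, y) of (p, y) \<Rightarrow> \<phi> p * (\<bar>u y\<bar> * (C * indicator K' y))) \<partial>?M)"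
          using \<phi>I by (simp add: abs_mult)
        show "AE x in ?M. integrable ?M (\<lambda>y. case (x, y) of (p, y) \<Rightarrow> \<phi> p * (\<bar>u y\<bar> * (C * indicator K' y)))"
          using d by simp
      qed
      then show ?thesis
      proof (rule Bochner_Integration.integrable_bound)
        have "(\<lambda>x. bump (\<rho> n) (snd x - fst x)) \<in> borel_measurable (?M \<Otimes>\<^sub>M ?M)"
        proof (rule measurable_compose[where g="bump (\<rho> n)" and N=borel])
          show "(\<lambda>x. snd x - fst x) \<in> ?M \<Otimes>\<^sub>M ?M \<rightarrow>\<^sub>M borel"
            using measurable_compose[OF measurable_fst id] measurable_compose[OF measurable_snd id]
            by (intro borel_measurable_diff) auto
          show "bump (\<rho> n) \<in> borel_measurable borel"
            using continuous_on_bump[OF \<rho>(1), of n 0] by (intro borel_measurable_continuous_onI) simp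
        qed
        then show "(\<lambda>(p, y). \<phi> p * (u y * bump (\<rho> n) (y - p))) \<in> borel_measurable (?M \<Otimes>\<^sub>M ?M)"
          unfolding case_prod_unfold
          by (intro borel_measurable_times measurable_compose[OF measurable_fst \<phi>M]
              measurable_compose[OF measurable_snd um])
        have "\<bar>\<phi> p * (u y * bump (\<rho> n) (y - p))\<bar> \<le> \<bar>\<phi> p * (\<bar>u y\<bar> * (C * indicator K' y))\<bar>" for p y
        proof (cases "p \<in> K \<and> norm (y - p) < \<rho> n")
          case True
          then have "y \<in> K'"
            using near[of p y] \<rho>(2)[of n] by auto
          then show ?thesis
            using C(1) C(2)[of "y - p"] bump_nonneg[of "\<rho> n" "y - p"] \<rho>(1)[of n]
            by (auto simp: abs_mult intro!: mult_left_mono)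
        next
          case False
          then have "\<phi> p = 0 \<or> bump (\<rho> n) (y - p) = 0"
            using K(3) bump_eq_0(1)[OF \<rho>(1)] by (metis not_less)
          then show ?thesis by auto
        qed
        then show "AE x in ?M \<Otimes>\<^sub>M ?M. norm (case x of (p, y) \<Rightarrow> \<phi> p * (u y * bump (\<rho> n) (y - p)))
            \<le> norm (case x of (p, y) \<Rightarrow> \<phi> p * (\<bar>u y\<bar> * (C * indicator K' y)))"
          by (intro AE_I2) (simp add: case_prod_unfold)
      qed
    qed
    have inner: "(\<integral>p. \<phi> p * (u y * bump (\<rho> n) (y - p)) \<partial>?M) = u y * A n y" for n y
    proof -
      have "(\<integral>p. \<phi> p * (u y * bump (\<rho> n) (y - p)) \<partial>?M) = (\<integral>p. u y * (\<phi> p * bump (\<rho> n) (y - p)) \<partial>?M)"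
        by (simp add: mult_ac)
      then show ?thesis by (simp add: A_def)
    qed
    have const: "(\<integral>y. u y * A n y \<partial>?M) = (\<integral>x. ?w x * \<phi> x \<partial>?M) * ?N" for n
    proof -
      have "(\<integral>y. u y * A n y \<partial>?M) = (\<integral>y. (\<integral>p. \<phi> p * (u y * bump (\<rho> n) (y - p)) \<partial>?M) \<partial>?M)"
        by (simp add: inner)
      also have "\<dots> = (\<integral>p. (\<integral>y. \<phi> p * (u y * bump (\<rho> n) (y - p)) \<partial>?M) \<partial>?M)"
        using fub by (rule MM.Fubini_integral)
      also have "\<dots> = (\<integral>p. (?w p * \<phi> p) * ?N \<partial>?M)"
      proof (rule Bochner_Integration.integral_cong[OF refl])
        fix p
        show "(\<integral>y. \<phi> p * (u y * bump (\<rho> n) (y - p)) \<partial>?M) = (?w p * \<phi> p) * ?N"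
        proof (cases "p \<in> K")
          case True
          then have "ball p \<epsilon> \<subseteq> D"
            using e by (force simp: \<epsilon>_def)
          with \<rho> have "?w p = (\<integral>y. u y * bump (\<rho> n) (y - p) \<partial>?M) / ?N"
            by (intro harmonic_rep_eq[OF assms])
          then show ?thesis
            using bump_mass_pos[where 'a='a] by simp
        qed (simp add: K(3))
      qed
      also have "\<dots> = (\<integral>x. ?w x * \<phi> x \<partial>?M) * ?N"
        by simp
      finally show ?thesis .
    qed
    have "(\<lambda>n. \<integral>y. u y * A n y \<partial>?M) \<longlonglongrightarrow> (\<integral>y. u y * (\<phi> y * ?N) \<partial>?M)"
    proof (rule integral_dominated_convergence)
      show "integrable ?M (\<lambda>y. \<bar>u y\<bar> * (B * ?N * indicator K' y))"
        using B(1) bump_mass_pos[where 'a='a] by (intro dom) simp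
      have "integrable ?M (\<lambda>y. u y * (\<phi> y * ?N))"
        using integrable_mult_left[OF L1_loc_mult_test_integrable[OF assms(1) uL \<phi>], of ?N]
        by (simp add: mult.assoc)
      then show "(\<lambda>y. u y * (\<phi> y * ?N)) \<in> borel_measurable ?M"
        by (rule borel_measurable_integrable)
      show "(\<lambda>y. u y * A n y) \<in> borel_measurable ?M" for n
        using borel_measurable_integrable[OF MM.integrable_snd[OF fub[of n]]] by (simp add: inner)
      show "AE y in ?M. (\<lambda>n. u y * A n y) \<longlonglongrightarrow> u y * (\<phi> y * ?N)"
        by (intro AE_I2 tendsto_mult tendsto_const Alim)
      show "AE y in ?M. norm (u y * A n y) \<le> \<bar>u y\<bar> * (B * ?N * indicator K' y)" for n
        by (intro AE_I2) (use Abound in \<open>simp add: abs_mult mult_left_mono\<close>)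
    qed
    then have "(\<integral>x. ?w x * \<phi> x \<partial>?M) * ?N = (\<integral>y. u y * (\<phi> y * ?N) \<partial>?M)"
      by (simp add: const LIMSEQ_const_iff)
    also have "\<dots> = (\<integral>y. u y * \<phi> y \<partial>?M) * ?N"
      by (simp add: mult.assoc[symmetric])
    finally show ?thesis
      using bump_mass_pos[where 'a='a] by simp
  qed
  then have "(\<integral>x. (u x - ?w x) * \<phi> x \<partial>?M) = 0" if "\<phi> \<in> test_functions D" for \<phi>
    using L1_loc_mult_test_integrable[OF assms(1) uL that] L1_loc_mult_test_integrable[OF assms(1) wL that] that
    by (simp add: left_diff_distrib)
  then have "AE x in ?M. u x - ?w x = 0"
    by (intro AE_0_if_orthogonal_test_functions assms(1) L1_loc_diff uL wL)
  then show ?thesis by simp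
qed

text \<open>
  The partial derivative is a weighted mean of \<open>g\<close>. By Jensen's inequality for the square its square
  is at most the weighted mean of \<open>g\<^sup>2\<close>, and the weight is at most \<open>2 / \<rho> ^ DIM('a)\<close> on the ball.
\<close>

lemma harmonic_gradient_estimate:
  fixes u :: "'a::euclidean_space \<Rightarrow> real"
  assumes "open D" "u \<in> H_star D" "has_weak_partial D i u g" "g \<in> L2 D" "0 < \<rho>" "cball p (3 * \<rho>) \<subseteq> D"
  shows "(frechet_derivative (harmonic_rep D u) (at p) i)\<^sup>2 \<le>
    2 / bump_mass TYPE('a) / \<rho> ^ DIM('a) * (\<integral>y. indicator (ball p \<rho>) y * (g y)\<^sup>2 \<partial>lebesgue_on D)"
proof -
  let ?N = "bump_mass TYPE('a)" and ?b = "\<lambda>y. bump \<rho> (y - p)"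
  note N = bump_mass_pos[where 'a='a]
  have sub: "cball p \<rho> \<subseteq> D"
    using assms(5,6) by (auto simp: subset_eq)
  have gL: "g \<in> L1_loc D"
    using assms(3) by (simp add: has_weak_partial_def)
  have gm: "g \<in> borel_measurable (lebesgue_on D)" "integrable (lebesgue_on D) (\<lambda>y. (g y)\<^sup>2)"
    using assms(4) by (auto simp: L2_def)
  have bm: "?b \<in> borel_measurable (lebesgue_on D)"
    using continuous_on_bump[OF assms(5)]
    by (intro measurable_lebesgue_on_if_borel borel_measurable_continuous_onI)
  define B where "B = 2 / \<rho> ^ DIM('a)"
  have bB: "0 \<le> ?b y" "?b y \<le> B * indicator (ball p \<rho>) y" for y
    using bump_nonneg[of \<rho> "y - p"] bump_le[OF assms(5), of "y - p"] bump_eq_0(1)[OF assms(5), of "y - p"] assms(5)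
    by (auto simp: B_def indicator_def dist_norm norm_minus_commute)
  have i1: "integrable (lebesgue_on D) (\<lambda>y. g y * ?b y)"
    by (rule L1_loc_mult_bump_integrable[OF assms(1) gL sub assms(5)])
  have i0: "integrable (lebesgue_on D) ?b"
    using L1_loc_mult_bump_integrable[OF assms(1) _ sub assms(5), of "\<lambda>x. 1"]
    by (simp add: continuous_on_imp_L1_loc[OF assms(1)])
  have i3: "integrable (lebesgue_on D) (\<lambda>y. indicator (ball p \<rho>) y * (g y)\<^sup>2)"
  proof (rule Bochner_Integration.integrable_bound[OF gm(2)])
    show "(\<lambda>y. indicator (ball p \<rho>) y * (g y)\<^sup>2) \<in> borel_measurable (lebesgue_on D)"
      by (intro borel_measurable_times[OF _ borel_measurable_integrable[OF gm(2)]]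
          measurable_lebesgue_on_if_borel[OF borel_measurable_indicator]) auto
  qed (auto simp: indicator_def)
  have i2: "integrable (lebesgue_on D) (\<lambda>y. (g y)\<^sup>2 * ?b y)"
  proof (rule Bochner_Integration.integrable_bound[OF integrable_mult_right[OF i3, of B]])
    show "(\<lambda>y. (g y)\<^sup>2 * ?b y) \<in> borel_measurable (lebesgue_on D)"
      using gm(1) bm by measurable
    show "AE y in lebesgue_on D. norm ((g y)\<^sup>2 * ?b y) \<le> norm (B * (indicator (ball p \<rho>) y * (g y)\<^sup>2))"
    proof (rule AE_I2)
      fix y
      have "0 \<le> B" using assms(5) by (simp add: B_def)
      then show "norm ((g y)\<^sup>2 * ?b y) \<le> norm (B * (indicator (ball p \<rho>) y * (g y)\<^sup>2))"
        using mult_right_mono[OF bB(2)[of y], of "(g y)\<^sup>2"] bB(1)[of y] by (simp add: abs_mult mult_ac)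
    qed
  qed
  define t where "t = (\<integral>y. g y * ?b y \<partial>lebesgue_on D) / ?N"
  \<comment> \<open>The variance of \<open>g\<close> around its weighted mean \<open>t\<close> is not negative.\<close>
  have "0 \<le> (\<integral>y. (g y - t)\<^sup>2 * ?b y \<partial>lebesgue_on D)"
    by (intro Bochner_Integration.integral_nonneg mult_nonneg_nonneg bB) simp
  also have "(\<lambda>y. (g y - t)\<^sup>2 * ?b y) = (\<lambda>y. (g y)\<^sup>2 * ?b y - 2 * t * (g y * ?b y) + t\<^sup>2 * ?b y)"
    by (auto simp: power2_eq_square algebra_simps)
  also have "(\<integral>y. (g y)\<^sup>2 * ?b y - 2 * t * (g y * ?b y) + t\<^sup>2 * ?b y \<partial>lebesgue_on D) =
      (\<integral>y. (g y)\<^sup>2 * ?b y \<partial>lebesgue_on D) - 2 * t * (\<integral>y. g y * ?b y \<partial>lebesgue_on D)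
        + t\<^sup>2 * (\<integral>y. ?b y \<partial>lebesgue_on D)"
    using i0 i1 i2 by simp
  also have "\<dots> = (\<integral>y. (g y)\<^sup>2 * ?b y \<partial>lebesgue_on D) - t\<^sup>2 * ?N"
    using N by (simp add: integral_bump_lebesgue_on[OF assms(1,5) sub] t_def power2_eq_square)
  also have "(\<integral>y. (g y)\<^sup>2 * ?b y \<partial>lebesgue_on D) \<le> (\<integral>y. B * (indicator (ball p \<rho>) y * (g y)\<^sup>2) \<partial>lebesgue_on D)"
  proof (rule integral_mono[OF i2 integrable_mult_right[OF i3]])
    fix y
    show "(g y)\<^sup>2 * ?b y \<le> B * (indicator (ball p \<rho>) y * (g y)\<^sup>2)"
      using mult_right_mono[OF bB(2)[of y], of "(g y)\<^sup>2"] by (simp add: mult_ac)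
  qed
  finally have "t\<^sup>2 \<le> B * (\<integral>y. indicator (ball p \<rho>) y * (g y)\<^sup>2 \<partial>lebesgue_on D) / ?N"
    using N by (simp add: field_simps)
  then show ?thesis
    using harmonic_rep_partial[OF assms(1-3,5,6)] by (simp add: t_def B_def mult_ac)
qed

text \<open>
  Collects what the rest of the argument uses about \<open>u\<close>. The weak derivatives of \<open>u\<close> are replaced by
  the classical ones of \<open>w\<close>, with which they agree almost everywhere.
\<close>

lemma H_star_harmonic_representative:
  fixes u :: "'a::euclidean_space \<Rightarrow> real"
  assumes D: "open D" and u: "u \<in> H_star D"
  obtains w w' where
    "AE x in lebesgue_on D. u x = w x"
    "\<And>x. x \<in> D \<Longrightarrow> (w has_derivative w' x) (at x)"
    "\<And>i. i \<in> Basis \<Longrightarrow> continuous_on D (\<lambda>x. w' x i)"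
    "\<And>i. i \<in> Basis \<Longrightarrow> integrable (lebesgue_on D) (\<lambda>x. (w' x i)\<^sup>2)"
    "\<And>i p \<rho>. \<lbrakk>i \<in> Basis; 0 < \<rho>; cball p (3 * \<rho>) \<subseteq> D\<rbrakk> \<Longrightarrow>
      (w' p i)\<^sup>2 \<le> 2 / bump_mass TYPE('a) / \<rho> ^ DIM('a) *
        (\<integral>y. indicator (ball p \<rho>) y * (w' y i)\<^sup>2 \<partial>lebesgue_on D)"
    "\<And>v v'. C1_W12 D v v' \<Longrightarrow> (\<integral>x. (\<Sum>i\<in>Basis. w' x i * v' x i) \<partial>lebesgue_on D) = 0"
proof -
  define w where "w = harmonic_rep D u"
  define w' where "w' x = frechet_derivative w (at x)" for x
  have ae: "AE x in lebesgue_on D. u x = w x"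
    unfolding w_def by (rule harmonic_rep_AE_eq[OF D u])
  have deriv: "(w has_derivative w' x) (at x)" if "x \<in> D" for x
    unfolding w_def w'_def by (rule harmonic_rep_differentiable[OF D u that])
  have cont: "continuous_on D (\<lambda>x. w' x i)" if "i \<in> Basis" for i
    unfolding w_def w'_def by (rule harmonic_rep_partial_continuous[OF D u that])
  have "\<forall>i\<in>Basis. \<exists>g. g \<in> L2 D \<and> has_weak_partial D i u g"
    using u by (auto simp: H_star_def BL_def)
  then obtain g where g: "\<And>i. i \<in> Basis \<Longrightarrow> g i \<in> L2 D" "\<And>i. i \<in> Basis \<Longrightarrow> has_weak_partial D i u (g i)"
    by metis
  have uL: "u \<in> L1_loc D"
    by (rule H_star_L1_loc[OF u])
  have w'm: "(\<lambda>x. w' x i) \<in> borel_measurable (lebesgue_on D)" if "i \<in> Basis" for i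
    by (rule measurable_lebesgue_on_if_continuous_on[OF D cont[OF that]])
  have gm: "g i \<in> borel_measurable (lebesgue_on D)" if "i \<in> Basis" for i
    using g(1)[OF that] by (simp add: L2_def)
  have wp: "has_weak_partial D i w (\<lambda>x. w' x i)" if "i \<in> Basis" for i
    by (rule has_weak_partial_classical[OF D deriv cont[OF that] that])
  have eq: "AE x in lebesgue_on D. g i x = w' x i" if i: "i \<in> Basis" for i
  proof -
    have "(\<integral>x. w x * frechet_derivative \<phi> (at x) i \<partial>lebesgue_on D) =
        (\<integral>x. u x * frechet_derivative \<phi> (at x) i \<partial>lebesgue_on D)" if \<phi>: "\<phi> \<in> test_functions D" for \<phi>
    proof (rule integral_cong_AE)
      note \<phi>' = test_function_partial[OF \<phi> i]
      show "(\<lambda>x. w x * frechet_derivative \<phi> (at x) i) \<in> borel_measurable (lebesgue_on D)"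
        using L1_loc_mult_test_integrable[OF D _ \<phi>'] wp[OF i]
        by (auto simp: has_weak_partial_def intro!: borel_measurable_integrable)
      show "(\<lambda>x. u x * frechet_derivative \<phi> (at x) i) \<in> borel_measurable (lebesgue_on D)"
        using L1_loc_mult_test_integrable[OF D uL \<phi>'] by (rule borel_measurable_integrable)
    qed (use ae in \<open>auto elim!: eventually_mono\<close>)
    then have "has_weak_partial D i w (g i)"
      using g(2)[OF i] wp[OF i] by (simp add: has_weak_partial_def)
    then show ?thesis
      by (rule has_weak_partial_AE_unique[OF D _ wp[OF i]])
  qed
  have int: "integrable (lebesgue_on D) (\<lambda>x. (w' x i)\<^sup>2)" if i: "i \<in> Basis" for i
  proof (rule integrable_cong_AE_imp)
    show "integrable (lebesgue_on D) (\<lambda>x. (g i x)\<^sup>2)"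
      using g(1)[OF i] by (simp add: L2_def)
    show "(\<lambda>x. (w' x i)\<^sup>2) \<in> borel_measurable (lebesgue_on D)"
      using w'm[OF i] by measurable
    show "AE x in lebesgue_on D. (g i x)\<^sup>2 = (w' x i)\<^sup>2"
      using eq[OF i] by eventually_elim simp
  qed
  have est: "(w' p i)\<^sup>2 \<le> 2 / bump_mass TYPE('a) / \<rho> ^ DIM('a) *
        (\<integral>y. indicator (ball p \<rho>) y * (w' y i)\<^sup>2 \<partial>lebesgue_on D)"
    if i: "i \<in> Basis" and \<rho>: "0 < \<rho>" "cball p (3 * \<rho>) \<subseteq> D" for i p \<rho>
  proof -
    have ind: "(indicator (ball p \<rho>) :: 'a \<Rightarrow> real) \<in> borel_measurable (lebesgue_on D)"
      by (intro measurable_lebesgue_on_if_borel[OF borel_measurable_indicator]) simp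
    have "(\<integral>y. indicator (ball p \<rho>) y * (g i y)\<^sup>2 \<partial>lebesgue_on D) =
        (\<integral>y. indicator (ball p \<rho>) y * (w' y i)\<^sup>2 \<partial>lebesgue_on D)"
      using eq[OF i] by (intro integral_cong_AE borel_measurable_times[OF ind] borel_measurable_power gm[OF i] w'm[OF i])
        (auto elim!: eventually_mono)
    with harmonic_gradient_estimate[OF D u g(2)[OF i] g(1)[OF i] \<rho>]
    show ?thesis
      by (simp add: w'_def w_def)
  qed
  have orth: "(\<integral>x. (\<Sum>i\<in>Basis. w' x i * v' x i) \<partial>lebesgue_on D) = 0"
    if v: "C1_W12 D v v'" for v v'
  proof -
    have "AE x in lebesgue_on D. \<forall>i\<in>Basis. g i x = w' x i"
      using eq by (intro AE_finite_allI) auto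
    moreover have "(\<lambda>x. v' x i) \<in> borel_measurable (lebesgue_on D)" if "i \<in> Basis" for i
      using v that by (intro measurable_lebesgue_on_if_continuous_on[OF D]) (simp add: C1_W12_def)
    ultimately have "(\<integral>x. (\<Sum>i\<in>Basis. w' x i * v' x i) \<partial>lebesgue_on D) =
        (\<integral>x. (\<Sum>i\<in>Basis. g i x * v' x i) \<partial>lebesgue_on D)"
      by (intro integral_cong_AE borel_measurable_sum borel_measurable_times gm w'm)
        (auto elim!: eventually_mono)
    also have "\<dots> = 0"
      by (rule H_star_orthogonal[OF D u g(2) v])
    finally show ?thesis .
  qed
  show ?thesis
    using that ae deriv cont int est orth by blast
qed

section \<open>Deep points in uniform domains\<close>

lemma sum_dist_le_curve_length:
  assumes "mono t" "range t \<subseteq> {0..1::real}"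
  shows "ennreal (\<Sum>k<n. dist (\<gamma> (t k)) (\<gamma> (t (Suc k)))) \<le> curve_length \<gamma>"
proof -
  have "ennreal (\<Sum>k<n. dist (\<gamma> (t k)) (\<gamma> (t (Suc k)))) = (\<Sum>k<n. ennreal (dist (\<gamma> (t k)) (\<gamma> (t (Suc k)))))"
    by (intro sum_ennreal[symmetric]) simp
  also have "\<dots> \<le> curve_length \<gamma>"
    unfolding curve_length_def by (rule SUP_upper2[of "(n, t)"]) (use assms in auto)
  finally show ?thesis .
qed

lemma dist_le_curve_length:
  assumes "a \<in> {0..1}" "b \<in> {0..1}" "a \<le> b"
  shows "ennreal (dist (\<gamma> a) (\<gamma> b)) \<le> curve_length \<gamma>"
proof -
  have "mono (\<lambda>k::nat. if k = 0 then a else b)"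
    using assms by (auto simp: mono_def)
  moreover have "range (\<lambda>k::nat. if k = 0 then a else b) \<subseteq> {0..1}"
    using assms by auto
  ultimately show ?thesis
    using sum_dist_le_curve_length[where t="\<lambda>k. if k = 0 then a else b" and n=1 and \<gamma>=\<gamma>] by simp
qed

text \<open>
  Enlarging the constant of a uniform domain to at least 1 is harmless and keeps the arithmetic with
  its powers simple. The complement is required to be nonempty so that \<open>infdist\<close> is the distance to
  it.
\<close>

definition uniform_const :: "'a::euclidean_space set \<Rightarrow> real \<Rightarrow> bool" where
  "uniform_const U C \<longleftrightarrow> open U \<and> - U \<noteq> {} \<and> 1 \<le> C \<and>
     (\<forall>x\<in>U. \<forall>y\<in>U. \<exists>\<gamma>. path \<gamma> \<and> path_image \<gamma> \<subseteq> U \<and> pathstart \<gamma> = x \<and> pathfinish \<gamma> = y \<and>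
        curve_length \<gamma> \<le> ennreal (C * dist x y) \<and>
        (\<forall>z\<in>path_image \<gamma>. min (dist x z) (dist z y) \<le> C * infdist z (- U)))"

lemma uniform_domain_imp_uniform_const:
  fixes U :: "'a::euclidean_space set"
  assumes "uniform_domain U" "- U \<noteq> {}"
  obtains C where "uniform_const U C"
proof -
  obtain C where C: "C > 0" "\<forall>x\<in>U. \<forall>y\<in>U. \<exists>\<gamma>.
        rectifiable \<gamma> \<and> path_image \<gamma> \<subseteq> U \<and> pathstart \<gamma> = x \<and> pathfinish \<gamma> = y \<and>
        curve_length \<gamma> \<le> ennreal (C * dist x y) \<and>
        (\<forall>z\<in>path_image \<gamma>. U = UNIV \<or> min (dist x z) (dist z y) \<le> C * infdist z (- U))"
    using assms(1) unfolding uniform_domain_def by blast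
  have "uniform_const U (max C 1)"
    unfolding uniform_const_def
  proof (intro conjI ballI)
    show "open U"
      using assms(1) by (simp add: uniform_domain_def is_domain_def)
    fix x y assume "x \<in> U" "y \<in> U"
    with C(2) obtain \<gamma> where \<gamma>: "rectifiable \<gamma>" "path_image \<gamma> \<subseteq> U" "pathstart \<gamma> = x" "pathfinish \<gamma> = y"
        "curve_length \<gamma> \<le> ennreal (C * dist x y)"
        "\<And>z. z \<in> path_image \<gamma> \<Longrightarrow> U = UNIV \<or> min (dist x z) (dist z y) \<le> C * infdist z (- U)"
      by metis
    have "curve_length \<gamma> \<le> ennreal (max C 1 * dist x y)"
      using \<gamma>(5) by (rule order_trans) (intro ennreal_leI mult_right_mono, auto)
    moreover have "min (dist x z) (dist z y) \<le> max C 1 * infdist z (- U)" if "z \<in> path_image \<gamma>" for z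
    proof -
      have "min (dist x z) (dist z y) \<le> C * infdist z (- U)"
        using \<gamma>(6)[OF that] assms(2) by auto
      also have "\<dots> \<le> max C 1 * infdist z (- U)"
        by (intro mult_right_mono infdist_nonneg) simp
      finally show ?thesis .
    qed
    ultimately show "\<exists>\<gamma>. path \<gamma> \<and> path_image \<gamma> \<subseteq> U \<and> pathstart \<gamma> = x \<and> pathfinish \<gamma> = y \<and>
        curve_length \<gamma> \<le> ennreal (max C 1 * dist x y) \<and>
        (\<forall>z\<in>path_image \<gamma>. min (dist x z) (dist z y) \<le> max C 1 * infdist z (- U))"
      using \<gamma>(1-4) by (intro exI[of _ \<gamma>]) (auto simp: rectifiable_def)
  qed (use assms(2) in auto)
  then show ?thesis by (rule that)
qed

text \<open>
  On a uniform curve from \<open>x\<close> to a point farther away than \<open>2 * s\<close> take a point at distance \<open>s\<close> from \<open>x\<close>.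
  It is at distance at least \<open>s\<close> from both end points, so the uniform condition makes it deep.
\<close>

lemma uniform_deep_point:
  fixes U :: "'a::euclidean_space set"
  assumes "uniform_const U C" "\<not> bounded U" "x \<in> U" "0 < s"
  obtains p where "p \<in> U" "dist x p = s" "s / C \<le> infdist p (- U)"
proof -
  have C: "1 \<le> C"
    using assms(1) by (simp add: uniform_const_def)
  obtain y where y: "y \<in> U" "2 * s < dist x y"
    using assms(2) unfolding bounded_def by (meson not_le)
  obtain \<gamma> where \<gamma>: "path \<gamma>" "path_image \<gamma> \<subseteq> U" "pathstart \<gamma> = x" "pathfinish \<gamma> = y"
      "\<And>z. z \<in> path_image \<gamma> \<Longrightarrow> min (dist x z) (dist z y) \<le> C * infdist z (- U)"
    using assms(1) \<open>x \<in> U\<close> y(1) unfolding uniform_const_def by metis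
  have "continuous_on {0..1} (\<lambda>t. dist x (\<gamma> t))"
    using \<gamma>(1) by (intro continuous_intros) (simp add: path_def)
  moreover have "dist x (\<gamma> 0) \<le> s" "s \<le> dist x (\<gamma> 1)"
    using \<gamma>(3,4) y assms(4) by (auto simp: pathstart_def pathfinish_def)
  ultimately obtain t where t: "0 \<le> t" "t \<le> 1" "dist x (\<gamma> t) = s"
    using IVT'[of "\<lambda>t. dist x (\<gamma> t)" 0 s 1] by auto
  then have z: "\<gamma> t \<in> path_image \<gamma>"
    by (simp add: path_image_def)
  have "s \<le> dist (\<gamma> t) y"
    using dist_triangle[of x y "\<gamma> t"] t(3) y(2) by linarith
  then have "s \<le> C * infdist (\<gamma> t) (- U)"
    using \<gamma>(5)[OF z] t(3) by simp
  then have "s / C \<le> infdist (\<gamma> t) (- U)"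
    using C by (simp add: field_simps)
  then show ?thesis
    using that[of "\<gamma> t"] z \<gamma>(2) t(3) by auto
qed

lemma infdist_gt_imp_cball_subset:
  assumes "r < infdist z (- U)"
  shows "cball z r \<subseteq> U"
proof
  fix y assume "y \<in> cball z r"
  then have "dist z y < infdist z (- U)"
    using assms by simp
  then show "y \<in> U"
    using infdist_le[of y "- U" z] by force
qed

text \<open>
  Close to an end point the depth of the end point is inherited, far from both end points the uniform
  condition applies. The balance of the two gives the factor \<open>C + 1\<close>.
\<close>

lemma uniform_deep_curve:
  fixes U :: "'a::euclidean_space set"
  assumes "uniform_const U C" "p \<in> U" "q \<in> U" "0 < s"
    and deep: "s / C \<le> infdist p (- U)" "s / C \<le> infdist q (- U)"
  obtains \<gamma> where "path \<gamma>" "path_image \<gamma> \<subseteq> U" "pathstart \<gamma> = p" "pathfinish \<gamma> = q"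
    "curve_length \<gamma> \<le> ennreal (C * dist p q)"
    "\<And>z. z \<in> path_image \<gamma> \<Longrightarrow> s / (C * (C + 1)) \<le> infdist z (- U)"
proof -
  have C: "1 \<le> C" and ne: "- U \<noteq> {}"
    using assms(1) by (simp_all add: uniform_const_def)
  obtain \<gamma> where \<gamma>: "path \<gamma>" "path_image \<gamma> \<subseteq> U" "pathstart \<gamma> = p" "pathfinish \<gamma> = q"
      "curve_length \<gamma> \<le> ennreal (C * dist p q)"
      "\<And>z. z \<in> path_image \<gamma> \<Longrightarrow> min (dist p z) (dist z q) \<le> C * infdist z (- U)"
    using assms(1-3) unfolding uniform_const_def by metis
  have "s / (C * (C + 1)) \<le> infdist z (- U)" if z: "z \<in> path_image \<gamma>" for z
  proof -
    let ?d = "infdist z (- U)"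
    have "infdist p (- U) \<le> ?d + dist p z" "infdist q (- U) \<le> ?d + dist q z"
      by (rule infdist_triangle)+
    then have "s / C \<le> ?d + min (dist p z) (dist z q)"
      using deep by (simp add: dist_commute min_def)
    also have "\<dots> \<le> ?d + C * ?d"
      using \<gamma>(6)[OF z] by simp
    finally have "s / C \<le> (C + 1) * ?d"
      by (simp add: algebra_simps)
    then have "s \<le> infdist z (- U) * (C * (C + 1))"
      using C by (simp add: field_simps)
    then show ?thesis
      using C by (subst pos_divide_le_eq) auto
  qed
  with \<gamma> that show ?thesis by blast
qed

text \<open>
  The only information about harmonic functions that the geometric part needs: \<open>\<mu>\<close> stands for the
  measure with density the square of the gradient.
\<close>

definition energy_bounded_gradient ::
    "'a::euclidean_space set \<Rightarrow> ('a \<Rightarrow> real) \<Rightarrow> ('a \<Rightarrow> 'a \<Rightarrow> real) \<Rightarrow> 'a measure \<Rightarrow> real \<Rightarrow> bool" where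
  "energy_bounded_gradient D w w' \<mu> A \<longleftrightarrow>
     finite_measure \<mu> \<and> sets \<mu> = sets borel \<and> 0 \<le> A \<and>
     (\<forall>x\<in>D. (w has_derivative w' x) (at x)) \<and>
     (\<forall>p \<rho> h. 0 < \<rho> \<longrightarrow> cball p (3 * \<rho>) \<subseteq> D \<longrightarrow>
        \<bar>w' p h\<bar> \<le> A * sqrt (measure \<mu> (ball p \<rho>) / \<rho> ^ DIM('a)) * norm h)"

text \<open>
  Along the curve that joins the two deep points \<open>w\<close> is locally Lipschitz, with a constant given by the
  gradient bound on balls of radius comparable to \<open>s\<close>, and the curve has length at most \<open>6 * C * s\<close>.
\<close>

lemma deep_points_oscillation:
  fixes U :: "'a::euclidean_space set" and w :: "'a \<Rightarrow> real"
  assumes U: "uniform_const U C" "U \<subseteq> D"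
    and w: "energy_bounded_gradient D w w' \<mu> A"
    and pq: "p \<in> U" "q \<in> U" "0 < s" "s / C \<le> infdist p (- U)" "s / C \<le> infdist q (- U)" "dist p q \<le> 6 * s"
  shows "\<bar>w p - w q\<bar> \<le> A * (6 * C) * sqrt ((8 * (C * (C + 1))) ^ DIM('a)) * s *
    sqrt (measure \<mu> (ball p ((6 * C + 1) * s)) / s ^ DIM('a))"
proof -
  interpret finite_measure \<mu>
    using w by (simp add: energy_bounded_gradient_def)
  have \<mu>: "sets \<mu> = sets borel" and "0 \<le> A"
    and deriv: "\<And>x. x \<in> D \<Longrightarrow> (w has_derivative w' x) (at x)"
    using w by (auto simp: energy_bounded_gradient_def)
  have C: "1 \<le> C"
    using U(1) by (simp add: uniform_const_def)
  obtain \<gamma> where \<gamma>: "path \<gamma>" "path_image \<gamma> \<subseteq> U" "pathstart \<gamma> = p" "pathfinish \<gamma> = q"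
    "curve_length \<gamma> \<le> ennreal (C * dist p q)"
    "\<And>z. z \<in> path_image \<gamma> \<Longrightarrow> s / (C * (C + 1)) \<le> infdist z (- U)"
    using uniform_deep_curve[OF U(1) pq(1-5)] by blast
  define \<delta> where "\<delta> = s / (C * (C + 1))"
  \<comment> \<open>Then \<open>cball y (3 * \<rho>)\<close> stays inside \<open>U\<close> for all \<open>y\<close> within \<open>\<delta> / 2\<close> of the curve.\<close>
  define \<rho> where "\<rho> = \<delta> / 8"
  have "2 \<le> C * (C + 1)"
    using mult_mono[of 1 C 2 "C + 1"] C by simp
  then have \<delta>: "0 < \<delta>" "\<delta> \<le> s / 2"
    unfolding \<delta>_def using pq(3) divide_left_mono[of 2 "C * (C + 1)" s] by auto
  have \<rho>: "0 < \<rho>" "s / \<rho> = 8 * (C * (C + 1))"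
  proof -
    show "0 < \<rho>"
      using \<delta>(1) by (simp add: \<rho>_def)
    show "s / \<rho> = 8 * (C * (C + 1))"
      unfolding \<rho>_def \<delta>_def using pq(3) by simp
  qed
  define L where "L = A * sqrt (measure \<mu> (ball p ((6 * C + 1) * s)) / \<rho> ^ DIM('a))"
  have "0 \<le> L"
    using \<open>0 \<le> A\<close> \<rho>(1) by (simp add: L_def)
  have len: "curve_length \<gamma> \<le> ennreal (6 * C * s)"
    using \<gamma>(5) by (rule order_trans) (use pq(6) C in \<open>auto intro!: ennreal_leI simp: mult_ac\<close>)
  have near: "dist p (\<gamma> t) \<le> 6 * C * s" if "t \<in> {0..1}" for t
  proof -
    have "ennreal (dist (\<gamma> 0) (\<gamma> t)) \<le> ennreal (6 * C * s)"
      using that by (intro order_trans[OF dist_le_curve_length len]) auto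
    then show ?thesis
      using \<gamma>(3) C pq(3) by (simp add: pathstart_def)
  qed
  have lip: "\<bar>w (\<gamma> t) - w z\<bar> \<le> L * dist (\<gamma> t) z" if t: "t \<in> {0..1}" and z: "dist (\<gamma> t) z < \<delta> / 2" for t z
  proof -
    have "norm (w (\<gamma> t) - w z) \<le> L * norm (\<gamma> t - z)"
    proof (rule differentiable_bound[of "ball (\<gamma> t) (\<delta> / 2)"])
      fix y assume y: "y \<in> ball (\<gamma> t) (\<delta> / 2)"
      have "\<delta> \<le> infdist (\<gamma> t) (- U)"
        using \<gamma>(6)[of "\<gamma> t"] t by (simp add: path_image_def \<delta>_def)
      also have "\<dots> \<le> infdist y (- U) + dist (\<gamma> t) y"
        by (rule infdist_triangle)
      finally have "3 * \<rho> < infdist y (- U)"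
        using y \<delta>(1) by (simp add: \<rho>_def)
      then have sub: "cball y (3 * \<rho>) \<subseteq> D"
        using infdist_gt_imp_cball_subset U(2) by blast
      then have "y \<in> D"
        using \<rho>(1) by (auto simp: subset_eq)
      then show "(w has_derivative w' y) (at y within ball (\<gamma> t) (\<delta> / 2))"
        by (rule has_derivative_at_withinI[OF deriv])
      have "ball y \<rho> \<subseteq> ball p ((6 * C + 1) * s)"
      proof
        fix v assume "v \<in> ball y \<rho>"
        then have "dist p v < dist p (\<gamma> t) + \<delta> / 2 + \<rho>"
          using y dist_triangle[of p v "\<gamma> t"] dist_triangle[of "\<gamma> t" v y] by simp
        also have "\<dots> \<le> (6 * C + 1) * s"
          using near[OF t] \<delta> by (simp add: \<rho>_def algebra_simps)
        finally show "v \<in> ball p ((6 * C + 1) * s)" by simp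
      qed
      then have m: "measure \<mu> (ball y \<rho>) \<le> measure \<mu> (ball p ((6 * C + 1) * s))"
        by (intro finite_measure_mono) (simp_all add: \<mu>)
      have "\<bar>w' y h\<bar> \<le> L * norm h" for h
      proof -
        have "\<bar>w' y h\<bar> \<le> A * sqrt (measure \<mu> (ball y \<rho>) / \<rho> ^ DIM('a)) * norm h"
          using w \<rho>(1) sub by (simp add: energy_bounded_gradient_def)
        also have "\<dots> \<le> L * norm h"
          unfolding L_def using \<open>0 \<le> A\<close> \<rho>(1) m
          by (intro mult_right_mono mult_left_mono real_sqrt_le_mono divide_right_mono) auto
        finally show ?thesis .
      qed
      then show "onorm (w' y) \<le> L"
        using \<open>0 \<le> L\<close> by (intro onorm_bound) auto
    qed (use z \<delta>(1) in auto)
    then show ?thesis by (simp add: dist_norm)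
  qed
  have "uniformly_continuous_on {0..1} \<gamma>"
    using \<gamma>(1) by (intro compact_uniformly_continuous) (auto simp: path_def)
  then obtain \<eta> where \<eta>: "0 < \<eta>"
      "\<And>a b. \<lbrakk>a \<in> {0..1}; b \<in> {0..1}; dist b a < \<eta>\<rbrakk> \<Longrightarrow> dist (\<gamma> b) (\<gamma> a) < \<delta> / 2"
    unfolding uniformly_continuous_on_def using \<delta>(1) by (metis half_gt_zero)
  obtain n :: nat where n: "0 < n" "1 / real n < \<eta>"
    using reals_Archimedean[OF \<eta>(1)] by (metis inverse_eq_divide zero_less_Suc)
  define t where "t k = min (real k / real n) 1" for k :: nat
  have t01: "t k \<in> {0..1}" for k
    by (auto simp: t_def)
  have "mono t"
    unfolding mono_def t_def by (intro allI impI min.mono divide_right_mono) auto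
  have step: "dist (t k) (t (Suc k)) < \<eta>" for k
  proof -
    have "\<bar>t k - t (Suc k)\<bar> \<le> \<bar>real k / real n - real (Suc k) / real n\<bar>"
      unfolding t_def by linarith
    also have "\<dots> = 1 / real n"
      by (simp add: diff_divide_distrib[symmetric])
    finally show ?thesis
      using n(2) by (simp add: dist_real_def)
  qed
  have "w p - w q = w (\<gamma> (t 0)) - w (\<gamma> (t n))"
    using \<gamma>(3,4) n(1) by (simp add: t_def pathstart_def pathfinish_def)
  also have "\<dots> = (\<Sum>k<n. w (\<gamma> (t k)) - w (\<gamma> (t (Suc k))))"
    by (rule sum_lessThan_telescope'[symmetric])
  also have "\<bar>\<dots>\<bar> \<le> (\<Sum>k<n. L * dist (\<gamma> (t k)) (\<gamma> (t (Suc k))))"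
    by (intro order_trans[OF sum_abs] sum_mono lip t01 \<eta>(2) step)
  also have "\<dots> \<le> L * (6 * C * s)"
  proof -
    have "ennreal (\<Sum>k<n. dist (\<gamma> (t k)) (\<gamma> (t (Suc k)))) \<le> ennreal (6 * C * s)"
      using \<open>mono t\<close> t01 by (intro order_trans[OF sum_dist_le_curve_length len]) auto
    then have "(\<Sum>k<n. dist (\<gamma> (t k)) (\<gamma> (t (Suc k)))) \<le> 6 * C * s"
      using C pq(3) by (subst (asm) ennreal_le_iff) auto
    then show ?thesis
      unfolding sum_distrib_left[symmetric] using \<open>0 \<le> L\<close> by (intro mult_left_mono)
  qed
  also have "L = A * sqrt ((8 * (C * (C + 1))) ^ DIM('a)) * sqrt (measure \<mu> (ball p ((6 * C + 1) * s)) / s ^ DIM('a))"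
  proof -
    have "1 / \<rho> ^ DIM('a) = (8 * (C * (C + 1))) ^ DIM('a) / s ^ DIM('a)"
      unfolding \<rho>(2)[symmetric] using pq(3) by (simp add: power_divide)
    moreover have "measure \<mu> (ball p ((6 * C + 1) * s)) / \<rho> ^ DIM('a) =
        measure \<mu> (ball p ((6 * C + 1) * s)) * (1 / \<rho> ^ DIM('a))"
      by simp
    ultimately have "measure \<mu> (ball p ((6 * C + 1) * s)) / \<rho> ^ DIM('a) =
        (8 * (C * (C + 1))) ^ DIM('a) * (measure \<mu> (ball p ((6 * C + 1) * s)) / s ^ DIM('a))"
      by (simp only: times_divide_eq_right times_divide_eq_left mult.commute)
    then show ?thesis
      unfolding L_def by (simp only: real_sqrt_mult mult.assoc)
  qed
  finally show ?thesis
    by (simp add: mult_ac)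
qed

lemma
  fixes \<mu> :: "'a::euclidean_space measure"
  assumes \<mu>: "finite_measure \<mu>" "sets \<mu> = sets borel" and "0 \<le> r"
  shows nn_integral_emeasure_ball:
      "(\<integral>\<^sup>+x. emeasure \<mu> (ball x r) \<partial>lborel) = ennreal (unit_ball_vol DIM('a) * r ^ DIM('a)) * emeasure \<mu> UNIV"
    and measurable_emeasure_ball: "(\<lambda>x. emeasure \<mu> (ball x r)) \<in> borel_measurable borel"
proof -
  interpret M: finite_measure \<mu> by fact
  interpret P: pair_sigma_finite lborel \<mu> ..
  have sp: "space \<mu> = UNIV"
    using sets_eq_imp_space_eq[OF \<mu>(2)] by simp
  have "sets (lborel \<Otimes>\<^sub>M \<mu>) = sets (borel \<Otimes>\<^sub>M (borel :: 'a measure))"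
    using \<mu>(2) by (intro sets_pair_measure_cong) auto
  moreover have "(\<lambda>(x, y). indicator (ball x r) y) \<in> borel_measurable (borel \<Otimes>\<^sub>M (borel :: 'a measure))"
    unfolding case_prod_unfold mem_ball indicator_def by measurable
  ultimately have m: "(\<lambda>(x, y). indicator (ball x r) y :: ennreal) \<in> borel_measurable (lborel \<Otimes>\<^sub>M \<mu>)"
    using measurable_cong_sets[of "lborel \<Otimes>\<^sub>M \<mu>" "borel \<Otimes>\<^sub>M borel" borel borel] by blast
  have e: "emeasure \<mu> (ball x r) = (\<integral>\<^sup>+y. indicator (ball x r) y \<partial>\<mu>)" for x
    using \<mu>(2) by simp
  show "(\<lambda>x. emeasure \<mu> (ball x r)) \<in> borel_measurable borel"
    unfolding e using M.borel_measurable_nn_integral[OF m] by simp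
  have "(\<integral>\<^sup>+x. emeasure \<mu> (ball x r) \<partial>lborel) = (\<integral>\<^sup>+y. (\<integral>\<^sup>+x. indicator (ball x r) y \<partial>lborel) \<partial>\<mu>)"
    unfolding e by (rule P.Fubini'[OF m, symmetric])
  also have "\<dots> = (\<integral>\<^sup>+y. ennreal (unit_ball_vol DIM('a) * r ^ DIM('a)) \<partial>\<mu>)"
  proof (rule nn_integral_cong)
    fix y :: 'a
    have "(\<integral>\<^sup>+x. indicator (ball x r) y \<partial>lborel) = (\<integral>\<^sup>+x. indicator (ball y r) x \<partial>lborel)"
      by (intro nn_integral_cong) (simp add: indicator_def dist_commute)
    also have "\<dots> = ennreal (unit_ball_vol DIM('a) * r ^ DIM('a))"
      using assms(3) by (simp add: emeasure_ball)
    finally show "(\<integral>\<^sup>+x. indicator (ball x r) y \<partial>lborel) = ennreal (unit_ball_vol DIM('a) * r ^ DIM('a))" .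
  qed
  also have "\<dots> = ennreal (unit_ball_vol DIM('a) * r ^ DIM('a)) * emeasure \<mu> UNIV"
    by (simp add: sp)
  finally show "(\<integral>\<^sup>+x. emeasure \<mu> (ball x r) \<partial>lborel) = ennreal (unit_ball_vol DIM('a) * r ^ DIM('a)) * emeasure \<mu> UNIV" .
qed

section \<open>A Poincare inequality for uniform domains\<close>

text \<open>
  Cauchy-Schwarz with the weights \<open>2 ^ k\<close>, whose inverses sum to at most 2.
\<close>

lemma square_sum_le_geometric:
  fixes b :: "nat \<Rightarrow> real"
  shows "(\<Sum>k\<le>n. b k)\<^sup>2 \<le> (\<Sum>k\<le>n. 2 * 2 ^ k * (b k)\<^sup>2)"
proof -
  have "(\<Sum>k\<le>n. b k)\<^sup>2 = (\<Sum>k\<le>n. sqrt ((1 / 2) ^ k) * (sqrt (2 ^ k) * b k))\<^sup>2"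
    by (simp add: mult.assoc[symmetric] real_sqrt_mult[symmetric] power_mult_distrib[symmetric])
  also have "\<dots> \<le> (\<Sum>k\<le>n. (sqrt ((1 / 2) ^ k))\<^sup>2) * (\<Sum>k\<le>n. (sqrt (2 ^ k) * b k)\<^sup>2)"
    by (rule Cauchy_Schwarz_ineq_sum)
  also have "\<dots> = (\<Sum>k\<le>n. (1 / 2) ^ k) * (\<Sum>k\<le>n. 2 ^ k * (b k)\<^sup>2)"
    by (simp add: power_mult_distrib)
  also have "\<dots> \<le> 2 * (\<Sum>k\<le>n. 2 ^ k * (b k)\<^sup>2)"
  proof (rule mult_right_mono)
    have "(\<Sum>k\<le>n. (1 / 2) ^ k) = 2 - (1 / 2 :: real) ^ n"
      by (induction n) auto
    then show "(\<Sum>k\<le>n. (1 / 2) ^ k) \<le> (2::real)"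
      by simp
  qed (simp add: sum_nonneg)
  finally show ?thesis
    by (simp add: sum_distrib_left mult.assoc)
qed

text \<open>
  Telescopes over deep points \<open>p k\<close> at distance \<open>R / 2 ^ k\<close> from \<open>x\<close>, which tend to \<open>x\<close>. The base point
  \<open>q\<close> is one deep point of scale \<open>R\<close> that serves all \<open>x\<close> at once. The bound
  is stated with the energies of balls around \<open>x\<close>, which depend measurably on \<open>x\<close>, whereas the points
  \<open>p k\<close> are arbitrary choices.
\<close>

lemma oscillation_le_dyadic_energies:
  fixes U :: "'a::euclidean_space set" and w :: "'a \<Rightarrow> real"
  assumes U: "uniform_const U C" "U \<subseteq> D" "\<not> bounded U"
    and w: "energy_bounded_gradient D w w' \<mu> A"
    and "0 < R" and x: "x \<in> U" "norm x < 2 * R"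
    and q: "q \<in> U" "norm q \<le> 3 * R" "R / C \<le> infdist q (- U)"
  defines "B \<equiv> A * (6 * C) * sqrt ((8 * (C * (C + 1))) ^ DIM('a))"
  shows "ennreal ((w x - w q)\<^sup>2) \<le> (\<Sum>k. ennreal (2 * 2 ^ k * (B\<^sup>2 * (R / 2 ^ k)\<^sup>2 / (R / 2 ^ k) ^ DIM('a))) *
    emeasure \<mu> (ball x ((6 * C + 2) * (R / 2 ^ k))))"
proof -
  interpret finite_measure \<mu>
    using w by (simp add: energy_bounded_gradient_def)
  have \<mu>: "sets \<mu> = sets borel" and "0 \<le> A"
    and deriv: "\<And>x. x \<in> D \<Longrightarrow> (w has_derivative w' x) (at x)"
    using w by (auto simp: energy_bounded_gradient_def)
  have C: "1 \<le> C"
    using U(1) by (simp add: uniform_const_def)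
  have "0 \<le> B"
    using \<open>0 \<le> A\<close> C by (simp add: B_def)
  define s where "s k = R / 2 ^ k" for k :: nat
  have s: "0 < s k" "s k = 2 * s (Suc k)" for k
    using \<open>0 < R\<close> by (auto simp: s_def)
  have "\<exists>p. p \<in> U \<and> dist x p = s k \<and> s k / C \<le> infdist p (- U)" for k
    using uniform_deep_point[OF U(1,3) x(1) s(1)[of k]] by metis
  then obtain p where p: "\<And>k. p k \<in> U" "\<And>k. dist x (p k) = s k" "\<And>k. s k / C \<le> infdist (p k) (- U)"
    by metis
  define b where "b k = B * s k * sqrt (measure \<mu> (ball x ((6 * C + 2) * s k)) / s k ^ DIM('a))" for k
  have link: "\<bar>w (p k) - w z\<bar> \<le> b k"
    if z: "z \<in> U" "s k / C \<le> infdist z (- U)" "dist (p k) z \<le> 6 * s k" for k z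
  proof -
    have "\<bar>w (p k) - w z\<bar> \<le> B * s k * sqrt (measure \<mu> (ball (p k) ((6 * C + 1) * s k)) / s k ^ DIM('a))"
      unfolding B_def
      by (rule deep_points_oscillation[OF U(1,2) w p(1) z(1) s(1) p(3) z(2,3)])
    also have "\<dots> \<le> b k"
      unfolding b_def
    proof (intro mult_left_mono real_sqrt_le_mono divide_right_mono finite_measure_mono)
      show "ball (p k) ((6 * C + 1) * s k) \<subseteq> ball x ((6 * C + 2) * s k)"
      proof
        fix y assume "y \<in> ball (p k) ((6 * C + 1) * s k)"
        then have "dist x y < s k + (6 * C + 1) * s k"
          using dist_triangle[of x y "p k"] p(2)[of k] by simp
        then show "y \<in> ball x ((6 * C + 2) * s k)"
          by (simp add: algebra_simps)
      qed
      show "0 \<le> B * s k"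
        using \<open>0 \<le> B\<close> s(1)[of k] by simp
      show "0 \<le> s k ^ DIM('a)"
        using s(1)[of k] by simp
    qed (simp add: \<mu>)
    finally show ?thesis .
  qed
  have first: "\<bar>w (p 0) - w q\<bar> \<le> b 0"
  proof (rule link[OF q(1)])
    show "s 0 / C \<le> infdist q (- U)"
      using q(3) by (simp add: s_def)
    have "dist (p 0) q \<le> dist x (p 0) + dist x q"
      by (metis dist_commute dist_triangle)
    also have "dist x q \<le> norm x + norm q"
      by (simp add: dist_norm norm_triangle_ineq4)
    finally show "dist (p 0) q \<le> 6 * s 0"
      using p(2)[of 0] x(2) q(2) by (simp add: s_def)
  qed
  have step: "\<bar>w (p (Suc k)) - w (p k)\<bar> \<le> b (Suc k)" for k
  proof (rule link[OF p(1)])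
    have "s (Suc k) / C \<le> s k / C"
      using C s[of k] s(1)[of "Suc k"] by (intro divide_right_mono) auto
    then show "s (Suc k) / C \<le> infdist (p k) (- U)"
      using p(3)[of k] by linarith
    have "dist (p (Suc k)) (p k) \<le> dist x (p (Suc k)) + dist x (p k)"
      by (metis dist_commute dist_triangle)
    then show "dist (p (Suc k)) (p k) \<le> 6 * s (Suc k)"
      using p(2)[of k] p(2)[of "Suc k"] s[of k] s(1)[of "Suc k"] by simp
  qed
  have sum: "\<bar>w (p n) - w q\<bar> \<le> (\<Sum>k\<le>n. b k)" for n
  proof (induction n)
    case 0
    then show ?case using first by simp
  next
    case (Suc n)
    then show ?case using step[of n] by simp
  qed
  let ?c = "\<lambda>k. ennreal (2 * 2 ^ k * (B\<^sup>2 * (s k)\<^sup>2 / s k ^ DIM('a))) * emeasure \<mu> (ball x ((6 * C + 2) * s k))"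
  have b2: "ennreal (2 * 2 ^ k * (b k)\<^sup>2) = ?c k" for k
  proof -
    have "(b k)\<^sup>2 = B\<^sup>2 * (s k)\<^sup>2 * (measure \<mu> (ball x ((6 * C + 2) * s k)) / s k ^ DIM('a))"
      using s(1)[of k] unfolding b_def power_mult_distrib by (subst real_sqrt_pow2) auto
    then have eq: "2 * 2 ^ k * (b k)\<^sup>2 = 2 * 2 ^ k * (B\<^sup>2 * (s k)\<^sup>2 / s k ^ DIM('a)) * measure \<mu> (ball x ((6 * C + 2) * s k))"
      by simp
    show ?thesis
      unfolding eq emeasure_eq_measure using s(1)[of k] by (intro ennreal_mult) auto
  qed
  have fin: "ennreal ((w (p n) - w q)\<^sup>2) \<le> (\<Sum>k. ?c k)" for n
  proof -
    have "(w (p n) - w q)\<^sup>2 \<le> (\<Sum>k\<le>n. b k)\<^sup>2"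
      using sum[of n] by (intro power2_le_iff_abs_le[THEN iffD2]) auto
    also have "\<dots> \<le> (\<Sum>k\<le>n. 2 * 2 ^ k * (b k)\<^sup>2)"
      by (rule square_sum_le_geometric)
    finally have "ennreal ((w (p n) - w q)\<^sup>2) \<le> ennreal (\<Sum>k\<le>n. 2 * 2 ^ k * (b k)\<^sup>2)"
      by (rule ennreal_leI)
    also have "\<dots> = (\<Sum>k\<le>n. ?c k)"
      unfolding b2[symmetric] by (intro sum_ennreal[symmetric]) simp
    also have "\<dots> \<le> (\<Sum>k. ?c k)"
      by (intro sum_le_suminf) auto
    finally show ?thesis .
  qed
  have "s \<longlonglongrightarrow> 0"
  proof -
    have "(\<lambda>k. R * (1 / 2) ^ k) \<longlonglongrightarrow> R * 0"
      by (intro tendsto_mult tendsto_const LIMSEQ_power_zero) simp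
    then show ?thesis
      by (simp add: s_def[abs_def] power_divide)
  qed
  moreover have "(\<lambda>k. dist (p k) x) = s"
    using p(2) by (auto simp: dist_commute)
  ultimately have "p \<longlonglongrightarrow> x"
    unfolding tendsto_dist_iff[of p] by simp
  moreover have "isCont w x"
    using deriv U(2) x(1) has_derivative_continuous by blast
  ultimately have "(\<lambda>n. w (p n)) \<longlonglongrightarrow> w x"
    by (rule isCont_tendsto_compose[rotated])
  then have "(\<lambda>n. ennreal ((w (p n) - w q)\<^sup>2)) \<longlonglongrightarrow> ennreal ((w x - w q)\<^sup>2)"
    by (intro tendsto_intros)
  then have "ennreal ((w x - w q)\<^sup>2) \<le> (\<Sum>k. ?c k)"
    by (rule LIMSEQ_le_const2) (use fin in auto)
  then show ?thesis
    by (simp add: s_def)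
qed

text \<open>
  By Fubini the energy of the ball of radius \<open>s\<close> around \<open>x\<close>, integrated over \<open>x\<close>, is of order
  \<open>s ^ DIM('a)\<close>. The \<open>k\<close>-th term of the pointwise bound therefore contributes of order
  \<open>2 ^ k * (R / 2 ^ k)\<^sup>2\<close>, and the sum over \<open>k\<close> is of order \<open>R\<^sup>2\<close>.
\<close>

lemma uniform_domain_Poincare:
  fixes U :: "'a::euclidean_space set" and w :: "'a \<Rightarrow> real"
  assumes U: "uniform_const U C" "U \<subseteq> D" "\<not> bounded U"
    and w: "energy_bounded_gradient D w w' \<mu> A"
  obtains K where "0 \<le> K" "\<And>R. 0 < R \<Longrightarrow>
    \<exists>c. (\<integral>\<^sup>+x. indicator (U \<inter> ball 0 (2 * R)) x * ennreal ((w x - c)\<^sup>2) \<partial>lborel) \<le> ennreal (K * R\<^sup>2)"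
proof -
  interpret finite_measure \<mu>
    using w by (simp add: energy_bounded_gradient_def)
  have \<mu>: "finite_measure \<mu>" "sets \<mu> = sets borel"
    using w by (auto simp: energy_bounded_gradient_def)
  have C: "1 \<le> C"
    using U(1) by (simp add: uniform_const_def)
  define B where "B = A * (6 * C) * sqrt ((8 * (C * (C + 1))) ^ DIM('a))"
  define V where "V = unit_ball_vol (real DIM('a)) * (6 * C + 2) ^ DIM('a)"
  define K where "K = 4 * B\<^sup>2 * V * measure \<mu> UNIV"
  have "0 \<le> V"
    using C by (simp add: V_def)
  have "\<exists>c. (\<integral>\<^sup>+x. indicator (U \<inter> ball 0 (2 * R)) x * ennreal ((w x - c)\<^sup>2) \<partial>lborel) \<le> ennreal (K * R\<^sup>2)"
    if "0 < R" for R
  proof (cases "U \<inter> ball 0 (2 * R) = {}")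
    case True
    then show ?thesis by simp
  next
    case False
    then obtain x0 where x0: "x0 \<in> U" "norm x0 < 2 * R"
      by auto
    obtain q where q: "q \<in> U" "dist x0 q = R" "R / C \<le> infdist q (- U)"
      using uniform_deep_point[OF U(1,3) x0(1) \<open>0 < R\<close>] by blast
    have "norm q \<le> norm x0 + dist x0 q"
      using norm_triangle_ineq[of x0 "q - x0"] by (simp add: dist_norm norm_minus_commute)
    then have qn: "norm q \<le> 3 * R"
      using q(2) x0(2) by simp
    let ?a = "\<lambda>k::nat. 2 * 2 ^ k * (B\<^sup>2 * (R / 2 ^ k)\<^sup>2 / (R / 2 ^ k) ^ DIM('a))"
    let ?m = "\<lambda>k x. emeasure \<mu> (ball x ((6 * C + 2) * (R / 2 ^ k)))"
    have r: "0 \<le> (6 * C + 2) * (R / 2 ^ k)" for k :: nat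
      using C \<open>0 < R\<close> by simp
    note m = measurable_emeasure_ball[OF \<mu> r]
    have "(\<integral>\<^sup>+x. indicator (U \<inter> ball 0 (2 * R)) x * ennreal ((w x - w q)\<^sup>2) \<partial>lborel)
        \<le> (\<integral>\<^sup>+x. (\<Sum>k. ennreal (?a k) * ?m k x) \<partial>lborel)"
    proof (rule nn_integral_mono)
      fix x
      show "indicator (U \<inter> ball 0 (2 * R)) x * ennreal ((w x - w q)\<^sup>2) \<le> (\<Sum>k. ennreal (?a k) * ?m k x)"
      proof (cases "x \<in> U \<inter> ball 0 (2 * R)")
        case True
        then have "x \<in> U" "norm x < 2 * R" by auto
        from oscillation_le_dyadic_energies[OF U w \<open>0 < R\<close> this q(1) qn q(3)] True
        show ?thesis by (simp add: B_def)
      qed simp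
    qed
    also have "\<dots> = (\<Sum>k. ennreal (?a k) * (\<integral>\<^sup>+x. ?m k x \<partial>lborel))"
      using m by (subst nn_integral_suminf) (auto simp: nn_integral_cmult)
    also have "\<dots> = (\<Sum>k. ennreal (K * R\<^sup>2 / 2 * (1 / 2) ^ k))"
    proof (rule suminf_cong)
      fix k
      define s where "s = R / 2 ^ k"
      have s: "0 < s" "2 ^ k * s\<^sup>2 = R\<^sup>2 * (1 / 2) ^ k"
        using \<open>0 < R\<close> by (auto simp: s_def field_simps power2_eq_square)
      have "ennreal (?a k) * (\<integral>\<^sup>+x. ?m k x \<partial>lborel) =
          ennreal (?a k) * (ennreal (unit_ball_vol (real DIM('a)) * ((6 * C + 2) * s) ^ DIM('a)) * ennreal (measure \<mu> UNIV))"
        unfolding nn_integral_emeasure_ball[OF \<mu> r] by (simp only: s_def emeasure_eq_measure)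
      also have "\<dots> = ennreal (?a k * (unit_ball_vol (real DIM('a)) * ((6 * C + 2) * s) ^ DIM('a) * measure \<mu> UNIV))"
      proof -
        have nonneg: "0 \<le> ?a k" "0 \<le> unit_ball_vol (real DIM('a)) * ((6 * C + 2) * s) ^ DIM('a)"
          using C s(1) \<open>0 < R\<close> by auto
        show ?thesis
          using nonneg by (simp only: ennreal_mult mult_nonneg_nonneg measure_nonneg)
      qed
      also have "?a k * (unit_ball_vol (real DIM('a)) * ((6 * C + 2) * s) ^ DIM('a) * measure \<mu> UNIV) =
          2 * (B\<^sup>2 * V * measure \<mu> UNIV) * (2 ^ k * s\<^sup>2)"
        using s(1) by (simp add: s_def[symmetric] V_def power_mult_distrib)
      also have "\<dots> = K * R\<^sup>2 / 2 * (1 / 2) ^ k"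
        unfolding s(2) by (simp add: K_def)
      finally show "ennreal (?a k) * (\<integral>\<^sup>+x. ?m k x \<partial>lborel) = ennreal (K * R\<^sup>2 / 2 * (1 / 2) ^ k)" .
    qed
    also have "\<dots> = ennreal (K * R\<^sup>2)"
    proof -
      have "(\<lambda>k. K * R\<^sup>2 / 2 * (1 / 2) ^ k) sums (K * R\<^sup>2 / 2 * (1 / (1 - 1 / 2)))"
        by (intro sums_mult geometric_sums) simp
      then have "(\<lambda>k. K * R\<^sup>2 / 2 * (1 / 2) ^ k) sums (K * R\<^sup>2)"
        by simp
      moreover have "0 \<le> K"
        using \<open>0 \<le> V\<close> by (simp add: K_def)
      ultimately show ?thesis
        by (subst suminf_ennreal_eq) auto
    qed
    finally show ?thesis by blast
  qed
  moreover have "0 \<le> K"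
    using \<open>0 \<le> V\<close> by (simp add: K_def)
  ultimately show ?thesis
    using that by blast
qed

section \<open>The Liouville property\<close>

lemma has_real_derivative_pos_part_square:
  "((\<lambda>t::real. (max 0 t)\<^sup>2) has_real_derivative 2 * max 0 t) (at t)"
proof -
  consider "t > 0" | "t < 0" | "t = 0"
    by linarith
  then show ?thesis
  proof cases
    case 1
    have "((\<lambda>t. t\<^sup>2) has_real_derivative 2 * max 0 t) (at t)"
      using 1 by (auto intro!: derivative_eq_intros)
    then show ?thesis
      by (rule has_field_derivative_transform_within_open[of _ _ _ "{0<..}"]) (use 1 in auto)
  next
    case 2
    have "((\<lambda>t. 0) has_real_derivative 2 * max 0 t) (at t)"
      using 2 by simp
    then show ?thesis
      by (rule has_field_derivative_transform_within_open[of _ _ _ "{..<0}"]) (use 2 in auto)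
  next
    case 3
    have "((\<lambda>h. (max 0 h)\<^sup>2 / h) \<longlongrightarrow> 0) (at (0::real))"
    proof (rule Lim_null_comparison)
      show "\<forall>\<^sub>F h in at 0. norm ((max 0 h)\<^sup>2 / h) \<le> \<bar>h\<bar>"
        by (intro always_eventually allI) (auto simp: max_def power2_eq_square)
      show "((\<lambda>h::real. \<bar>h\<bar>) \<longlongrightarrow> 0) (at 0)"
        by (auto intro!: tendsto_eq_intros)
    qed
    then show ?thesis
      using 3 by (simp add: DERIV_def)
  qed
qed

text \<open>
  A spline that is continuously differentiable suffices, since the cutoff only enters a member of
  \<open>W12\<close> and not a test function.
\<close>

lemma exists_cutoff:
  fixes R :: real
  assumes "0 < R"
  obtains \<phi> \<phi>' where
    "\<And>x::'a::euclidean_space. (\<phi> has_derivative \<phi>' x) (at x)"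
    "\<And>i. continuous_on UNIV (\<lambda>x. \<phi>' x i)"
    "\<And>x. 0 \<le> \<phi> x" "\<And>x. \<phi> x \<le> 1"
    "\<And>x. norm x \<le> R \<Longrightarrow> \<phi> x = 1"
    "\<And>x. 2 * R \<le> norm x \<Longrightarrow> \<phi> x = 0"
    "\<And>x h. \<bar>\<phi>' x h\<bar> \<le> 12 / R * norm h"
    "\<And>x h. \<not> (R < norm x \<and> norm x < 2 * R) \<Longrightarrow> \<phi>' x h = 0"
proof -
  define P where "P t = (max 0 t)\<^sup>2" for t :: real
  \<comment> \<open>Equal to 1 for \<open>s \<le> 1\<close> and to 0 for \<open>s \<ge> 2\<close>; it will be evaluated at \<open>|x|^2 / R^2\<close>.\<close>
  define \<theta> where "\<theta> s = P (1 - P (s - 1))" for s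
  define \<theta>' where "\<theta>' s = 2 * max 0 (1 - P (s - 1)) * (- (2 * max 0 (s - 1)))" for s
  have P: "(P has_real_derivative 2 * max 0 t) (at t)" for t
    unfolding P_def by (rule has_real_derivative_pos_part_square)
  have \<theta>: "(\<theta> has_real_derivative \<theta>' s) (at s)" for s
  proof -
    have "((\<lambda>s. s - 1) has_real_derivative 1) (at s)"
      by (auto intro!: derivative_eq_intros)
    from DERIV_chain2[where f=P and g="\<lambda>s. s - 1", OF P this]
    have "((\<lambda>s. 1 - P (s - 1)) has_real_derivative - (2 * max 0 (s - 1))) (at s)"
      by (auto intro!: derivative_eq_intros)
    from DERIV_chain2[where f=P and g="\<lambda>s. 1 - P (s - 1)", OF P this] show ?thesis
      by (simp add: \<theta>_def[abs_def] \<theta>'_def)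
  qed
  have P01: "0 \<le> P t" for t
    by (simp add: P_def)
  have P1: "P t \<le> 1" if "t \<le> 1" for t
    using that unfolding P_def by (auto simp: max_def power_le_one)
  have Pge: "1 \<le> P t" if "1 \<le> t" for t
    using that unfolding P_def by (auto simp: max_def one_le_power)
  have low: "\<theta> s = 1" "\<theta>' s = 0" if "s \<le> 1" for s
    using that by (auto simp: \<theta>_def \<theta>'_def P_def)
  have high: "\<theta> s = 0" "\<theta>' s = 0" if "2 \<le> s" for s
    using Pge[of "s - 1"] that by (auto simp: \<theta>_def \<theta>'_def P_def[of "1 - _"])
  have \<theta>01: "0 \<le> \<theta> s" "\<theta> s \<le> 1" for s
    using P01[of "s - 1"] P01 P1 by (auto simp: \<theta>_def)
  have \<theta>'4: "\<bar>\<theta>' s\<bar> \<le> 4" for s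
  proof (cases "2 \<le> s")
    case False
    then have "max 0 (s - 1) \<le> 1" "max 0 (1 - P (s - 1)) \<le> 1"
      using P01[of "s - 1"] by auto
    then have "max 0 (1 - P (s - 1)) * max 0 (s - 1) \<le> 1"
      by (intro mult_le_one) auto
    then show ?thesis
      by (simp add: \<theta>'_def abs_mult)
  qed (simp add: high)
  define n where "n x = (norm x)\<^sup>2 / R\<^sup>2" for x :: 'a
  have n: "(n has_derivative (\<lambda>h. 2 * (x \<bullet> h) / R\<^sup>2)) (at x)" for x
  proof -
    have "((\<lambda>x. x \<bullet> x) has_derivative (\<lambda>h. 2 * (x \<bullet> h))) (at x)"
      by (auto intro!: derivative_eq_intros simp: inner_commute)
    from has_derivative_mult_left[OF this, of "inverse (R\<^sup>2)"] show ?thesis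
      by (simp add: n_def[abs_def] power2_norm_eq_inner divide_inverse)
  qed
  have n1: "n x \<le> 1" if "norm x \<le> R" for x
    using that assms power_mono[of "norm x" R 2] by (simp add: n_def)
  have n2: "2 \<le> n x" if "3 / 2 * R \<le> norm x" for x
  proof -
    have "(3 / 2 * R)\<^sup>2 \<le> (norm x)\<^sup>2"
      using that assms by (intro power_mono) auto
    then have "2 * R\<^sup>2 \<le> (norm x)\<^sup>2"
    proof -
      have "(3 / 2 * R)\<^sup>2 = 9 / 4 * R\<^sup>2"
        by (simp add: power2_eq_square)
      then show ?thesis
        using \<open>(3 / 2 * R)\<^sup>2 \<le> (norm x)\<^sup>2\<close> zero_le_power2[of R] by linarith
    qed
    then show ?thesis
      using assms by (simp add: n_def field_simps)
  qed
  show ?thesis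
  proof (rule that[of "\<lambda>x. \<theta> (n x)" "\<lambda>x h. \<theta>' (n x) * (2 * (x \<bullet> h) / R\<^sup>2)"])
    fix x :: 'a
    have "(\<theta> has_derivative (*) (\<theta>' (n x))) (at (n x))"
      using \<theta> by (simp add: has_field_derivative_def)
    from has_derivative_compose[OF n this]
    show "((\<lambda>x. \<theta> (n x)) has_derivative (\<lambda>h. \<theta>' (n x) * (2 * (x \<bullet> h) / R\<^sup>2))) (at x)" .
    show "\<theta> (n x) = 1" if "norm x \<le> R"
      using n1[OF that] by (rule low)
    show "\<theta> (n x) = 0" if "2 * R \<le> norm x"
      using that assms by (intro high n2) auto
    show "\<theta>' (n x) * (2 * (x \<bullet> h) / R\<^sup>2) = 0" if "\<not> (R < norm x \<and> norm x < 2 * R)" for h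
      using that low(2)[OF n1] high(2)[OF n2] assms by force
    show "\<bar>\<theta>' (n x) * (2 * (x \<bullet> h) / R\<^sup>2)\<bar> \<le> 12 / R * norm h" for h
    proof (cases "norm x \<le> 3 / 2 * R")
      case True
      have "\<bar>x \<bullet> h\<bar> \<le> 3 / 2 * R * norm h"
        using Cauchy_Schwarz_ineq2[of x h] mult_right_mono[OF True norm_ge_zero[of h]] by linarith
      then have "\<bar>2 * (x \<bullet> h) / R\<^sup>2\<bar> \<le> 3 * R * norm h / R\<^sup>2"
        unfolding abs_divide using assms by (intro frac_le) auto
      then have "\<bar>\<theta>' (n x)\<bar> * \<bar>2 * (x \<bullet> h) / R\<^sup>2\<bar> \<le> 4 * (3 * R * norm h / R\<^sup>2)"
        by (intro mult_mono \<theta>'4) auto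
      also have "\<dots> = 12 / R * norm h"
        using assms by (simp add: power2_eq_square)
      finally show ?thesis
        by (simp only: abs_mult)
    next
      case False
      then have "\<theta>' (n x) = 0"
        by (intro high n2) simp
      then show ?thesis
        using assms by simp
    qed
    have "continuous_on UNIV P"
      using P by (meson DERIV_isCont continuous_at_imp_continuous_on)
    then have cP: "continuous_on S f \<Longrightarrow> continuous_on S (\<lambda>x. P (f x))" for S :: "'a set" and f
      by (rule continuous_on_compose2) auto
    show "continuous_on UNIV (\<lambda>x. \<theta>' (n x) * (2 * (x \<bullet> i) / R\<^sup>2))" for i
      unfolding \<theta>'_def n_def using assms by (intro continuous_intros cP) auto
  qed (rule \<theta>01)+
qed

lemma abs_arctan_diff_le: "\<bar>arctan x - arctan y\<bar> \<le> \<bar>x - y\<bar>"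
proof -
  have "norm (arctan x - arctan y) \<le> 1 * norm (x - y)"
  proof (rule field_differentiable_bound[of UNIV])
    fix z :: real
    show "(arctan has_field_derivative inverse (1 + z\<^sup>2)) (at z within UNIV)"
      by (rule DERIV_arctan)
    show "norm (inverse (1 + z\<^sup>2)) \<le> 1"
      by (simp add: inverse_le_1_iff add_pos_nonneg abs_of_pos)
  qed auto
  then show ?thesis by simp
qed

lemma norm_gradient_vector:
  fixes f :: "'a::euclidean_space \<Rightarrow> real"
  assumes "linear f"
  defines "g \<equiv> \<Sum>i\<in>Basis. f i *\<^sub>R i"
  shows "f h = g \<bullet> h" "(norm g)\<^sup>2 = (\<Sum>i\<in>Basis. (f i)\<^sup>2)"
proof -
  have gi: "g \<bullet> i = f i" if "i \<in> Basis" for i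
    using that by (simp add: g_def)
  have "f h = f (\<Sum>i\<in>Basis. (h \<bullet> i) *\<^sub>R i)"
    by (simp add: euclidean_representation)
  also have "\<dots> = (\<Sum>i\<in>Basis. (h \<bullet> i) * f i)"
    by (simp add: linear_sum[OF assms(1)] linear_cmul[OF assms(1)])
  also have "\<dots> = g \<bullet> h"
    by (subst euclidean_inner) (simp add: gi mult.commute)
  finally show "f h = g \<bullet> h" .
  show "(norm g)\<^sup>2 = (\<Sum>i\<in>Basis. (f i)\<^sup>2)"
    unfolding power2_norm_eq_inner by (subst euclidean_inner) (simp add: gi power2_eq_square)
qed

text \<open>
  The factor 12 is the one in the gradient bound of the cutoff.
\<close>

lemma weighted_mean_inequality:
  fixes a b t :: real
  assumes "0 < t"
  shows "12 * a * b \<le> t * a\<^sup>2 + 36 / t * b\<^sup>2"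
proof -
  have "0 \<le> (t * a - 6 * b)\<^sup>2 / t"
    using assms by simp
  also have "\<dots> = t * a\<^sup>2 + 36 / t * b\<^sup>2 - 12 * a * b"
    using assms by (simp add: field_simps power2_eq_square)
  finally show ?thesis by simp
qed

text \<open>
  Tests with \<open>v = (arctan w - arctan c) \<phi>\<close>. The arctangent makes \<open>v\<close> bounded and keeps the strictly
  positive weight \<open>1 / (1 + w\<^sup>2)\<close> on the energy; as it does not increase distances, the error term is
  bounded by means of \<open>|w - c|\<close>. The free parameter \<open>t\<close> balances the two parts of that error.
\<close>

lemma cutoff_energy_le:
  fixes w :: "'a::euclidean_space \<Rightarrow> real"
  assumes D: "open D"
    and deriv: "\<And>x. x \<in> D \<Longrightarrow> (w has_derivative w' x) (at x)"
    and cont: "\<And>i. i \<in> Basis \<Longrightarrow> continuous_on D (\<lambda>x. w' x i)"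
    and int: "\<And>i. i \<in> Basis \<Longrightarrow> integrable (lebesgue_on D) (\<lambda>x. (w' x i)\<^sup>2)"
    and orth: "\<And>v v'. C1_W12 D v v' \<Longrightarrow> (\<integral>x. (\<Sum>i\<in>Basis. w' x i * v' x i) \<partial>lebesgue_on D) = 0"
    and R: "0 < R" and t: "0 < t"
  defines "E \<equiv> \<lambda>x. \<Sum>i\<in>Basis. (w' x i)\<^sup>2"
  assumes J: "integrable (lebesgue_on D) (\<lambda>x. indicator {x. R < norm x \<and> norm x < 2 * R} x * (w x - c)\<^sup>2)"
  shows "(\<integral>x. indicator (cball 0 R) x * (E x / (1 + (w x)\<^sup>2)) \<partial>lebesgue_on D) \<le>
    t / R\<^sup>2 * (\<integral>x. indicator {x. R < norm x \<and> norm x < 2 * R} x * (w x - c)\<^sup>2 \<partial>lebesgue_on D) +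
    36 / t * (\<integral>x. indicator {x. R < norm x} x * E x \<partial>lebesgue_on D)"
proof -
  let ?M = "lebesgue_on D" and ?A = "{x::'a. R < norm x \<and> norm x < 2 * R}"
  obtain \<phi> \<phi>' where \<phi>:
    "\<And>x::'a. (\<phi> has_derivative \<phi>' x) (at x)"
    "\<And>i. continuous_on UNIV (\<lambda>x. \<phi>' x i)"
    "\<And>x. 0 \<le> \<phi> x" "\<And>x. \<phi> x \<le> 1"
    "\<And>x. norm x \<le> R \<Longrightarrow> \<phi> x = 1"
    "\<And>x. 2 * R \<le> norm x \<Longrightarrow> \<phi> x = 0"
    "\<And>x h. \<bar>\<phi>' x h\<bar> \<le> 12 / R * norm h"
    "\<And>x h. \<not> (R < norm x \<and> norm x < 2 * R) \<Longrightarrow> \<phi>' x h = 0"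
    using exists_cutoff[OF R, where 'a='a] by blast
  have c\<phi>: "continuous_on S \<phi>" for S
    using \<phi>(1) by (rule continuous_on_if_has_derivative)
  have cw: "continuous_on D w"
    using deriv by (rule continuous_on_if_has_derivative)
  have cE: "continuous_on D E"
    unfolding E_def by (intro continuous_intros cont)
  have E0: "0 \<le> E x" for x
    by (simp add: E_def sum_nonneg)
  note meas = measurable_lebesgue_on_if_continuous_on[OF D]
  have ind: "(indicator S :: 'a \<Rightarrow> real) \<in> borel_measurable ?M" if "S \<in> sets borel" for S :: "'a set"
    using that by (rule measurable_lebesgue_on_if_borel[OF borel_measurable_indicator])
  have Eint: "integrable ?M E"
    unfolding E_def by (intro Bochner_Integration.integrable_sum int)
  have pos: "0 < 1 + (w x)\<^sup>2" for x
    by (simp add: add_pos_nonneg)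
  have fin: "integrable ?M (\<lambda>x. B * indicator (ball 0 (2 * R)) x :: real)" for B
  proof -
    have "integrable lebesgue (indicator (D \<inter> ball 0 (2 * R)) :: 'a \<Rightarrow> real)"
      using D emeasure_bounded_finite[of "D \<inter> ball 0 (2 * R)"]
      by (intro integrable_real_indicator) (auto simp: bounded_Int)
    also have "indicator (D \<inter> ball 0 (2 * R)) = (\<lambda>x. indicator D x *\<^sub>R (indicator (ball 0 (2 * R)) x :: real))"
      by (auto simp: indicator_def fun_eq_iff)
    finally show ?thesis
      using D by (intro integrable_mult_right) (simp add: integrable_restrict_space)
  qed
  define a where "a x = arctan (w x) - arctan c" for x
  have abound: "\<bar>a x\<bar> \<le> 4" for x
    using arctan_bounded[of "w x"] arctan_bounded[of c] pi_less_4 unfolding a_def by linarith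
  have ca: "continuous_on D a"
    unfolding a_def[abs_def] by (intro continuous_intros cw)
  define v where "v x = a x * \<phi> x" for x
  define v' where "v' x h = a x * \<phi>' x h + w' x h / (1 + (w x)\<^sup>2) * \<phi> x" for x h
  have "(\<integral>x. (\<Sum>i\<in>Basis. w' x i * v' x i) \<partial>?M) = 0"
  proof (rule orth[of v], unfold C1_W12_def, intro conjI ballI)
    fix x assume "x \<in> D"
    have "(a has_derivative (\<lambda>h. w' x h / (1 + (w x)\<^sup>2))) (at x)"
      unfolding a_def[abs_def] using deriv[OF \<open>x \<in> D\<close>]
      by (auto intro!: derivative_eq_intros simp: divide_inverse)
    from has_derivative_mult[OF this \<phi>(1)]
    show "(v has_derivative v' x) (at x)"
      by (simp add: v_def[abs_def] v'_def[abs_def])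
  next
    fix i :: 'a assume i: "i \<in> Basis"
    show cv': "continuous_on D (\<lambda>x. v' x i)"
      unfolding v'_def using pos
      by (intro continuous_intros ca cw cont[OF i] c\<phi> continuous_on_subset[OF \<phi>(2)]) (auto simp: less_imp_neq[symmetric])
    have bound: "(v' x i)\<^sup>2 \<le> 2 * (w' x i)\<^sup>2 + 2 * (48 / R)\<^sup>2 * indicator (ball 0 (2 * R)) x" for x
    proof -
      have "\<bar>a x * \<phi>' x i\<bar> \<le> 48 / R * indicator (ball 0 (2 * R)) x"
      proof (cases "x \<in> ball 0 (2 * R)")
        case True
        have "\<bar>a x\<bar> * \<bar>\<phi>' x i\<bar> \<le> 4 * (12 / R * norm i)"
          by (intro mult_mono abound \<phi>) auto
        with True i show ?thesis by (simp add: abs_mult)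
      qed (use \<phi>(8) in auto)
      then have 1: "(a x * \<phi>' x i)\<^sup>2 \<le> (48 / R)\<^sup>2 * indicator (ball 0 (2 * R)) x"
      proof (cases "x \<in> ball 0 (2 * R)")
        case True
        with \<open>\<bar>a x * \<phi>' x i\<bar> \<le> _\<close> have "\<bar>a x * \<phi>' x i\<bar> \<le> 48 / R"
          by simp
        then have "\<bar>a x * \<phi>' x i\<bar>\<^sup>2 \<le> (48 / R)\<^sup>2"
          by (intro power_mono) auto
        with True show ?thesis by simp
      qed (use \<phi>(8) in auto)
      have "\<bar>w' x i / (1 + (w x)\<^sup>2) * \<phi> x\<bar> \<le> \<bar>w' x i\<bar> / 1 * 1"
        unfolding abs_mult abs_divide using \<phi>(3,4)[of x] pos[of x]
        by (intro mult_mono frac_le) auto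
      then have "\<bar>w' x i / (1 + (w x)\<^sup>2) * \<phi> x\<bar> \<le> \<bar>w' x i\<bar>"
        by (simp only: div_by_1 mult_1_right)
      then have 2: "(w' x i / (1 + (w x)\<^sup>2) * \<phi> x)\<^sup>2 \<le> (w' x i)\<^sup>2"
        by (rule abs_le_square_iff[THEN iffD1])
      have "(p + q)\<^sup>2 \<le> 2 * p\<^sup>2 + 2 * q\<^sup>2" for p q :: real
        using sum_squares_bound[of p q] by (simp add: power2_sum)
      from this[of "a x * \<phi>' x i" "w' x i / (1 + (w x)\<^sup>2) * \<phi> x"] 1 2 show ?thesis
        unfolding v'_def by linarith
    qed
    show "integrable ?M (\<lambda>x. (v' x i)\<^sup>2)"
    proof (rule Bochner_Integration.integrable_bound)
      show "integrable ?M (\<lambda>x. 2 * (w' x i)\<^sup>2 + 2 * (48 / R)\<^sup>2 * indicator (ball 0 (2 * R)) x)"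
        by (intro Bochner_Integration.integrable_add integrable_mult_right int[OF i] fin)
      show "(\<lambda>x. (v' x i)\<^sup>2) \<in> borel_measurable ?M"
        by (intro meas continuous_intros cv')
      show "AE x in ?M. norm ((v' x i)\<^sup>2) \<le> norm (2 * (w' x i)\<^sup>2 + 2 * (48 / R)\<^sup>2 * indicator (ball 0 (2 * R)) x)"
        by (rule AE_I2) (use bound in \<open>auto intro: order_trans[OF _ abs_ge_self]\<close>)
    qed
  next
    show "integrable ?M (\<lambda>x. (v x)\<^sup>2)"
    proof (rule Bochner_Integration.integrable_bound[OF fin[of 16]])
      have "continuous_on D v"
        unfolding v_def[abs_def] by (intro continuous_intros ca c\<phi>)
      then show "(\<lambda>x. (v x)\<^sup>2) \<in> borel_measurable ?M"
        by (intro meas continuous_intros)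
      have "(v x)\<^sup>2 \<le> 16 * indicator (ball 0 (2 * R)) x" for x
      proof (cases "x \<in> ball 0 (2 * R)")
        case True
        have "\<bar>v x\<bar> \<le> 4 * 1"
          unfolding v_def abs_mult using \<phi>(3,4)[of x] by (intro mult_mono abound) auto
        then have "\<bar>v x\<bar>\<^sup>2 \<le> 4\<^sup>2"
          by (intro power_mono) auto
        with True show ?thesis by simp
      qed (simp add: v_def \<phi>(6))
      then show "AE x in ?M. norm ((v x)\<^sup>2) \<le> norm (16 * indicator (ball 0 (2 * R)) x :: real)"
        by (intro AE_I2) (auto intro: order_trans[OF _ abs_ge_self])
    qed
  qed
  define F where "F x = \<phi> x * (E x / (1 + (w x)\<^sup>2))" for x
  define T where "T x = a x * (\<Sum>i\<in>Basis. w' x i * \<phi>' x i)" for x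
  have split: "(\<Sum>i\<in>Basis. w' x i * v' x i) = F x + T x" for x
  proof -
    have "w' x i * v' x i = \<phi> x / (1 + (w x)\<^sup>2) * (w' x i)\<^sup>2 + a x * (w' x i * \<phi>' x i)" for i
      by (simp add: v'_def power2_eq_square algebra_simps)
    then show ?thesis
      by (simp add: F_def T_def E_def sum.distrib sum_distrib_left sum_divide_distrib)
  qed
  let ?G = "\<lambda>x. t / R\<^sup>2 * (indicator ?A x * (w x - c)\<^sup>2) + 36 / t * (indicator {x. R < norm x} x * E x)"
  have T_le: "\<bar>T x\<bar> \<le> ?G x" if "x \<in> D" for x
  proof (cases "x \<in> ?A")
    case True
    define g where "g = (\<Sum>i\<in>Basis. w' x i *\<^sub>R i)"
    have "linear (w' x)" "linear (\<phi>' x)"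
      using deriv[OF that] \<phi>(1) has_derivative_linear by blast+
    note g = norm_gradient_vector[OF this(1), folded g_def]
    have "(\<Sum>i\<in>Basis. w' x i * \<phi>' x i) = \<phi>' x g"
      unfolding g_def using \<open>linear (\<phi>' x)\<close> by (simp add: linear_sum linear_cmul)
    then have "\<bar>\<Sum>i\<in>Basis. w' x i * \<phi>' x i\<bar> \<le> 12 / R * norm g"
      using \<phi>(7) by simp
    then have "\<bar>T x\<bar> \<le> \<bar>w x - c\<bar> * (12 / R * norm g)"
      unfolding T_def abs_mult a_def by (intro mult_mono abs_arctan_diff_le) auto
    also have "\<dots> = 12 * (\<bar>w x - c\<bar> / R) * norm g"
      by simp
    also have "\<dots> \<le> t * (\<bar>w x - c\<bar> / R)\<^sup>2 + 36 / t * (norm g)\<^sup>2"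
      by (rule weighted_mean_inequality[OF t])
    also have "\<dots> = ?G x"
      using True g(2) by (simp add: power_divide E_def)
    finally show ?thesis .
  next
    case False
    then have "T x = 0"
      using \<phi>(8) by (simp add: T_def)
    moreover have "0 \<le> ?G x"
      using t E0 by simp
    ultimately show ?thesis by simp
  qed
  have indE: "integrable ?M (\<lambda>x. indicator S x * E x)" if "S \<in> sets borel" for S
  proof (rule Bochner_Integration.integrable_bound[OF Eint])
    show "(\<lambda>x. indicator S x * E x) \<in> borel_measurable ?M"
      by (intro borel_measurable_times ind that meas cE)
  qed (auto simp: indicator_def)
  have open_out: "{x::'a. R < norm x} \<in> sets borel"
    by measurable
  have Gint: "integrable ?M ?G"
    by (intro Bochner_Integration.integrable_add integrable_mult_right J indE open_out)
  have Fb: "0 \<le> F x" "F x \<le> E x" for x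
  proof -
    show "0 \<le> F x"
      using \<phi>(3) E0 pos[of x] by (simp add: F_def)
    have "E x / (1 + (w x)\<^sup>2) \<le> E x / 1"
      using E0[of x] by (intro divide_left_mono) (auto simp: pos)
    then have "\<phi> x * (E x / (1 + (w x)\<^sup>2)) \<le> 1 * (E x / 1)"
      using \<phi>(3,4)[of x] E0[of x] pos[of x] by (intro mult_mono) auto
    then show "F x \<le> E x" by (simp add: F_def)
  qed
  have cF: "continuous_on D (\<lambda>x. E x / (1 + (w x)\<^sup>2))"
    by (intro continuous_intros cE cw) (use pos in \<open>auto simp: less_imp_neq[symmetric]\<close>)
  have Fint: "integrable ?M F"
  proof (rule Bochner_Integration.integrable_bound[OF Eint])
    show "F \<in> borel_measurable ?M"
      unfolding F_def[abs_def] by (intro meas continuous_on_mult c\<phi> cF)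
  qed (use Fb E0 in auto)
  have Tint: "integrable ?M T"
  proof (rule Bochner_Integration.integrable_bound[OF Gint])
    show "T \<in> borel_measurable ?M"
      unfolding T_def[abs_def] by (intro meas continuous_intros ca cont continuous_on_subset[OF \<phi>(2)]) auto
    show "AE x in ?M. norm (T x) \<le> norm (?G x)"
    proof (rule AE_I2)
      fix x assume "x \<in> space ?M"
      then have "\<bar>T x\<bar> \<le> ?G x"
        by (intro T_le) simp
      then show "norm (T x) \<le> norm (?G x)"
        unfolding real_norm_def by (rule order_trans[OF _ abs_ge_self])
    qed
  qed
  have "(\<integral>x. indicator (cball 0 R) x * (E x / (1 + (w x)\<^sup>2)) \<partial>?M) \<le> (\<integral>x. F x \<partial>?M)"
  proof (rule integral_mono[OF _ Fint])
    have le: "indicator (cball 0 R) x * (E x / (1 + (w x)\<^sup>2)) \<le> F x"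
      "0 \<le> indicator (cball 0 R) x * (E x / (1 + (w x)\<^sup>2))" for x
      using Fb(1)[of x] \<phi>(5)[of x] E0[of x] pos[of x] by (auto simp: F_def indicator_def)
    then show "indicator (cball 0 R) x * (E x / (1 + (w x)\<^sup>2)) \<le> F x" for x by blast
    show "integrable ?M (\<lambda>x. indicator (cball 0 R) x * (E x / (1 + (w x)\<^sup>2)))"
    proof (rule Bochner_Integration.integrable_bound[OF Fint])
      show "(\<lambda>x. indicator (cball 0 R) x * (E x / (1 + (w x)\<^sup>2))) \<in> borel_measurable ?M"
        by (intro borel_measurable_times ind meas cF) simp
      show "AE x in ?M. norm (indicator (cball 0 R) x * (E x / (1 + (w x)\<^sup>2))) \<le> norm (F x)"
        unfolding real_norm_def using le Fb(1) by (intro AE_I2) (simp only: abs_of_nonneg)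
    qed
  qed
  also have "\<dots> = - (\<integral>x. T x \<partial>?M)"
    using \<open>(\<integral>x. (\<Sum>i\<in>Basis. w' x i * v' x i) \<partial>?M) = 0\<close> Fint Tint by (simp add: split)
  also have "\<dots> \<le> (\<integral>x. \<bar>T x\<bar> \<partial>?M)"
    using integral_abs_bound[of ?M T] by linarith
  also have "\<dots> \<le> (\<integral>x. ?G x \<partial>?M)"
    using T_le by (intro integral_mono integrable_abs Tint Gint) auto
  also have "\<dots> = t / R\<^sup>2 * (\<integral>x. indicator ?A x * (w x - c)\<^sup>2 \<partial>?M) +
      36 / t * (\<integral>x. indicator {x. R < norm x} x * E x \<partial>?M)"
    using J indE[OF open_out] by simp
  finally show ?thesis .
qed

text \<open>
  In the cutoff inequality with radius \<open>n\<close> the Poincare inequality bounds the first error term by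
  \<open>t * K\<close>, uniformly in \<open>n\<close>, while the second one, a tail of the energy, vanishes in the limit. As \<open>t\<close>
  is arbitrary, the weighted energy is 0, and the gradient vanishes by the gradient estimate.
\<close>

lemma H_star_imp_AE_const:
  fixes D :: "'a::euclidean_space set"
  assumes D: "open D" "connected D" "D \<noteq> {}" and u: "u \<in> H_star D"
    and U: "uniform_const U C" "U = D - cball 0 r" "\<not> bounded U"
  shows "\<exists>c. AE x in lebesgue_on D. u x = c"
proof -
  let ?M = "lebesgue_on D"
  obtain w w' where ae: "AE x in ?M. u x = w x"
    and deriv: "\<And>x. x \<in> D \<Longrightarrow> (w has_derivative w' x) (at x)"
    and cont: "\<And>i. i \<in> Basis \<Longrightarrow> continuous_on D (\<lambda>x. w' x i)"
    and int: "\<And>i. i \<in> Basis \<Longrightarrow> integrable ?M (\<lambda>x. (w' x i)\<^sup>2)"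
    and est: "\<And>i p \<rho>. \<lbrakk>i \<in> Basis; 0 < \<rho>; cball p (3 * \<rho>) \<subseteq> D\<rbrakk> \<Longrightarrow>
      (w' p i)\<^sup>2 \<le> 2 / bump_mass TYPE('a) / \<rho> ^ DIM('a) *
        (\<integral>y. indicator (ball p \<rho>) y * (w' y i)\<^sup>2 \<partial>?M)"
    and orth: "\<And>v v'. C1_W12 D v v' \<Longrightarrow> (\<integral>x. (\<Sum>i\<in>Basis. w' x i * v' x i) \<partial>?M) = 0"
    by (rule H_star_harmonic_representative[OF D(1) u]) blast
  define E where "E x = (\<Sum>i\<in>Basis. (w' x i)\<^sup>2)" for x
  define \<mu> where "\<mu> = distr (density ?M (\<lambda>x. ennreal (E x))) borel (\<lambda>x. x)"
  have E0: "0 \<le> E x" for x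
    by (simp add: E_def sum_nonneg)
  have cE: "continuous_on D E"
    unfolding E_def by (intro continuous_intros cont)
  have cw: "continuous_on D w"
    using deriv by (rule continuous_on_if_has_derivative)
  note meas = measurable_lebesgue_on_if_continuous_on[OF D(1)]
  have ind: "(indicator S :: 'a \<Rightarrow> real) \<in> borel_measurable ?M" if "S \<in> sets borel" for S :: "'a set"
    using that by (rule measurable_lebesgue_on_if_borel[OF borel_measurable_indicator])
  have Eint: "integrable ?M E"
    unfolding E_def by (intro Bochner_Integration.integrable_sum int)
  have indE: "integrable ?M (\<lambda>x. indicator S x * E x)" if "S \<in> sets borel" for S
    by (rule Bochner_Integration.integrable_bound[OF Eint borel_measurable_times[OF ind[OF that] meas[OF cE]]])
      (simp add: indicator_def)
  have emu: "emeasure \<mu> S = ennreal (\<integral>x. indicator S x * E x \<partial>?M)" if S: "S \<in> sets borel" for S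
  proof -
    have "(\<lambda>x. x) \<in> ?M \<rightarrow>\<^sub>M borel"
      by (intro measurable_restrict_space1 measurable_completion) simp
    then have "emeasure \<mu> S = emeasure (density ?M (\<lambda>x. ennreal (E x))) (S \<inter> D)" "S \<inter> D \<in> sets ?M"
      using S measurable_sets[of "\<lambda>x. x" ?M borel S] by (simp_all add: \<mu>_def emeasure_distr)
    then have "emeasure \<mu> S = (\<integral>\<^sup>+x. ennreal (E x) * indicator (S \<inter> D) x \<partial>?M)"
      using meas[OF cE] by (simp add: emeasure_density)
    also have "\<dots> = (\<integral>\<^sup>+x. ennreal (indicator S x * E x) \<partial>?M)"
      by (intro nn_integral_cong) (auto simp: indicator_def)
    also have "\<dots> = ennreal (\<integral>x. indicator S x * E x \<partial>?M)"
      using E0 by (intro nn_integral_eq_integral indE[OF S]) auto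
    finally show ?thesis .
  qed
  have \<mu>: "finite_measure \<mu>" "sets \<mu> = sets borel"
    by (rule finite_measureI) (use emu[of UNIV] in \<open>simp_all add: \<mu>_def\<close>)
  have mu: "measure \<mu> S = (\<integral>x. indicator S x * E x \<partial>?M)" if "S \<in> sets borel" for S
    unfolding measure_def emu[OF that] by (intro enn2real_ennreal Bochner_Integration.integral_nonneg) (simp add: E0)
  define c where "c = 2 / bump_mass TYPE('a)"
  have "0 \<le> c"
    using bump_mass_pos[where 'a='a] by (simp add: c_def)
  have estE: "E p \<le> c * (measure \<mu> (ball p \<rho>) / \<rho> ^ DIM('a))"
    if \<rho>: "0 < \<rho>" "cball p (3 * \<rho>) \<subseteq> D" for p \<rho>
  proof -
    have ii: "integrable ?M (\<lambda>y. indicator (ball p \<rho>) y * (w' y i)\<^sup>2)" if i: "i \<in> Basis" for i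
    proof (rule Bochner_Integration.integrable_bound[OF int[OF i]])
      show "(\<lambda>y. indicator (ball p \<rho>) y * (w' y i)\<^sup>2) \<in> borel_measurable ?M"
        by (intro borel_measurable_times ind meas continuous_intros cont[OF i]) auto
    qed (auto simp: indicator_def)
    have "E p \<le> (\<Sum>i\<in>Basis. c / \<rho> ^ DIM('a) * (\<integral>y. indicator (ball p \<rho>) y * (w' y i)\<^sup>2 \<partial>?M))"
      unfolding E_def c_def by (intro sum_mono est \<rho>)
    also have "\<dots> = c / \<rho> ^ DIM('a) * (\<integral>y. (\<Sum>i\<in>Basis. indicator (ball p \<rho>) y * (w' y i)\<^sup>2) \<partial>?M)"
      by (subst Bochner_Integration.integral_sum) (auto intro: ii simp: sum_distrib_left)
    also have "\<dots> = c * (measure \<mu> (ball p \<rho>) / \<rho> ^ DIM('a))"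
      by (simp add: mu E_def sum_distrib_left)
    finally show ?thesis .
  qed
  have est': "\<bar>w' p h\<bar> \<le> sqrt c * sqrt (measure \<mu> (ball p \<rho>) / \<rho> ^ DIM('a)) * norm h"
    if \<rho>: "0 < \<rho>" "cball p (3 * \<rho>) \<subseteq> D" for p \<rho> h
  proof -
    have "p \<in> D"
      using \<rho> by auto
    define g where "g = (\<Sum>i\<in>Basis. w' p i *\<^sub>R i)"
    note g = norm_gradient_vector[OF has_derivative_linear[OF deriv[OF \<open>p \<in> D\<close>]], folded g_def E_def]
    have "norm g \<le> sqrt (c * (measure \<mu> (ball p \<rho>) / \<rho> ^ DIM('a)))"
      using estE[OF \<rho>] g(2) by (intro real_le_rsqrt) simp
    then have "\<bar>w' p h\<bar> \<le> sqrt (c * (measure \<mu> (ball p \<rho>) / \<rho> ^ DIM('a))) * norm h"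
      unfolding g(1) using order_trans[OF Cauchy_Schwarz_ineq2 mult_right_mono[OF _ norm_ge_zero]] by blast
    then show ?thesis
      by (simp only: real_sqrt_mult)
  qed
  have wb: "energy_bounded_gradient D w w' \<mu> (sqrt c)"
    using \<mu> deriv est' \<open>0 \<le> c\<close> by (auto simp: energy_bounded_gradient_def)
  have "U \<subseteq> D"
    using U(2) by auto
  obtain K where K: "0 \<le> K" "\<And>R. 0 < R \<Longrightarrow>
      \<exists>c. (\<integral>\<^sup>+x. indicator (U \<inter> ball 0 (2 * R)) x * ennreal ((w x - c)\<^sup>2) \<partial>lborel) \<le> ennreal (K * R\<^sup>2)"
    using uniform_domain_Poincare[OF U(1) \<open>U \<subseteq> D\<close> U(3) wb] by blast
  define I where "I n = (\<integral>x. indicator (cball 0 (real n)) x * (E x / (1 + (w x)\<^sup>2)) \<partial>?M)" for n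
  define T where "T n = (\<integral>x. indicator {x. real n < norm x} x * E x \<partial>?M)" for n
  have main: "I n \<le> t * K + 36 / t * T n" if "0 < t" "0 < n" "r \<le> real n" for n t
  proof -
    let ?R = "real n" and ?A = "{x::'a. real n < norm x \<and> norm x < 2 * real n}"
    have R: "0 < ?R"
      using that by simp
    obtain b where b: "(\<integral>\<^sup>+x. indicator (U \<inter> ball 0 (2 * ?R)) x * ennreal ((w x - b)\<^sup>2) \<partial>lborel) \<le> ennreal (K * ?R\<^sup>2)"
      using K(2)[OF R] by blast
    let ?h = "\<lambda>x. indicator ?A x * (w x - b)\<^sup>2"
    have "?A \<in> sets borel"
      by measurable
    then have hm: "?h \<in> borel_measurable ?M"
      by (intro borel_measurable_times ind meas continuous_intros cw)
    have "(\<integral>\<^sup>+x. ennreal (?h x) \<partial>?M) = (\<integral>\<^sup>+x. ennreal (?h x) * indicator D x \<partial>lborel)"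
      using D(1) by (simp add: nn_integral_restrict_space nn_integral_completion)
    also have "\<dots> \<le> (\<integral>\<^sup>+x. indicator (U \<inter> ball 0 (2 * ?R)) x * ennreal ((w x - b)\<^sup>2) \<partial>lborel)"
      using that(3) by (intro nn_integral_mono) (auto simp: indicator_def U(2))
    also note b
    finally have hle: "(\<integral>\<^sup>+x. ennreal (?h x) \<partial>?M) \<le> ennreal (K * ?R\<^sup>2)" .
    have J: "integrable ?M ?h"
      using hm order.strict_trans1[OF hle ennreal_less_top] by (intro integrableI_nonneg) auto
    have "ennreal (\<integral>x. ?h x \<partial>?M) \<le> ennreal (K * ?R\<^sup>2)"
      using nn_integral_eq_integral[OF J] hle by simp
    then have hK: "(\<integral>x. ?h x \<partial>?M) \<le> K * ?R\<^sup>2"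
      using K(1) by (subst (asm) ennreal_le_iff) auto
    have "I n \<le> t / ?R\<^sup>2 * (\<integral>x. indicator ?A x * (w x - b)\<^sup>2 \<partial>?M) + 36 / t * T n"
      unfolding I_def T_def E_def
      by (rule cutoff_energy_le[OF D(1) deriv cont int orth R that(1) J])
    also have "\<dots> \<le> t / ?R\<^sup>2 * (K * ?R\<^sup>2) + 36 / t * T n"
      using that(1) by (intro add_right_mono mult_left_mono hK) simp
    also have "t / ?R\<^sup>2 * (K * ?R\<^sup>2) = t * K"
      using R by simp
    finally show ?thesis .
  qed
  have pos: "0 < 1 + (w x)\<^sup>2" for x
    by (simp add: add_pos_nonneg)
  have q: "0 \<le> E x / (1 + (w x)\<^sup>2)" "E x / (1 + (w x)\<^sup>2) \<le> E x" for x
  proof -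
    show "0 \<le> E x / (1 + (w x)\<^sup>2)"
      using E0(1)[of x] pos[of x] by simp
    have "E x / (1 + (w x)\<^sup>2) \<le> E x / 1"
      using E0(1)[of x] pos[of x] by (intro divide_left_mono) auto
    then show "E x / (1 + (w x)\<^sup>2) \<le> E x" by simp
  qed
  have cq: "continuous_on D (\<lambda>x. E x / (1 + (w x)\<^sup>2))"
    by (intro continuous_intros cE cw) (use pos in \<open>auto simp: less_imp_neq[symmetric]\<close>)
  have I_lim: "I \<longlonglongrightarrow> (\<integral>x. E x / (1 + (w x)\<^sup>2) \<partial>?M)"
    unfolding I_def
  proof (rule integral_dominated_convergence[OF _ _ Eint])
    show "(\<lambda>x. E x / (1 + (w x)\<^sup>2)) \<in> borel_measurable ?M"
      by (rule meas[OF cq])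
    show "(\<lambda>x. indicator (cball 0 (real n)) x * (E x / (1 + (w x)\<^sup>2))) \<in> borel_measurable ?M" for n
      by (intro borel_measurable_times ind meas[OF cq]) simp
    show "AE x in ?M. (\<lambda>n. indicator (cball 0 (real n)) x * (E x / (1 + (w x)\<^sup>2))) \<longlonglongrightarrow> E x / (1 + (w x)\<^sup>2)"
    proof (rule AE_I2, rule tendsto_eventually)
      fix x :: 'a
      obtain N :: nat where N: "norm x \<le> real N"
        using real_arch_simple by blast
      show "\<forall>\<^sub>F n in sequentially. indicator (cball 0 (real n)) x * (E x / (1 + (w x)\<^sup>2)) = E x / (1 + (w x)\<^sup>2)"
        by (rule eventually_mono[OF eventually_ge_at_top[of N]]) (use N in auto)
    qed
    show "AE x in ?M. norm (indicator (cball 0 (real n)) x * (E x / (1 + (w x)\<^sup>2))) \<le> E x" for n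
      using q E0 by (intro AE_I2) (auto simp: indicator_def abs_of_nonneg)
  qed
  have T_lim: "T \<longlonglongrightarrow> (\<integral>x. 0 \<partial>?M)"
    unfolding T_def
  proof (rule integral_dominated_convergence[OF _ _ Eint])
    show "(\<lambda>x. indicator {x. real n < norm x} x * E x) \<in> borel_measurable ?M" for n
      by (intro borel_measurable_times ind meas[OF cE]) measurable
    show "AE x in ?M. (\<lambda>n. indicator {x. real n < norm x} x * E x) \<longlonglongrightarrow> 0"
    proof (rule AE_I2, rule tendsto_eventually)
      fix x :: 'a
      obtain N :: nat where N: "norm x \<le> real N"
        using real_arch_simple by blast
      show "\<forall>\<^sub>F n in sequentially. indicator {x. real n < norm x} x * E x = 0"
        by (rule eventually_mono[OF eventually_ge_at_top[of N]]) (use N in auto)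
    qed
    show "AE x in ?M. norm (indicator {x. real n < norm x} x * E x) \<le> E x" for n
      using E0 by (intro AE_I2) (auto simp: indicator_def)
  qed simp
  have Ile: "(\<integral>x. E x / (1 + (w x)\<^sup>2) \<partial>?M) \<le> t * K" if "0 < t" for t
  proof (rule LIMSEQ_le[OF I_lim])
    have "(\<lambda>n. t * K + 36 / t * T n) \<longlonglongrightarrow> t * K + 36 / t * (\<integral>x. 0 \<partial>?M)"
      by (intro tendsto_intros T_lim)
    then show "(\<lambda>n. t * K + 36 / t * T n) \<longlonglongrightarrow> t * K"
      by simp
    obtain N :: nat where "r \<le> real N"
      using real_arch_simple by blast
    then show "\<exists>N. \<forall>n\<ge>N. I n \<le> t * K + 36 / t * T n"
      using main[OF that] by (intro exI[of _ "Suc N"]) auto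
  qed
  have "(\<integral>x. E x / (1 + (w x)\<^sup>2) \<partial>?M) \<le> 0"
  proof (rule field_le_epsilon)
    fix \<epsilon> :: real assume "0 < \<epsilon>"
    then have "(\<integral>x. E x / (1 + (w x)\<^sup>2) \<partial>?M) \<le> \<epsilon> / (K + 1) * K"
      using K(1) by (intro Ile) simp
    also have "\<dots> \<le> \<epsilon>"
      using K(1) \<open>0 < \<epsilon>\<close> by (simp add: field_simps)
    finally show "(\<integral>x. E x / (1 + (w x)\<^sup>2) \<partial>?M) \<le> 0 + \<epsilon>" by simp
  qed
  moreover have "0 \<le> (\<integral>x. E x / (1 + (w x)\<^sup>2) \<partial>?M)"
    by (intro Bochner_Integration.integral_nonneg q)
  ultimately have "(\<integral>x. E x / (1 + (w x)\<^sup>2) \<partial>?M) = 0"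
    by linarith
  moreover have "integrable ?M (\<lambda>x. E x / (1 + (w x)\<^sup>2))"
  proof (rule Bochner_Integration.integrable_bound[OF Eint meas[OF cq]])
    show "AE x in ?M. norm (E x / (1 + (w x)\<^sup>2)) \<le> norm (E x)"
      using q E0 by (intro AE_I2) simp
  qed
  ultimately have "AE x in ?M. E x / (1 + (w x)\<^sup>2) = 0"
    using q(1) by (subst (asm) integral_nonneg_eq_0_iff_AE) auto
  then have AE0: "AE x in ?M. E x = 0"
    by eventually_elim (use pos in \<open>simp add: less_imp_neq[symmetric]\<close>)
  have w'0: "w' p = (\<lambda>h. 0)" if p: "p \<in> D" for p
  proof -
    obtain \<rho> where \<rho>: "0 < \<rho>" "cball p (3 * \<rho>) \<subseteq> D"
      using open_contains_cball_mult[OF D(1) p, of 3] by auto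
    have "measure \<mu> (ball p \<rho>) = 0"
      unfolding mu[OF borel_open[OF open_ball]]
      using AE0 by (intro integral_eq_zero_AE) (auto elim!: eventually_mono)
    then show ?thesis
      using est'[OF \<rho>] by auto
  qed
  obtain x0 where "x0 \<in> D"
    using D(3) by blast
  have "w x = w x0" if "x \<in> D" for x
  proof (rule has_derivative_zero_unique_connected[OF D(1,2) _ that \<open>x0 \<in> D\<close>])
    fix y assume "y \<in> D"
    from deriv[OF this] w'0[OF this] show "(w has_derivative (\<lambda>h. 0)) (at y)"
      by simp
  qed
  moreover have "AE x in ?M. x \<in> D"
    by (rule AE_I2) simp
  ultimately have "AE x in ?M. u x = w x0"
    using ae by (auto elim: eventually_elim2)
  then show ?thesis by blast
qed

theorem proposition3p6:
  fixes D :: "'a::euclidean_space set"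
  assumes "DIM('a) \<ge> 3"
    and "\<not> bounded D"
    and "class_D D"
    and "\<exists>r>0. uniform_domain (D - closure (ball 0 r))"
  shows "H_star D = {u. \<exists>c::real. AE x in lebesgue_on D. u x = c}"
proof
  have dom: "open D" "connected D" "D \<noteq> {}"
    using assms(3) by (auto simp: class_D_def is_domain_def)
  show "{u. \<exists>c::real. AE x in lebesgue_on D. u x = c} \<subseteq> H_star D"
    using AE_const_in_H_star[OF dom(1)] by blast
  obtain r where r: "r > 0" "uniform_domain (D - closure (ball 0 r))"
    using assms(4) by blast
  define U where "U = D - cball 0 r"
  have "uniform_domain U"
    using r by (simp add: U_def)
  moreover have "0 \<in> - U"
    using r(1) by (simp add: U_def)
  then have "- U \<noteq> {}"
    by blast
  ultimately obtain C where C: "uniform_const U C"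
    by (rule uniform_domain_imp_uniform_const)
  have "\<not> bounded U"
  proof
    assume "bounded U"
    then have "bounded (U \<union> cball 0 r)"
      by simp
    then have "bounded D"
      by (rule bounded_subset) (auto simp: U_def)
    with assms(2) show False ..
  qed
  then show "H_star D \<subseteq> {u. \<exists>c::real. AE x in lebesgue_on D. u x = c}"
    using H_star_imp_AE_const[OF dom _ C U_def] by blast
qed

end
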